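(* Let $P$ be a propositional proof system that simulates Extended Frege EF and such that for some constant $c\ge1$: (i) whenever $\sigma\in$ TAUT and $\sigma'$ is obtained from $\sigma$ by substituting constants $0$ or $1$ for some atoms, $s_P(\sigma')\le s_P(\sigma)^c$; and (ii) for all formulas $\alpha,\beta$, $s_P(\beta)\le (s_P(\alpha)+s_P(\alpha\to\beta))^c$. Assume there exists a polynomial-time function $g:\{0,1\}^*\to\{0,1\}^*$ stretching all inputs of size $n$ to size $m(n)>n$ which is $\bigvee$-hard for $P$. Then the gadget generator $\mathrm{Gad}_f$ based on $f=CV_{k^2,k}$ is $\bigvee$-hard (and hence also hard) for $P$.
   Context: A propositional proof system (pps) is a polynomial-time relation $P(x,y)$ with $\exists xP(x,y)$ iff $y\in$ TAUT; $s_P(\tau)$ is the minimal size of a $P$-proof of $\tau$. $P$ simulates $Q$ iff there is $c$ with $s_P(\sigma)\le s_Q(\sigma)^c$ for all $\sigma\in$ TAUT. For a generator $g$ (stretching size-$n$ inputs to size $m=m(n)>n$, $g_n$ computed by a circuit $C_n$ of size $m^{O(1)}$) and $b\in\{0,1\}^m$, $\tau(g_n)_b$ is the natural size-$m^{O(1)}$ propositional encoding of "$|x|=n\to C_n(x)\neq b$". $g$ is hard for $P$ if for every $c$ only finitely many tautologies $\tau(g_n)_b$ have $P$-proofs of size $\le |\tau(g_n)_b|^c$; $g$ is $\bigvee$-hard for $P$ if for every $c\ge1$ only finitely many disjunctions $\tau(g_n)_{b_1}\vee\dots\vee\tau(g_n)_{b_r}$ ($n,r\ge1$, $b_i\in\{0,1\}^m$,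 disjuncts in disjoint atoms) have $P$-proofs of size $\le m^c$. Gadget generator: for a p-time $f:\{0,1\}^\ell\times\{0,1\}^k\to\{0,1\}^{k+1}$, $\mathrm{Gad}_f:\{0,1\}^n\to\{0,1\}^{n+1}$ with $n=\ell+k(\ell+1)$ interprets its input as $v\in\{0,1\}^\ell$ and $u^1,\dots,u^{\ell+1}\in\{0,1\}^k$ and outputs the concatenation of $w^s=f(v,u^s)$, $s=1,\dots,\ell+1$. The circuit value function $CV_{a,k}(v,u)$ takes a size-$a$ description $v$ of a circuit with $k$ inputs and $k+1$ outputs and $u\in\{0,1\}^k$ and returns the circuit's output on $u$ (so here $\ell=k^2$).
   Formalization: The proof system's relation P(x,y) is required to be decidable in time polynomial in the proof length |x| alone, so a formula is at most polynomially longer than its proofs; with time polynomial in |x|+|y|, trivial proofs of gadget disjunctions could be added and the claim fails. *)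

theory Defs
  imports "HOL-Library.Extended_Nat"
begin

section \<open>Propositional formulas and their binary encoding\<close>

datatype (atoms: 'a) form =
    Cst bool
  | At 'a
  | Neg "'a form"
  | Con "'a form" "'a form"
  | Dis "'a form" "'a form"
  | Imp "'a form" "'a form"
  for map: rename

type_synonym fm = "nat form"

fun fm_eval :: "('a \<Rightarrow> bool) \<Rightarrow> 'a form \<Rightarrow> bool" where
  "fm_eval e (Cst b) = b"
| "fm_eval e (At a) = e a"
| "fm_eval e (Neg \<phi>) = (\<not> fm_eval e \<phi>)"
| "fm_eval e (Con \<phi> \<psi>) = (fm_eval e \<phi> \<and> fm_eval e \<psi>)"
| "fm_eval e (Dis \<phi> \<psi>) = (fm_eval e \<phi> \<or> fm_eval e \<psi>)"
| "fm_eval e (Imp \<phi> \<psi>) = (fm_eval e \<phi> \<longrightarrow> fm_eval e \<psi>)"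

definition tautology :: "fm \<Rightarrow> bool" where
  "tautology \<phi> \<longleftrightarrow> (\<forall>e. fm_eval e \<phi>)"

definition Iff :: "'a form \<Rightarrow> 'a form \<Rightarrow> 'a form" where
  "Iff \<phi> \<psi> = Con (Imp \<phi> \<psi>) (Imp \<psi> \<phi>)"

fun Conj :: "'a form list \<Rightarrow> 'a form" where
  "Conj [] = Cst True"
| "Conj [\<phi>] = \<phi>"
| "Conj (\<phi> # \<psi> # \<phi>s) = Con \<phi> (Conj (\<psi> # \<phi>s))"

fun Disj :: "'a form list \<Rightarrow> 'a form" where
  "Disj [] = Cst False"
| "Disj [\<phi>] = \<phi>"
| "Disj (\<phi> # \<psi> # \<phi>s) = Dis \<phi> (Disj (\<psi> # \<phi>s))"

text \<open>Substitution of constants for some of the atoms: atoms mapped to \<open>None\<close> are kept.\<close>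

fun inst :: "('a \<Rightarrow> bool option) \<Rightarrow> 'a form \<Rightarrow> 'a form" where
  "inst \<theta> (Cst b) = Cst b"
| "inst \<theta> (At a) = (case \<theta> a of None \<Rightarrow> At a | Some b \<Rightarrow> Cst b)"
| "inst \<theta> (Neg \<phi>) = Neg (inst \<theta> \<phi>)"
| "inst \<theta> (Con \<phi> \<psi>) = Con (inst \<theta> \<phi>) (inst \<theta> \<psi>)"
| "inst \<theta> (Dis \<phi> \<psi>) = Dis (inst \<theta> \<phi>) (inst \<theta> \<psi>)"
| "inst \<theta> (Imp \<phi> \<psi>) = Imp (inst \<theta> \<phi>) (inst \<theta> \<psi>)"

text \<open>A prefix-free binary code; indices of atoms are written in binary, each digit preceded by a
  continuation bit.\<close>

fun enc_nat :: "nat \<Rightarrow> bool list" where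
  "enc_nat n = (if n = 0 then [False] else True # odd n # enc_nat (n div 2))"

declare enc_nat.simps [simp del]

fun enc :: "fm \<Rightarrow> bool list" where
  "enc (Cst b) = [False, False, b]"
| "enc (At a) = [False, True, False] @ enc_nat a"
| "enc (Neg \<phi>) = [False, True, True] @ enc \<phi>"
| "enc (Con \<phi> \<psi>) = [True, False, False] @ enc \<phi> @ enc \<psi>"
| "enc (Dis \<phi> \<psi>) = [True, False, True] @ enc \<phi> @ enc \<psi>"
| "enc (Imp \<phi> \<psi>) = [True, True, False] @ enc \<phi> @ enc \<psi>"

definition TAUT :: "bool list set" where
  "TAUT = {enc \<phi> | \<phi>. tautology \<phi>}"

definition fm_size :: "fm \<Rightarrow> nat" where
  "fm_size \<phi> = length (enc \<phi>)"


section \<open>Polynomial time\<close>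

text \<open>Deterministic Turing machines with one tape, infinite to the right. The states are
  \<open>0, \<dots>, states M\<close>, of which \<open>0\<close> is initial and \<open>states M\<close> is the halting state. Symbol \<open>0\<close> is the
  blank, \<open>1\<close> and \<open>2\<close> stand for the two bits, and \<open>3\<close> separates the two arguments of a relation.\<close>

datatype move = Lft | Stay | Rgt

datatype tm = TM (states: nat) (symbols: nat) (delta: "nat \<Rightarrow> nat \<Rightarrow> nat \<times> nat \<times> move")

definition tm_wf :: "tm \<Rightarrow> bool" where
  "tm_wf M \<longleftrightarrow> 4 \<le> symbols M \<and>
     (\<forall>q < states M. \<forall>a < symbols M.
        case delta M q a of (q', a', _) \<Rightarrow> q' \<le> states M \<and> a' < symbols M)"

fun tm_step :: "tm \<Rightarrow> nat \<times> nat \<times> (nat \<Rightarrow> nat) \<Rightarrow> nat \<times> nat \<times> (nat \<Rightarrow> nat)" where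
  "tm_step M (q, h, t) =
     (if q < states M
      then case delta M q (t h) of (q', a, d) \<Rightarrow>
             (q', case d of Lft \<Rightarrow> h - 1 | Stay \<Rightarrow> h | Rgt \<Rightarrow> h + 1, t(h := a))
      else (q, h, t))"

definition tm_init :: "nat list \<Rightarrow> nat \<times> nat \<times> (nat \<Rightarrow> nat)" where
  "tm_init w = (0, 0, \<lambda>i. if i < length w then w ! i else 0)"

definition sym :: "bool \<Rightarrow> nat" where
  "sym b = (if b then 2 else 1)"

text \<open>The output is the bit string in front of the first blank.\<close>

definition tm_computes :: "tm \<Rightarrow> nat list \<Rightarrow> bool list \<Rightarrow> nat \<Rightarrow> bool" where
  "tm_computes M w out T \<longleftrightarrow>
     (case (tm_step M ^^ T) (tm_init w) of (q, h, t) \<Rightarrow>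
        q = states M \<and> (\<forall>i < length out. t i = sym (out ! i)) \<and> t (length out) = 0)"

definition ptime_fun :: "(bool list \<Rightarrow> bool list) \<Rightarrow> bool" where
  "ptime_fun g \<longleftrightarrow>
     (\<exists>M d. tm_wf M \<and> (\<forall>x. tm_computes M (map sym x) (g x) (length x ^ d + d)))"


section \<open>Propositional proof systems\<close>

text \<open>The running time of the verifier is measured in the length of the proof, as it is for a system
  given by a Cook--Reckhow function. Measured in the joint length, a single short string could be a
  proof of infinitely many, arbitrarily long, formulas, and the length of a formula would not be
  polynomially bounded by the length of its proofs.\<close>

definition ptime_verifiable :: "(bool list \<Rightarrow> bool list \<Rightarrow> bool) \<Rightarrow> bool" where
  "ptime_verifiable P \<longleftrightarrow>
     (\<exists>M d. tm_wf M \<and>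
        (\<forall>x y. tm_computes M (map sym x @ [3] @ map sym y) [P x y] (length x ^ d + d)))"

definition pps :: "(bool list \<Rightarrow> bool list \<Rightarrow> bool) \<Rightarrow> bool" where
  "pps P \<longleftrightarrow> ptime_verifiable P \<and> (\<forall>y. (\<exists>x. P x y) \<longleftrightarrow> y \<in> TAUT)"

text \<open>The minimal size of a proof; \<open>\<infinity>\<close> if there is none.\<close>

definition min_size :: "(bool list \<Rightarrow> bool list \<Rightarrow> bool) \<Rightarrow> fm \<Rightarrow> enat" where
  "min_size P \<phi> = (INF x \<in> {x. P x (enc \<phi>)}. enat (length x))"

definition simulates ::
  "(bool list \<Rightarrow> bool list \<Rightarrow> bool) \<Rightarrow> (bool list \<Rightarrow> bool list \<Rightarrow> bool) \<Rightarrow> bool" where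
  "simulates P Q \<longleftrightarrow> (\<exists>c. \<forall>\<sigma>. tautology \<sigma> \<longrightarrow> min_size P \<sigma> \<le> min_size Q \<sigma> ^ c)"


subsection \<open>Extended Frege\<close>

inductive frege_axiom :: "fm \<Rightarrow> bool" where
  "frege_axiom (Imp \<phi> (Imp \<psi> \<phi>))"
| "frege_axiom (Imp (Imp \<phi> (Imp \<psi> \<chi>)) (Imp (Imp \<phi> \<psi>) (Imp \<phi> \<chi>)))"
| "frege_axiom (Imp (Con \<phi> \<psi>) \<phi>)"
| "frege_axiom (Imp (Con \<phi> \<psi>) \<psi>)"
| "frege_axiom (Imp \<phi> (Imp \<psi> (Con \<phi> \<psi>)))"
| "frege_axiom (Imp \<phi> (Dis \<phi> \<psi>))"
| "frege_axiom (Imp \<psi> (Dis \<phi> \<psi>))"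
| "frege_axiom (Imp (Imp \<phi> \<chi>) (Imp (Imp \<psi> \<chi>) (Imp (Dis \<phi> \<psi>) \<chi>)))"
| "frege_axiom (Imp (Imp \<phi> \<psi>) (Imp (Imp \<phi> (Neg \<psi>)) (Neg \<phi>)))"
| "frege_axiom (Imp (Neg (Neg \<phi>)) \<phi>)"
| "frege_axiom (Cst True)"
| "frege_axiom (Imp (Cst False) \<phi>)"

definition ef_derivation :: "fm list \<Rightarrow> bool" where
  "ef_derivation \<pi> \<longleftrightarrow> \<pi> \<noteq> [] \<and>
     (\<forall>i < length \<pi>.
        frege_axiom (\<pi> ! i) \<or>
        (\<exists>j < i. \<exists>k < i. \<pi> ! k = Imp (\<pi> ! j) (\<pi> ! i)) \<or>
        (\<exists>q \<psi>. \<pi> ! i = Iff (At q) \<psi> \<and> q \<notin> atoms \<psi> \<and>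
               (\<forall>j < i. q \<notin> atoms (\<pi> ! j)) \<and> q \<notin> atoms (last \<pi>)))"

definition EF :: "bool list \<Rightarrow> bool list \<Rightarrow> bool" where
  "EF x y \<longleftrightarrow> (\<exists>\<pi>. ef_derivation \<pi> \<and> x = concat (map enc \<pi>) \<and> y = enc (last \<pi>))"


section \<open>Circuits\<close>

text \<open>The nodes of a circuit are its inputs followed by its gates, numbered from \<open>0\<close>. A reference to
  a node that is not available has the value \<open>0\<close>, so that every bit string describes a circuit.\<close>

datatype gate = GConst bool | GNot nat | GAnd nat nat | GOr nat nat

datatype circuit = Circuit (inputs: nat) (gates: "gate list") (outputs: "nat list")

definition at0 :: "bool list \<Rightarrow> nat \<Rightarrow> bool" where
  "at0 vs j \<longleftrightarrow> j < length vs \<and> vs ! j"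

fun gate_eval :: "(nat \<Rightarrow> bool) \<Rightarrow> gate \<Rightarrow> bool" where
  "gate_eval e (GConst b) = b"
| "gate_eval e (GNot i) = (\<not> e i)"
| "gate_eval e (GAnd i j) = (e i \<and> e j)"
| "gate_eval e (GOr i j) = (e i \<or> e j)"

definition nodes :: "circuit \<Rightarrow> bool list \<Rightarrow> bool list" where
  "nodes C x = foldl (\<lambda>vs g. vs @ [gate_eval (at0 vs) g]) x (gates C)"

definition run :: "circuit \<Rightarrow> bool list \<Rightarrow> bool list" where
  "run C x = map (at0 (nodes C x)) (outputs C)"


subsection \<open>Definition sequences and the formulas \<open>\<tau>\<close>\<close>

text \<open>A definition sequence is what the propositional encoding needs to know of a circuit: atoms
  \<open>0, \<dots>, arity D - 1\<close> are the inputs, atom \<open>arity D + i\<close> is defined by \<open>defs D ! i\<close> from atoms of smaller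
  index, and the outputs are formulas in these atoms.\<close>

datatype defseq = Defseq (arity: nat) (defs: "fm list") (outs: "fm list")

definition defseq_eval :: "defseq \<Rightarrow> bool list \<Rightarrow> bool list" where
  "defseq_eval D x =
     map (fm_eval (at0 (foldl (\<lambda>vs \<phi>. vs @ [fm_eval (at0 vs) \<phi>]) x (defs D)))) (outs D)"

definition defseq_size :: "defseq \<Rightarrow> nat" where
  "defseq_size D = sum_list (map fm_size (defs D)) + sum_list (map fm_size (outs D))"

definition num_atoms :: "defseq \<Rightarrow> nat" where
  "num_atoms D = arity D + length (defs D)"

definition tau :: "defseq \<Rightarrow> bool list \<Rightarrow> fm" where
  "tau D b =
     Imp (Conj (map (\<lambda>i. Iff (At (arity D + i)) (defs D ! i)) [0..<length (defs D)]))
         (Disj (map2 (\<lambda>\<phi> \<beta>. if \<beta> then Neg \<phi> else \<phi>) (outs D) b))"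

definition node_fm :: "nat \<Rightarrow> nat \<Rightarrow> fm" where
  "node_fm l j = (if j < l then At j else Cst False)"

fun gate_fm :: "nat \<Rightarrow> gate \<Rightarrow> fm" where
  "gate_fm l (GConst b) = Cst b"
| "gate_fm l (GNot i) = Neg (node_fm l i)"
| "gate_fm l (GAnd i j) = Con (node_fm l i) (node_fm l j)"
| "gate_fm l (GOr i j) = Dis (node_fm l i) (node_fm l j)"

definition defseq_of :: "circuit \<Rightarrow> defseq" where
  "defseq_of C =
     Defseq (inputs C)
       (map (\<lambda>i. gate_fm (inputs C + i) (gates C ! i)) [0..<length (gates C)])
       (map (node_fm (inputs C + length (gates C))) (outputs C))"


section \<open>Proof complexity generators\<close>

text \<open>A generator is a family of functions, computed by the members of a family of definition
  sequences; the latter fixes the formulas \<open>\<tau>\<close>. The members are indexed by \<open>k \<ge> 1\<close>: the input length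
  for a function on strings, the block length for a gadget generator.\<close>

definition generator :: "(nat \<Rightarrow> bool list \<Rightarrow> bool list) \<Rightarrow> (nat \<Rightarrow> defseq) \<Rightarrow> bool" where
  "generator G D \<longleftrightarrow>
     (\<forall>k \<ge> 1. arity (D k) < length (outs (D k)) \<and>
        (\<forall>x. length x = arity (D k) \<longrightarrow> defseq_eval (D k) x = G k x)) \<and>
     (\<exists>d. \<forall>k \<ge> 1. defseq_size (D k) \<le> length (outs (D k)) ^ d)"

definition hard :: "(bool list \<Rightarrow> bool list \<Rightarrow> bool) \<Rightarrow> (nat \<Rightarrow> defseq) \<Rightarrow> bool" where
  "hard P D \<longleftrightarrow>
     (\<forall>c. finite {\<phi>. \<exists>k b. k \<ge> 1 \<and> length b = length (outs (D k)) \<and> \<phi> = tau (D k) b \<and>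
                       min_size P \<phi> \<le> enat (fm_size \<phi> ^ c)})"

text \<open>The disjuncts may be written in any pairwise disjoint sets of atoms: \<open>\<rho> i\<close> names the atoms of
  the \<open>i\<close>-th disjunct. A proof system need not be closed under renaming of atoms.\<close>

definition vee_hard :: "(bool list \<Rightarrow> bool list \<Rightarrow> bool) \<Rightarrow> (nat \<Rightarrow> defseq) \<Rightarrow> bool" where
  "vee_hard P D \<longleftrightarrow>
     (\<forall>c \<ge> 1. finite {\<phi>. \<exists>k bs \<rho>. k \<ge> 1 \<and> bs \<noteq> [] \<and>
        (\<forall>b \<in> set bs. length b = length (outs (D k))) \<and>
        inj_on (\<lambda>(i, a). \<rho> i a) ({..<length bs} \<times> {..<num_atoms (D k)}) \<and>
        \<phi> = Disj (map (\<lambda>i. rename (\<rho> i) (tau (D k) (bs ! i))) [0..<length bs]) \<and>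
        min_size P \<phi> \<le> enat (length (outs (D k)) ^ c)})"


section \<open>The gadget generator of the circuit value function\<close>

definition gad :: "nat \<Rightarrow> nat \<Rightarrow> (bool list \<Rightarrow> bool list \<Rightarrow> bool list) \<Rightarrow> bool list \<Rightarrow> bool list" where
  "gad l k f x =
     concat (map (\<lambda>s. f (take l x) (take k (drop (l + s * k) x))) [0..<l + 1])"

text \<open>A description of \<open>a\<close> bits of a circuit with \<open>k\<close> inputs and \<open>k + 1\<close> outputs consists of the
  \<open>k + 1\<close> output nodes, followed by as many gates as fit. Node numbers are written in binary (least
  significant bit first) with \<open>addr_len a k\<close> bits; a gate is given by two bits for its kind and two
  node numbers. A constant gate takes its value from the first bit after the kind. Bits beyond the
  end of the description, which are needed only for small \<open>k\<close>, are read as \<open>0\<close>.\<close>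

definition addr_len :: "nat \<Rightarrow> nat \<Rightarrow> nat" where
  "addr_len a k = (LEAST w. a + k \<le> 2 ^ w)"

definition num_gates :: "nat \<Rightarrow> nat \<Rightarrow> nat" where
  "num_gates a k = (a - (k + 1) * addr_len a k) div (2 + 2 * addr_len a k)"

definition gate_pos :: "nat \<Rightarrow> nat \<Rightarrow> nat \<Rightarrow> nat" where
  "gate_pos a k i = (k + 1) * addr_len a k + i * (2 + 2 * addr_len a k)"

definition read_addr :: "bool list \<Rightarrow> nat \<Rightarrow> nat \<Rightarrow> nat" where
  "read_addr v w p = (\<Sum>j<w. of_bool (at0 v (p + j)) * 2 ^ j)"

definition read_gate :: "bool list \<Rightarrow> nat \<Rightarrow> nat \<Rightarrow> gate" where
  "read_gate v w p =
     (let i = read_addr v w (p + 2); j = read_addr v w (p + 2 + w) in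
      if at0 v p
      then (if at0 v (p + 1) then GConst (at0 v (p + 2)) else GOr i j)
      else (if at0 v (p + 1) then GAnd i j else GNot i))"

definition decode :: "nat \<Rightarrow> nat \<Rightarrow> bool list \<Rightarrow> circuit" where
  "decode a k v =
     Circuit k
       (map (\<lambda>i. read_gate v (addr_len a k) (gate_pos a k i)) [0..<num_gates a k])
       (map (\<lambda>t. read_addr v (addr_len a k) (t * addr_len a k)) [0..<k + 1])"

definition CV :: "nat \<Rightarrow> nat \<Rightarrow> bool list \<Rightarrow> bool list \<Rightarrow> bool list" where
  "CV a k v u = run (decode a k v) u"


subsection \<open>Its definition sequence\<close>

text \<open>The atoms are the bits of \<open>v\<close>, the bits of \<open>u\<^sup>1, \<dots>, u\<^bsup>a+1\<^esup>\<close>, and one atom for each gate of the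
  circuit described by \<open>v\<close>, for each of its \<open>a + 1\<close> evaluations. The decoding of the description is
  expressed by formulas, without atoms of its own: closure under substitution of constants alone gives no
  way to eliminate atoms that merely name subformulas.\<close>

definition desc_fm :: "nat \<Rightarrow> nat \<Rightarrow> fm" where
  "desc_fm a p = (if p < a then At p else Cst False)"

definition addr_fm :: "nat \<Rightarrow> nat \<Rightarrow> nat \<Rightarrow> nat \<Rightarrow> fm" where
  "addr_fm a w p j =
     Conj (map (\<lambda>t. if odd (j div 2 ^ t) then desc_fm a (p + t) else Neg (desc_fm a (p + t))) [0..<w])"

definition select_fm :: "nat \<Rightarrow> nat \<Rightarrow> nat \<Rightarrow> nat \<Rightarrow> (nat \<Rightarrow> fm) \<Rightarrow> fm" where
  "select_fm a w p l nd = Disj (map (\<lambda>j. Con (addr_fm a w p j) (nd j)) [0..<l])"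

definition cv_gate_fm :: "nat \<Rightarrow> nat \<Rightarrow> nat \<Rightarrow> nat \<Rightarrow> (nat \<Rightarrow> fm) \<Rightarrow> fm" where
  "cv_gate_fm a w p l nd =
     (let d = desc_fm a p; e = desc_fm a (p + 1);
          x = select_fm a w (p + 2) l nd; y = select_fm a w (p + 2 + w) l nd in
      Disj [Con (Con (Neg d) (Neg e)) (Neg x),
            Con (Con (Neg d) e) (Con x y),
            Con (Con d (Neg e)) (Dis x y),
            Con (Con d e) (desc_fm a (p + 2))])"

definition cv_node :: "nat \<Rightarrow> nat \<Rightarrow> nat \<Rightarrow> nat \<Rightarrow> fm" where
  "cv_node a k s j =
     At (if j < k then a + s * k + j else a + (a + 1) * k + s * num_gates a k + (j - k))"

definition gad_CV :: "nat \<Rightarrow> nat \<Rightarrow> defseq" where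
  "gad_CV a k =
     Defseq (a + (a + 1) * k)
       (concat (map (\<lambda>s. map (\<lambda>i. cv_gate_fm a (addr_len a k) (gate_pos a k i) (k + i) (cv_node a k s))
                             [0..<num_gates a k]) [0..<a + 1]))
       (concat (map (\<lambda>s. map (\<lambda>t. select_fm a (addr_len a k) (t * addr_len a k) (k + num_gates a k)
                                    (cv_node a k s)) [0..<k + 1]) [0..<a + 1]))"

end

theory Submission
  imports Defs
begin

text \<open>Let a disjunction of formulas \<open>\<tau>\<close> of the gadget generator for block length \<open>k\<close> have a short
  \<open>P\<close>-proof. Take the largest \<open>n\<close> such that a polynomial bound on the size of the circuit computing
  \<open>g\<close> on inputs of length \<open>n\<close> does not exceed \<open>k\<close>, so that \<open>k\<close> is polynomial in \<open>n\<close>. The first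
  \<open>n + 1\<close> outputs of that circuit, together with copies of \<open>k - n\<close> more inputs, form a circuit from
  \<open>k\<close> to \<open>k + 1\<close> bits that has a description of \<open>k\<^sup>2\<close> bits. Substitute this description for the
  gadget, the prescribed output bits for the copied inputs, and \<open>0\<close> for the gates that are not
  needed. What remains says that one of many strings is not a value of \<open>g\<close>, and Frege proves in
  polynomial size that it implies the corresponding disjunction of formulas \<open>\<tau>\<close> for \<open>g\<close>, in the very
  atoms of the original: each conjunct and each disjunct depends on at most three atoms once the
  constants are propagated. Short \<open>P\<close>-proofs for infinitely many \<open>k\<close> would thus give short
  \<open>P\<close>-proofs for infinitely many \<open>n\<close>. The number of disjuncts is under control because a proof
  cannot be much shorter than the formula it proves.\<close>

section \<open>Codes of formulas and the length of proofs\<close>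

text \<open>The obstacle is how little \<open>P\<close> offers: constants may be substituted and
  modus ponens applied, but neither formulas nor new names can be substituted. So the passage from
  gadget to circuit is proved inside EF, as one implication between two concrete formulas. A single
  gadget definition may mention polynomially many description bits and nodes, so truth tables are
  out of reach. The substituted description decides every address lookup, however, and three-valued
  evaluation notices this without simplifying the formula; at most eight cases remain. One gadget
  disjunct says that a concatenation of k^2 + 1 blocks is not attained, and so becomes k^2 + 1
  disjuncts for \<open>g\<close>. This is where hardness for disjunctions, and not just for single
  formulas, is used. Finiteness is obtained through explicit bounds. Hardness of \<open>g\<close>
  bounds the size of all short-proof disjunctions for \<open>g\<close>; a disjunct for input length
  n has more than n symbols; hence n, then k < (n + 1)^e, and then the size of the gadget
  disjunction are bounded.\<close>

lemma enc_nat_prefix_free: "enc_nat n @ xs = enc_nat n' @ ys \<Longrightarrow> n = n' \<and> xs = ys"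
proof (induction n arbitrary: n' rule: less_induct)
  case (less n)
  show ?case
  proof (cases "n = 0 \<or> n' = 0")
    case True
    then show ?thesis
      using less.prems by (auto simp: enc_nat.simps[of n] enc_nat.simps[of n'] split: if_splits)
  next
    case False
    then have *: "odd n = odd n'" "enc_nat (n div 2) @ xs = enc_nat (n' div 2) @ ys"
      using less.prems by (simp_all add: enc_nat.simps[of n] enc_nat.simps[of n'])
    then have "n div 2 = n' div 2 \<and> xs = ys"
      using less.IH[of "n div 2" "n' div 2"] False by simp
    with * show ?thesis
      by (metis odd_two_times_div_two_succ even_two_times_div_two)
  qed
qed

text \<open>The leading bits fix the constructor and every component is self-delimiting. Arbitrary
  tails are carried along because the induction has to split off the first of two
  subformulas.\<close>

lemma enc_prefix_free: "enc \<phi> @ xs = enc \<psi> @ ys \<Longrightarrow> \<phi> = \<psi> \<and> xs = ys"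
proof (induction \<phi> arbitrary: \<psi> xs ys)
  case (Cst b)
  then show ?case by (cases \<psi>) auto
next
  case (At a)
  then show ?case by (cases \<psi>) (auto dest: enc_nat_prefix_free)
next
  case (Neg \<phi>)
  then show ?case by (cases \<psi>) auto
next
  case (Con \<phi>1 \<phi>2)
  from Con.prems obtain \<psi>1 \<psi>2 where \<psi>: "\<psi> = Con \<psi>1 \<psi>2" by (cases \<psi>) auto
  with Con.prems have "enc \<phi>1 @ (enc \<phi>2 @ xs) = enc \<psi>1 @ (enc \<psi>2 @ ys)" by simp
  from Con.IH(1)[OF this] Con.IH(2)[of xs \<psi>2 ys] show ?case by (simp add: \<psi>)
next
  case (Dis \<phi>1 \<phi>2)
  from Dis.prems obtain \<psi>1 \<psi>2 where \<psi>: "\<psi> = Dis \<psi>1 \<psi>2" by (cases \<psi>) auto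
  with Dis.prems have "enc \<phi>1 @ (enc \<phi>2 @ xs) = enc \<psi>1 @ (enc \<psi>2 @ ys)" by simp
  from Dis.IH(1)[OF this] Dis.IH(2)[of xs \<psi>2 ys] show ?case by (simp add: \<psi>)
next
  case (Imp \<phi>1 \<phi>2)
  from Imp.prems obtain \<psi>1 \<psi>2 where \<psi>: "\<psi> = Imp \<psi>1 \<psi>2" by (cases \<psi>) auto
  with Imp.prems have "enc \<phi>1 @ (enc \<phi>2 @ xs) = enc \<psi>1 @ (enc \<psi>2 @ ys)" by simp
  from Imp.IH(1)[OF this] Imp.IH(2)[of xs \<psi>2 ys] show ?case by (simp add: \<psi>)
qed

lemma inj_enc: "inj enc"
  using enc_prefix_free[of _ "[]" _ "[]"] by (auto intro: injI)

lemma finite_fm_size_le: "finite {\<phi>. fm_size \<phi> \<le> B}"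
proof -
  have "finite (enc ` {\<phi>. fm_size \<phi> \<le> B})"
    by (rule finite_subset[OF _ finite_lists_length_le[of "UNIV :: bool set" B]])
       (auto simp: fm_size_def)
  then show ?thesis
    using inj_enc by (meson finite_imageD inj_on_subset subset_UNIV)
qed

lemma length_enc_nat_le: "length (enc_nat n) \<le> 2 * n + 1"
proof (induction n rule: less_induct)
  case (less n)
  show ?case
  proof (cases "n = 0")
    case False
    then have "length (enc_nat (n div 2)) \<le> 2 * (n div 2) + 1"
      using less by simp
    moreover have "n div 2 < n" using False by simp
    moreover have "length (enc_nat n) = length (enc_nat (n div 2)) + 2"
      using False by (simp add: enc_nat.simps[of n])
    ultimately show ?thesis
      using False by linarith
  qed (simp add: enc_nat.simps)
qed

text \<open>A finite bound excludes the empty infimum, which is \<infinity>, and a nonempty infimum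
  in \<open>enat\<close> is attained.\<close>

lemma min_size_leE:
  assumes "min_size P \<phi> \<le> enat B"
  obtains x where "P x (enc \<phi>)" "length x \<le> B"
proof -
  let ?S = "(\<lambda>x. enat (length x)) ` {x. P x (enc \<phi>)}"
  have "?S \<noteq> {}"
    using assms by (force simp: min_size_def top_enat_def)
  then have "Inf ?S \<in> ?S"
    by (auto simp: Inf_enat_def intro: LeastI)
  then show ?thesis
    using assms that by (auto simp: min_size_def)
qed

lemma min_size_le: "P x (enc \<phi>) \<Longrightarrow> min_size P \<phi> \<le> enat (length x)"
  unfolding min_size_def by (rule INF_lower) simp

text \<open>A machine reads at most one cell per step.\<close>

lemma tm_step_local:
  assumes "t \<le> T"
    and "\<forall>i < T. snd (snd c0) i = snd (snd c0') i" "fst c0 = fst c0'"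
    and "fst (snd c0) = 0" "fst (snd c0') = 0"
  shows "(case ((tm_step M ^^ t) c0, (tm_step M ^^ t) c0') of
           ((q, h, f), (q', h', f')) \<Rightarrow> q = q' \<and> h = h' \<and> h \<le> t \<and> (\<forall>i < T. f i = f' i))"
  using assms(1)
proof (induction t)
  case 0
  show ?case using assms by (auto split: prod.splits)
next
  case (Suc t)
  then show ?case
    by (auto simp: fun_upd_def split: prod.splits if_splits move.splits)
qed

text \<open>The head starts at 0 and moves by at most one cell, so \<open>t\<close> steps write only
  below position \<open>t\<close>. Bit symbols are not blank, hence this limits the length of the
  output.\<close>

lemma tm_tape_nonblank:
  "case (tm_step M ^^ t) (tm_init w) of (q, h, f) \<Rightarrow>
     h \<le> t \<and> (\<forall>i. f i \<noteq> 0 \<longrightarrow> i < length w \<or> i < t)"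
proof (induction t)
  case 0
  show ?case by (auto simp: tm_init_def)
next
  case (Suc t)
  then show ?case
    by (auto simp: less_Suc_eq split: prod.splits if_splits move.splits)
qed

lemma ptime_fun_length:
  assumes "ptime_fun g"
  shows "\<exists>d. \<forall>x. length (g x) \<le> length x + length x ^ d + d"
proof -
  obtain M d where M: "\<And>x. tm_computes M (map sym x) (g x) (length x ^ d + d)"
    using assms by (auto simp: ptime_fun_def)
  have "length (g x) \<le> length x + length x ^ d + d" for x
  proof (cases "g x = []")
    case False
    let ?i = "length (g x) - 1"
    have i: "?i < length (g x)" using False by simp
    obtain q h f where c: "(tm_step M ^^ (length x ^ d + d)) (tm_init (map sym x)) = (q, h, f)"
      by (metis prod_cases3)
    have "f ?i = sym (g x ! ?i)"
      using M[of x] i by (simp add: tm_computes_def c)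
    then have "f ?i \<noteq> 0" by (simp add: sym_def)
    then have "?i < length x \<or> ?i < length x ^ d + d"
      using tm_tape_nonblank[where t = "length x ^ d + d" and M = M and w = "map sym x"] by (simp add: c)
    then show ?thesis by linarith
  qed simp
  then show ?thesis by blast
qed

text \<open>Since codes are prefix-free, a verifier that does not reach the end of a formula cannot tell
  it from a string that is not a formula.\<close>

lemma pps_fm_size:
  assumes "pps P"
  shows "\<exists>d. \<forall>\<phi> x. P x (enc \<phi>) \<longrightarrow> fm_size \<phi> \<le> length x ^ d + d"
proof -
  obtain M d where M: "\<And>x y. tm_computes M (map sym x @ [3] @ map sym y) [P x y] (length x ^ d + d)"
    using assms by (auto simp: pps_def ptime_verifiable_def)
  have "fm_size \<phi> \<le> length x ^ d + d" if P: "P x (enc \<phi>)" for \<phi> x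
  proof (rule ccontr)
    assume long: "\<not> ?thesis"
    let ?T = "length x ^ d + d"
    let ?w = "map sym x @ [3] @ map sym (enc \<phi>)"
    \<comment> \<open>One more bit behind a code never yields a code, by prefix-freeness, yet it
      lies beyond what the machine can see.\<close>
    let ?w' = "map sym x @ [3] @ map sym (enc \<phi> @ [False])"
    \<comment> \<open>The verdict stands in cell 0, while the two tapes are known to agree only on
      cells below \<open>?T\<close>.\<close>
    have T0: "0 < ?T" by (cases d) auto
    obtain q h f where c: "(tm_step M ^^ ?T) (tm_init ?w) = (q, h, f)"
      by (metis prod_cases3)
    obtain q' h' f' where c': "(tm_step M ^^ ?T) (tm_init ?w') = (q', h', f')"
      by (metis prod_cases3)
    have "\<forall>i < ?T. snd (snd (tm_init ?w)) i = snd (snd (tm_init ?w')) i"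
    proof (intro allI impI)
      fix i assume "i < ?T"
      then have i: "i < length ?w" using long by (simp add: fm_size_def)
      have "?w' = ?w @ [sym False]" by simp
      then have "?w' ! i = ?w ! i" using i by (simp only: nth_append if_True)
      then show "snd (snd (tm_init ?w)) i = snd (snd (tm_init ?w')) i"
        using i by (simp add: tm_init_def)
    qed
    then have "\<forall>i < ?T. f i = f' i"
      using tm_step_local[of ?T ?T "tm_init ?w" "tm_init ?w'" M, OF order.refl] c c'
      by (simp add: tm_init_def)
    then have "f 0 = f' 0" using T0 by blast
    moreover have "f 0 = sym (P x (enc \<phi>))"
      using M[of x "enc \<phi>"] c by (simp add: tm_computes_def)
    moreover have "f' 0 = sym (P x (enc \<phi> @ [False]))"
      using M[of x "enc \<phi> @ [False]"] c' by (simp add: tm_computes_def)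
    ultimately have "P x (enc \<phi> @ [False])"
      using P by (simp add: sym_def split: if_splits)
    then have "enc \<phi> @ [False] \<in> TAUT" using assms by (auto simp: pps_def)
    then obtain \<psi> where "enc \<phi> @ [False] = enc \<psi> @ []" by (auto simp: TAUT_def)
    then show False using enc_prefix_free by blast
  qed
  then show ?thesis by blast
qed

section \<open>Frege proofs\<close>

text \<open>Atoms and constants count as one symbol, so renaming atoms and substituting constants
  leave this measure unchanged. The length of names is charged only once, when a symbol count is
  turned into an EF proof length.\<close>

fun sz :: "'a form \<Rightarrow> nat" where
  "sz (Cst b) = 1"
| "sz (At a) = 1"
| "sz (Neg \<phi>) = sz \<phi> + 1"
| "sz (Con \<phi> \<psi>) = sz \<phi> + sz \<psi> + 1"
| "sz (Dis \<phi> \<psi>) = sz \<phi> + sz \<psi> + 1"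
| "sz (Imp \<phi> \<psi>) = sz \<phi> + sz \<psi> + 1"

fun sb :: "('a \<Rightarrow> 'b form) \<Rightarrow> 'a form \<Rightarrow> 'b form" where
  "sb \<sigma> (Cst b) = Cst b"
| "sb \<sigma> (At a) = \<sigma> a"
| "sb \<sigma> (Neg \<phi>) = Neg (sb \<sigma> \<phi>)"
| "sb \<sigma> (Con \<phi> \<psi>) = Con (sb \<sigma> \<phi>) (sb \<sigma> \<psi>)"
| "sb \<sigma> (Dis \<phi> \<psi>) = Dis (sb \<sigma> \<phi>) (sb \<sigma> \<psi>)"
| "sb \<sigma> (Imp \<phi> \<psi>) = Imp (sb \<sigma> \<phi>) (sb \<sigma> \<psi>)"

lemma sz_pos [simp]: "1 \<le> sz \<phi>" "0 < sz \<phi>"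
  by (induction \<phi>) auto

lemma sz_sb_le:
  assumes "\<And>a. sz (\<sigma> a) \<le> M"
  shows "sz (sb \<sigma> \<phi>) \<le> sz \<phi> * M"
proof -
  have "1 \<le> M" using assms sz_pos(1) le_trans by blast
  then show ?thesis
    by (induction \<phi>) (auto simp: assms algebra_simps)
qed

lemma rename_eq_sb: "rename f \<phi> = sb (\<lambda>a. At (f a)) \<phi>"
  by (induction \<phi>) auto

lemma sz_rename [simp]: "sz (rename f \<phi>) = sz \<phi>"
  by (induction \<phi>) auto

lemma sz_inst [simp]: "sz (inst \<theta> \<phi>) = sz \<phi>"
  by (induction \<phi>) (auto split: option.splits)

lemma sb_eq_self: "(\<And>a. a \<in> atoms \<phi> \<Longrightarrow> \<sigma> a = At a) \<Longrightarrow> sb \<sigma> \<phi> = \<phi>"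
  by (induction \<phi>) auto

lemma atoms_sb: "atoms (sb \<sigma> \<phi>) = (\<Union>a \<in> atoms \<phi>. atoms (\<sigma> a))"
  by (induction \<phi>) auto

lemma sz_le_fm_size: "sz \<phi> \<le> fm_size \<phi>"
  by (induction \<phi>) (auto simp: fm_size_def)

text \<open>Each node contributes three bits, and an atom its name in addition.\<close>

lemma fm_size_le_sz:
  "(\<And>a. a \<in> atoms \<phi> \<Longrightarrow> length (enc_nat a) \<le> L) \<Longrightarrow> fm_size \<phi> \<le> sz \<phi> * (L + 3)"
  by (induction \<phi>) (fastforce simp: fm_size_def algebra_simps)+

lemma atom_le_fm_size: "a \<in> atoms \<phi> \<Longrightarrow> length (enc_nat a) \<le> fm_size \<phi>"
  by (induction \<phi>) (auto simp: fm_size_def)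

lemma frege_axiom_sb: "frege_axiom \<phi> \<Longrightarrow> frege_axiom (sb \<sigma> \<phi>)"
  by (induction rule: frege_axiom.induct) (auto intro: frege_axiom.intros)

definition lit :: "bool \<Rightarrow> 'a form \<Rightarrow> 'a form" where
  "lit b \<phi> = (if b then \<phi> else Neg \<phi>)"

subsection \<open>Completeness\<close>

text \<open>Derivability from hypotheses, without counting symbols. It supplies the deduction
  theorem and completeness for fixed schemes; sizes return in \<open>fprov_schema\<close>.\<close>

inductive hder :: "fm set \<Rightarrow> fm \<Rightarrow> bool" for \<Gamma> where
  hder_ax: "frege_axiom \<phi> \<Longrightarrow> hder \<Gamma> \<phi>"
| hder_hyp: "\<phi> \<in> \<Gamma> \<Longrightarrow> hder \<Gamma> \<phi>"
| hder_mp: "hder \<Gamma> \<phi> \<Longrightarrow> hder \<Gamma> (Imp \<phi> \<psi>) \<Longrightarrow> hder \<Gamma> \<psi>"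

lemma hder_mono: "hder \<Gamma> \<phi> \<Longrightarrow> \<Gamma> \<subseteq> \<Delta> \<Longrightarrow> hder \<Delta> \<phi>"
  by (induction rule: hder.induct) (auto intro: hder.intros)

lemma hder_weaken: "hder \<Gamma> \<psi> \<Longrightarrow> hder \<Gamma> (Imp \<phi> \<psi>)"
  by (rule hder_mp[OF _ hder_ax]) (auto intro: frege_axiom.intros)

lemma hder_refl: "hder \<Gamma> (Imp \<phi> \<phi>)"
proof -
  have "hder \<Gamma> (Imp (Imp \<phi> (Imp \<phi> \<phi>)) (Imp \<phi> \<phi>))"
    by (rule hder_mp[of _ "Imp \<phi> (Imp (Imp \<phi> \<phi>) \<phi>)"]) (auto intro!: hder_ax frege_axiom.intros)
  then show ?thesis
    by (rule hder_mp[rotated]) (auto intro!: hder_ax frege_axiom.intros)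
qed

lemma hder_deduct: "hder (insert \<phi> \<Gamma>) \<psi> \<Longrightarrow> hder \<Gamma> (Imp \<phi> \<psi>)"
proof (induction rule: hder.induct)
  case (hder_ax \<psi>)
  then show ?case by (intro hder_weaken hder.hder_ax)
next
  case (hder_hyp \<psi>)
  then show ?case by (auto intro: hder_refl hder_weaken hder.hder_hyp)
next
  case (hder_mp \<chi> \<psi>)
  have "hder \<Gamma> (Imp (Imp \<phi> (Imp \<chi> \<psi>)) (Imp (Imp \<phi> \<chi>) (Imp \<phi> \<psi>)))"
    by (intro hder.hder_ax frege_axiom.intros)
  then show ?case
    by (rule hder.hder_mp[OF hder_mp.IH(1) hder.hder_mp[OF hder_mp.IH(2)]])
qed

lemma hder_negI:
  assumes "hder (insert \<phi> \<Gamma>) \<psi>" "hder (insert \<phi> \<Gamma>) (Neg \<psi>)"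
  shows "hder \<Gamma> (Neg \<phi>)"
proof -
  have "hder \<Gamma> (Imp (Imp \<phi> \<psi>) (Imp (Imp \<phi> (Neg \<psi>)) (Neg \<phi>)))"
    by (intro hder_ax frege_axiom.intros)
  from hder_mp[OF hder_deduct[OF assms(2)] hder_mp[OF hder_deduct[OF assms(1)] this]]
  show ?thesis .
qed

lemma hder_ccontr:
  assumes "hder (insert (Neg \<phi>) \<Gamma>) \<psi>" "hder (insert (Neg \<phi>) \<Gamma>) (Neg \<psi>)"
  shows "hder \<Gamma> \<phi>"
proof -
  have "hder \<Gamma> (Imp (Neg (Neg \<phi>)) \<phi>)"
    by (intro hder_ax frege_axiom.intros)
  from hder_mp[OF hder_negI[OF assms] this] show ?thesis .
qed

lemma hder_insert: "hder \<Gamma> \<phi> \<Longrightarrow> hder (insert \<psi> \<Gamma>) \<phi>"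
  by (rule hder_mono) auto

lemma hder_explode: "hder \<Gamma> \<phi> \<Longrightarrow> hder \<Gamma> (Neg \<phi>) \<Longrightarrow> hder \<Gamma> \<psi>"
  by (rule hder_ccontr[of _ _ \<phi>]) (simp_all add: hder_insert)

lemma hder_cases:
  assumes "hder (insert \<phi> \<Gamma>) \<chi>" "hder (insert (Neg \<phi>) \<Gamma>) \<chi>"
  shows "hder \<Gamma> \<chi>"
proof -
  have 1: "hder (insert (Neg \<chi>) \<Gamma>) (Neg \<phi>)"
    by (rule hder_negI[of _ _ \<chi>]) (auto intro: hder_hyp hder_mono[OF assms(1)])
  have 2: "hder (insert (Neg \<chi>) \<Gamma>) (Neg (Neg \<phi>))"
    by (rule hder_negI[of _ _ \<chi>]) (auto intro: hder_hyp hder_mono[OF assms(2)])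
  show ?thesis by (rule hder_ccontr[OF 1 2])
qed

text \<open>Kalmar's lemma: the literals describing \<open>e\<close> derive each subformula or its
  negation, following the truth tables of the connectives.\<close>

lemma hder_kalmar: "hder ((\<lambda>a. lit (e a) (At a)) ` atoms \<phi>) (lit (fm_eval e \<phi>) \<phi>)"
proof (induction \<phi>)
  case (Cst b)
  have "hder \<Gamma> (Neg (Cst False))" for \<Gamma>
  proof (rule hder_negI[of _ _ "Cst True"])
    show "hder (insert (Cst False) \<Gamma>) (Neg (Cst True))"
      by (rule hder_mp[of _ "Cst False"]) (auto intro: hder.intros frege_axiom.intros)
  qed (auto intro: hder.intros frege_axiom.intros)
  then show ?case by (auto simp: lit_def intro: hder_ax frege_axiom.intros)
next
  case (At a)
  then show ?case by (auto intro: hder_hyp)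
next
  case (Neg \<phi>)
  show ?case
  proof (cases "fm_eval e \<phi>")
    case True
    with Neg show ?thesis
      using hder_negI[OF hder_insert, of _ \<phi> "Neg \<phi>"] by (simp add: lit_def hder_hyp)
  next
    case False
    with Neg show ?thesis by (simp add: lit_def)
  qed
next
  case (Con \<phi> \<psi>)
  let ?\<Gamma> = "(\<lambda>a. lit (e a) (At a)) ` atoms (Con \<phi> \<psi>)"
  have IH: "hder ?\<Gamma> (lit (fm_eval e \<phi>) \<phi>)" "hder ?\<Gamma> (lit (fm_eval e \<psi>) \<psi>)"
    by (auto intro: hder_mono[OF Con.IH(1)] hder_mono[OF Con.IH(2)])
  have pr: "hder (insert (Con \<phi> \<psi>) ?\<Gamma>) \<phi>" "hder (insert (Con \<phi> \<psi>) ?\<Gamma>) \<psi>"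
    by (rule hder_mp[of _ "Con \<phi> \<psi>"]; auto intro: hder.intros frege_axiom.intros)+
  consider "fm_eval e \<phi>" "fm_eval e \<psi>" | "\<not> fm_eval e \<phi>" | "\<not> fm_eval e \<psi>" by blast
  then show ?case
  proof cases
    case 1
    have "hder ?\<Gamma> (Imp \<phi> (Imp \<psi> (Con \<phi> \<psi>)))" by (intro hder_ax frege_axiom.intros)
    from hder_mp[OF _ hder_mp[OF _ this]] IH 1 show ?thesis by (simp add: lit_def)
  next
    case 2
    with IH have "hder ?\<Gamma> (Neg \<phi>)" by (simp add: lit_def)
    from hder_negI[OF pr(1) hder_insert[OF this]] 2 show ?thesis by (simp add: lit_def)
  next
    case 3
    with IH have "hder ?\<Gamma> (Neg \<psi>)" by (simp add: lit_def)
    from hder_negI[OF pr(2) hder_insert[OF this]] 3 show ?thesis by (simp add: lit_def)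
  qed
next
  case (Dis \<phi> \<psi>)
  let ?\<Gamma> = "(\<lambda>a. lit (e a) (At a)) ` atoms (Dis \<phi> \<psi>)"
  have IH: "hder ?\<Gamma> (lit (fm_eval e \<phi>) \<phi>)" "hder ?\<Gamma> (lit (fm_eval e \<psi>) \<psi>)"
    by (auto intro: hder_mono[OF Dis.IH(1)] hder_mono[OF Dis.IH(2)])
  consider "fm_eval e \<phi>" | "fm_eval e \<psi>" | "\<not> fm_eval e \<phi>" "\<not> fm_eval e \<psi>" by blast
  then show ?case
  proof cases
    case 1
    have "hder ?\<Gamma> (Imp \<phi> (Dis \<phi> \<psi>))" by (intro hder_ax frege_axiom.intros)
    from hder_mp[OF _ this] IH 1 show ?thesis by (simp add: lit_def)
  next
    case 2
    have "hder ?\<Gamma> (Imp \<psi> (Dis \<phi> \<psi>))" by (intro hder_ax frege_axiom.intros)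
    from hder_mp[OF _ this] IH 2 show ?thesis by (simp add: lit_def)
  next
    case 3
    let ?D = "insert (Dis \<phi> \<psi>) ?\<Gamma>"
    have n: "hder ?\<Gamma> (Neg \<phi>)" "hder ?\<Gamma> (Neg \<psi>)" using 3 IH by (simp_all add: lit_def)
    have all: "hder ?D \<chi>" for \<chi>
    proof -
      have 1: "hder ?D (Imp \<phi> \<chi>)"
        by (rule hder_deduct, rule hder_explode[OF _ hder_insert[OF hder_insert[OF n(1)]]])
           (simp add: hder_hyp)
      have 2: "hder ?D (Imp \<psi> \<chi>)"
        by (rule hder_deduct, rule hder_explode[OF _ hder_insert[OF hder_insert[OF n(2)]]])
           (simp add: hder_hyp)
      have 3: "hder ?D (Imp (Imp \<phi> \<chi>) (Imp (Imp \<psi> \<chi>) (Imp (Dis \<phi> \<psi>) \<chi>)))"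
        by (intro hder_ax frege_axiom.intros)
      have 4: "hder ?D (Dis \<phi> \<psi>)" by (simp add: hder_hyp)
      show ?thesis by (rule hder_mp[OF 4 hder_mp[OF 2 hder_mp[OF 1 3]]])
    qed
    from hder_negI[OF all all] 3 show ?thesis by (simp add: lit_def)
  qed
next
  case (Imp \<phi> \<psi>)
  let ?\<Gamma> = "(\<lambda>a. lit (e a) (At a)) ` atoms (Imp \<phi> \<psi>)"
  have IH: "hder ?\<Gamma> (lit (fm_eval e \<phi>) \<phi>)" "hder ?\<Gamma> (lit (fm_eval e \<psi>) \<psi>)"
    by (auto intro: hder_mono[OF Imp.IH(1)] hder_mono[OF Imp.IH(2)])
  consider "\<not> fm_eval e \<phi>" | "fm_eval e \<psi>" | "fm_eval e \<phi>" "\<not> fm_eval e \<psi>" by blast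
  then show ?case
  proof cases
    case 1
    with IH have "hder ?\<Gamma> (Neg \<phi>)" by (simp add: lit_def)
    from hder_explode[OF _ hder_insert[OF this]] have "hder ?\<Gamma> (Imp \<phi> \<psi>)"
      by (intro hder_deduct) (simp add: hder_hyp)
    with 1 show ?thesis by (simp add: lit_def)
  next
    case 2
    with IH show ?thesis by (simp add: lit_def hder_weaken)
  next
    case 3
    with IH have n: "hder ?\<Gamma> \<phi>" "hder ?\<Gamma> (Neg \<psi>)" by (simp_all add: lit_def)
    have "hder (insert (Imp \<phi> \<psi>) ?\<Gamma>) \<psi>"
      by (rule hder_mp[OF hder_insert[OF n(1)]]) (simp add: hder_hyp)
    from hder_negI[OF this hder_insert[OF n(2)]] 3 show ?thesis by (simp add: lit_def)
  qed
qed

text \<open>Kalmar's lemma holds for every \<open>e\<close>, so the literals can be discharged one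
  atom at a time by a case distinction.\<close>

lemma frege_complete:
  assumes "tautology \<phi>"
  shows "hder {} \<phi>"
proof -
  have "hder {} \<phi>" if "finite A" "\<And>e. hder ((\<lambda>a. lit (e a) (At a)) ` A) \<phi>" for A
    using that
  proof (induction A rule: finite_induct)
    case (insert x A)
    have "hder ((\<lambda>a. lit (e a) (At a)) ` A) \<phi>" for e
    proof (rule hder_cases[of "At x"])
      have *: "(\<lambda>a. lit ((e(x := b)) a) (At a)) ` A = (\<lambda>a. lit (e a) (At a)) ` A" for b
        using insert.hyps by (intro image_cong) auto
      show "hder (insert (At x) ((\<lambda>a. lit (e a) (At a)) ` A)) \<phi>"
        using insert.prems[of "e(x := True)"] by (simp only: image_insert *) (simp add: lit_def)
      show "hder (insert (Neg (At x)) ((\<lambda>a. lit (e a) (At a)) ` A)) \<phi>"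
        using insert.prems[of "e(x := False)"] by (simp only: image_insert *) (simp add: lit_def)
    qed
    then show ?case by (rule insert.IH)
  qed auto
  moreover have "finite (atoms \<phi>)" by (induction \<phi>) auto
  moreover have "hder ((\<lambda>a. lit (e a) (At a)) ` atoms \<phi>) \<phi>" for e
    using hder_kalmar[of e \<phi>] assms by (simp add: tautology_def lit_def)
  ultimately show ?thesis by blast
qed

subsection \<open>Proofs with a bound on the number of symbols\<close>

text \<open>Proof trees measured by their total number of symbols: the bounds of the premises add up
  and may be enlarged freely. Derived rules thus become additions of bounds.\<close>

inductive fprov :: "nat \<Rightarrow> fm \<Rightarrow> bool" where
  fprov_ax: "frege_axiom \<phi> \<Longrightarrow> sz \<phi> \<le> n \<Longrightarrow> fprov n \<phi>"
| fprov_mp: "fprov p \<phi> \<Longrightarrow> fprov q (Imp \<phi> \<psi>) \<Longrightarrow> p + q + sz \<psi> \<le> n \<Longrightarrow> fprov n \<psi>"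

lemma fprov_mono: "fprov p \<phi> \<Longrightarrow> p \<le> q \<Longrightarrow> fprov q \<phi>"
proof (induction arbitrary: q rule: fprov.induct)
  case (fprov_ax \<phi> n)
  then show ?case by - (rule fprov.fprov_ax; auto)
next
  case (fprov_mp p \<phi> q' \<psi> n)
  show ?case
    by (rule fprov.fprov_mp[OF fprov_mp.hyps(1,2)]) (use fprov_mp in auto)
qed

lemma fprov_sb:
  "fprov n \<phi> \<Longrightarrow> (\<And>a. sz (\<sigma> a) = 1) \<Longrightarrow> fprov n (sb \<sigma> \<phi>)"
proof (induction rule: fprov.induct)
  case (fprov_ax \<phi> n)
  then show ?case
    using sz_sb_le[of \<sigma> 1 \<phi>] by (intro fprov.fprov_ax frege_axiom_sb) auto
next
  case (fprov_mp p \<phi> q \<psi> n)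
  then show ?case
    using sz_sb_le[of \<sigma> 1 \<psi>] by - (rule fprov.fprov_mp[of p "sb \<sigma> \<phi>" q]; auto)
qed

lemma fprov_rename: "fprov n \<phi> \<Longrightarrow> fprov n (rename f \<phi>)"
  by (simp add: rename_eq_sb fprov_sb)

text \<open>Sequences in the format of EF that are obtained by writing out proof trees; they contain
  no extension axioms.\<close>

inductive frege_list :: "fm list \<Rightarrow> bool" where
  frege_list_Nil: "frege_list []"
| frege_list_ax: "frege_list \<pi> \<Longrightarrow> frege_axiom \<phi> \<Longrightarrow> frege_list (\<pi> @ [\<phi>])"
| frege_list_mp: "frege_list \<pi> \<Longrightarrow> \<phi> \<in> set \<pi> \<Longrightarrow> Imp \<phi> \<psi> \<in> set \<pi> \<Longrightarrow> frege_list (\<pi> @ [\<psi>])"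

lemma frege_list_append: "frege_list \<pi>' \<Longrightarrow> frege_list \<pi> \<Longrightarrow> frege_list (\<pi> @ \<pi>')"
proof (induction rule: frege_list.induct)
  case (frege_list_mp \<pi>' \<phi> \<psi>)
  then show ?case
    using frege_list.frege_list_mp[of "\<pi> @ \<pi>'" \<phi> \<psi>] by simp
qed (auto simp flip: append_assoc intro: frege_list.intros)

lemma frege_list_sb: "frege_list \<pi> \<Longrightarrow> frege_list (map (sb \<sigma>) \<pi>)"
proof (induction rule: frege_list.induct)
  case (frege_list_mp \<pi> \<phi> \<psi>)
  then show ?case
    by (force intro: frege_list.frege_list_mp[of _ "sb \<sigma> \<phi>"])
qed (auto intro: frege_list.intros frege_axiom_sb)

lemma frege_list_nth:
  assumes "frege_list \<pi>" "i < length \<pi>"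
  shows "frege_axiom (\<pi> ! i) \<or> (\<exists>j < i. \<exists>k < i. \<pi> ! k = Imp (\<pi> ! j) (\<pi> ! i))"
  using assms
proof (induction arbitrary: i rule: frege_list.induct)
  case (frege_list_ax \<pi> \<phi>)
  show ?case
  proof (cases "i < length \<pi>")
    case True
    from frege_list_ax.IH[OF True] show ?thesis
    proof (elim disjE exE conjE)
      fix j k assume "j < i" "k < i" "\<pi> ! k = Imp (\<pi> ! j) (\<pi> ! i)"
      then show ?thesis
        using True by (intro disjI2 exI[of _ j] conjI exI[of _ k]) (simp_all add: nth_append)
    qed (simp add: nth_append True)
  qed (use frege_list_ax in \<open>auto simp: nth_append less_Suc_eq\<close>)
next
  case (frege_list_mp \<pi> \<phi> \<psi>)
  show ?case
  proof (cases "i < length \<pi>")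
    case True
    from frege_list_mp.IH[OF True] show ?thesis
    proof (elim disjE exE conjE)
      fix j k assume "j < i" "k < i" "\<pi> ! k = Imp (\<pi> ! j) (\<pi> ! i)"
      then show ?thesis
        using True by (intro disjI2 exI[of _ j] conjI exI[of _ k]) (simp_all add: nth_append)
    qed (simp add: nth_append True)
  next
    case False
    then have i: "i = length \<pi>" using frege_list_mp.prems by simp
    obtain j where j: "j < length \<pi>" "\<pi> ! j = \<phi>"
      using frege_list_mp.hyps(2) by (metis in_set_conv_nth)
    obtain k where k: "k < length \<pi>" "\<pi> ! k = Imp \<phi> \<psi>"
      using frege_list_mp.hyps(3) by (metis in_set_conv_nth)
    show ?thesis
      using i j k by (intro disjI2 exI[of _ j] conjI exI[of _ k]) (simp_all add: nth_append)
  qed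
qed simp

lemma frege_list_of_fprov:
  "fprov n \<phi> \<Longrightarrow> \<exists>\<pi>. frege_list \<pi> \<and> \<pi> \<noteq> [] \<and> last \<pi> = \<phi> \<and> sum_list (map sz \<pi>) \<le> n"
proof (induction rule: fprov.induct)
  case (fprov_ax \<phi> n)
  then show ?case
    using frege_list_ax[OF frege_list_Nil] by (intro exI[of _ "[\<phi>]"]) auto
next
  case (fprov_mp p \<phi> q \<psi> n)
  then obtain \<pi> \<pi>' where *: "frege_list \<pi>" "\<pi> \<noteq> []" "last \<pi> = \<phi>" "sum_list (map sz \<pi>) \<le> p"
    "frege_list \<pi>'" "\<pi>' \<noteq> []" "last \<pi>' = Imp \<phi> \<psi>" "sum_list (map sz \<pi>') \<le> q" by blast
  then have "\<phi> \<in> set (\<pi> @ \<pi>')" "Imp \<phi> \<psi> \<in> set (\<pi> @ \<pi>')"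
    by (metis UnCI last_in_set set_append)+
  then have "frege_list ((\<pi> @ \<pi>') @ [\<psi>])"
    using * by (meson frege_list_mp frege_list_append)
  then show ?case
    using * fprov_mp.hyps by (intro exI[of _ "(\<pi> @ \<pi>') @ [\<psi>]"]) auto
qed

text \<open>Lines of the proof may contain atoms foreign to \<phi> whose names are arbitrarily long.
  Replacing these by \<open>Cst True\<close> preserves axioms and modus ponens and leaves \<phi>
  alone, so every remaining name has length at most \<open>L\<close>.\<close>

lemma min_size_EF_le:
  assumes "fprov n \<phi>" "\<And>a. a \<in> atoms \<phi> \<Longrightarrow> length (enc_nat a) \<le> L"
  shows "min_size EF \<phi> \<le> enat (n * (L + 3))"
proof -
  obtain \<pi> where \<pi>: "frege_list \<pi>" "\<pi> \<noteq> []" "last \<pi> = \<phi>" "sum_list (map sz \<pi>) \<le> n"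
    using frege_list_of_fprov[OF assms(1)] by blast
  define \<sigma> where "\<sigma> = (\<lambda>a. if a \<in> atoms \<phi> then At a else Cst True)"
  let ?\<pi> = "map (sb \<sigma>) \<pi>"
  have last: "last ?\<pi> = \<phi>"
    using \<pi> by (simp add: last_map sb_eq_self \<sigma>_def)
  have ef: "ef_derivation ?\<pi>"
    using frege_list_nth[OF frege_list_sb[OF \<pi>(1)]] \<pi>(2) unfolding ef_derivation_def by auto
  have sz1: "sz (\<sigma> a) \<le> 1" for a by (simp add: \<sigma>_def)
  have line: "length (enc (sb \<sigma> \<psi>)) \<le> sz \<psi> * (L + 3)" for \<psi>
  proof -
    have "fm_size (sb \<sigma> \<psi>) \<le> sz (sb \<sigma> \<psi>) * (L + 3)"
      using assms(2) by (intro fm_size_le_sz) (auto simp: atoms_sb \<sigma>_def split: if_splits)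
    also have "\<dots> \<le> sz \<psi> * (L + 3)"
      using sz_sb_le[of \<sigma> 1 \<psi>] sz1 by (intro mult_right_mono) auto
    finally show ?thesis by (simp add: fm_size_def)
  qed
  have "length (concat (map enc ?\<pi>)) = (\<Sum>\<psi>\<leftarrow>\<pi>. length (enc (sb \<sigma> \<psi>)))"
    by (simp add: length_concat comp_def)
  also have "\<dots> \<le> (\<Sum>\<psi>\<leftarrow>\<pi>. sz \<psi> * (L + 3))"
    by (intro sum_list_mono line)
  also have "\<dots> = sum_list (map sz \<pi>) * (L + 3)"
    by (simp add: sum_list_mult_const)
  also have "\<dots> \<le> n * (L + 3)"
    using \<pi>(4) by (rule mult_right_mono) simp
  finally have "length (concat (map enc ?\<pi>)) \<le> n * (L + 3)" .
  moreover have "EF (concat (map enc ?\<pi>)) (enc \<phi>)"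
    unfolding EF_def using ef last by metis
  ultimately show ?thesis
    using min_size_le[of EF] by (meson enat_ord_simps(1) order_trans)
qed

subsection \<open>Derived rules\<close>

text \<open>The substitution acts on one fixed derivation of \<open>T\<close>, so its symbol count
  grows only linearly with the substituted formulas.\<close>

lemma fprov_schema: "hder {} T \<Longrightarrow> \<exists>K. \<forall>\<sigma> M. (\<forall>a. sz (\<sigma> a) \<le> M) \<longrightarrow> fprov (K * M) (sb \<sigma> T)"
proof (induction rule: hder.induct)
  case (hder_ax \<phi>)
  then show ?case
    by (intro exI[of _ "sz \<phi>"] allI impI fprov_ax frege_axiom_sb sz_sb_le) auto
next
  case (hder_mp \<phi> \<psi>)
  then obtain K K' where K: "\<And>\<sigma> M. (\<forall>a. sz (\<sigma> a) \<le> M) \<Longrightarrow> fprov (K * M) (sb \<sigma> \<phi>)"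
    "\<And>\<sigma> M. (\<forall>a. sz (\<sigma> a) \<le> M) \<Longrightarrow> fprov (K' * M) (sb \<sigma> (Imp \<phi> \<psi>))" by blast
  show ?case
  proof (intro exI[of _ "K + K' + sz \<psi>"] allI impI)
    fix \<sigma> :: "nat \<Rightarrow> fm" and M assume M: "\<forall>a. sz (\<sigma> a) \<le> M"
    have "sz (sb \<sigma> \<psi>) \<le> sz \<psi> * M" using M by (intro sz_sb_le) auto
    then show "fprov ((K + K' + sz \<psi>) * M) (sb \<sigma> \<psi>)"
      using K(1)[OF M] K(2)[OF M] by - (rule fprov_mp[of "K * M" "sb \<sigma> \<phi>" "K' * M"]; auto simp: algebra_simps)
  qed
qed auto

text \<open>One constant serves for all instances of all schemes of bounded size, as these are finitely
  many. The summand \<open>400\<close> pays for two applications of modus ponens.\<close>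

definition K0 :: nat where
  "K0 = (LEAST K. \<forall>T. tautology T \<and> fm_size T \<le> 200 \<longrightarrow>
           (\<forall>\<sigma> M. (\<forall>a. sz (\<sigma> a) \<le> M) \<longrightarrow> fprov (K * M) (sb \<sigma> T))) + 400"

text \<open>The bound uses \<open>K0 - 400\<close>, which is the least constant itself; the
  remaining \<open>400 * M\<close> are spent on the conclusions of modus ponens in the next two
  rules.\<close>

lemma frege_rule0:
  assumes "tautology T" "fm_size T \<le> 200" "\<And>a. sz (\<sigma> a) \<le> M"
  shows "fprov ((K0 - 400) * M) (sb \<sigma> T)"
proof -
  have *: "\<exists>K. \<forall>T \<in> S. \<forall>\<sigma> M. (\<forall>a. sz (\<sigma> a) \<le> M) \<longrightarrow> fprov (K * M) (sb \<sigma> T)"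
    if "finite S" "\<forall>T \<in> S. tautology T" for S :: "fm set"
    using that
  proof (induction S rule: finite_induct)
    case (insert T S)
    obtain K where K: "\<forall>T \<in> S. \<forall>\<sigma> M. (\<forall>a. sz (\<sigma> a) \<le> M) \<longrightarrow> fprov (K * M) (sb \<sigma> T)"
      using insert by auto
    obtain K' where K': "\<forall>\<sigma> M. (\<forall>a. sz (\<sigma> a) \<le> M) \<longrightarrow> fprov (K' * M) (sb \<sigma> T)"
      using fprov_schema[OF frege_complete] insert by blast
    have "K * M \<le> (K + K') * M" "K' * M \<le> (K + K') * M" for M by simp_all
    then show ?case
      using K K' fprov_mono by (intro exI[of _ "K + K'"]) (metis insert_iff)
  qed auto
  have "finite {T. tautology T \<and> fm_size T \<le> 200}"
    by (rule finite_subset[OF _ finite_fm_size_le[of 200]]) auto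
  from *[OF this] have ex: "\<exists>K. \<forall>T. tautology T \<and> fm_size T \<le> 200 \<longrightarrow>
      (\<forall>\<sigma> M. (\<forall>a. sz (\<sigma> a) \<le> M) \<longrightarrow> fprov (K * M) (sb \<sigma> T))"
    by simp
  show ?thesis
    using LeastI_ex[OF ex] assms unfolding K0_def by simp
qed

lemma K0_ge: "400 \<le> K0"
  by (simp add: K0_def)

lemma frege_rule1:
  assumes "tautology (Imp T1 T2)" "fm_size (Imp T1 T2) \<le> 200" "\<And>a. sz (\<sigma> a) \<le> M"
    and "fprov p (sb \<sigma> T1)"
  shows "fprov (p + K0 * M) (sb \<sigma> T2)"
proof -
  have "sz T2 \<le> 400"
    using sz_le_fm_size[of T2] assms(2) by (simp add: fm_size_def)
  then have "sz (sb \<sigma> T2) \<le> 400 * M"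
    using sz_sb_le[of \<sigma> M T2] assms(3) by (meson mult_right_mono order_trans zero_le)
  moreover have "(K0 - 400) * M + 400 * M = K0 * M"
    using K0_ge by (simp flip: add_mult_distrib)
  ultimately show ?thesis
    using frege_rule0[OF assms(1-3)] assms(4) by - (rule fprov_mp[OF assms(4), of "(K0 - 400) * M"]; auto)
qed

lemma frege_rule2:
  assumes "tautology (Imp T1 (Imp T2 T3))" "fm_size (Imp T1 (Imp T2 T3)) \<le> 200" "\<And>a. sz (\<sigma> a) \<le> M"
    and "fprov p (sb \<sigma> T1)" "fprov q (sb \<sigma> T2)"
  shows "fprov (p + q + K0 * M) (sb \<sigma> T3)"
proof -
  have "sz T3 \<le> 200" "sz (Imp T2 T3) \<le> 200"
    using sz_le_fm_size[of T3] sz_le_fm_size[of "Imp T2 T3"] assms(2) by (simp_all add: fm_size_def)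
  then have sz: "sz (sb \<sigma> T3) \<le> 200 * M" "sz (sb \<sigma> (Imp T2 T3)) \<le> 200 * M"
    using sz_sb_le[of \<sigma> M T3] sz_sb_le[of \<sigma> M "Imp T2 T3"] assms(3)
    by (meson mult_right_mono order_trans zero_le)+
  have K: "(K0 - 400) * M + 400 * M = K0 * M"
    using K0_ge by (simp flip: add_mult_distrib)
  have "fprov (p + ((K0 - 400) * M + 200 * M)) (sb \<sigma> (Imp T2 T3))"
    using frege_rule0[OF assms(1-3)] sz by - (rule fprov_mp[OF assms(4), of "(K0 - 400) * M"]; auto)
  then show ?thesis
    using sz K by - (rule fprov_mp[OF assms(5), of "p + ((K0 - 400) * M + 200 * M)"]; auto)
qed

text \<open>No scheme below has more than three metavariables.\<close>

definition sub3 :: "fm \<Rightarrow> fm \<Rightarrow> fm \<Rightarrow> nat \<Rightarrow> fm" where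
  "sub3 A B C a = (if a = 0 then A else if a = 1 then B else C)"

lemma sub3_simps [simp]: "sub3 A B C 0 = A" "sub3 A B C (Suc 0) = B" "sub3 A B C 2 = C"
  by (simp_all add: sub3_def)

lemma sub3_le: "sz A \<le> M \<Longrightarrow> sz B \<le> M \<Longrightarrow> sz C \<le> M \<Longrightarrow> sz (sub3 A B C a) \<le> M"
  by (simp add: sub3_def)

named_theorems scheme
declare tautology_def [scheme] fm_size_def [scheme] enc_nat.simps [scheme]

abbreviation (input) "X0 \<equiv> At (0::nat)"
abbreviation (input) "X1 \<equiv> At (1::nat)"
abbreviation (input) "X2 \<equiv> At (2::nat)"

context
  fixes A B C :: fm and M :: nat
  assumes M: "sz A \<le> M" "sz B \<le> M" "sz C \<le> M"
begin

lemma fprov_scheme0: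
  "tautology T \<Longrightarrow> fm_size T \<le> 200 \<Longrightarrow> fprov (K0 * M) (sb (sub3 A B C) T)"
  by (rule fprov_mono[OF frege_rule0]) (auto intro: sub3_le M)

lemma fprov_scheme1:
  "fprov p (sb (sub3 A B C) T1) \<Longrightarrow> tautology (Imp T1 T2) \<Longrightarrow> fm_size (Imp T1 T2) \<le> 200 \<Longrightarrow>
   fprov (p + K0 * M) (sb (sub3 A B C) T2)"
  by (rule frege_rule1) (auto intro: sub3_le M)

lemma fprov_scheme2:
  "fprov p (sb (sub3 A B C) T1) \<Longrightarrow> fprov q (sb (sub3 A B C) T2) \<Longrightarrow>
   tautology (Imp T1 (Imp T2 T3)) \<Longrightarrow> fm_size (Imp T1 (Imp T2 T3)) \<le> 200 \<Longrightarrow>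
   fprov (p + q + K0 * M) (sb (sub3 A B C) T3)"
  by (rule frege_rule2) (auto intro: sub3_le M)

lemma fprov_refl: "fprov (K0 * M) (Imp A A)"
  using fprov_scheme0[of "Imp X0 X0"] by (auto simp: scheme)

lemma fprov_True: "fprov (K0 * M) (Imp A (Cst True))"
  using fprov_scheme0[of "Imp X0 (Cst True)"] by (auto simp: scheme)

lemma fprov_notFalse: "fprov (K0 * M) (Imp A (Neg (Cst False)))"
  using fprov_scheme0[of "Imp X0 (Neg (Cst False))"] by (auto simp: scheme)

lemma fprov_False: "fprov (K0 * M) (Imp (Cst False) A)"
  using fprov_scheme0[of "Imp (Cst False) X0"] by (auto simp: scheme)

lemma fprov_Con1: "fprov (K0 * M) (Imp (Con A B) A)"
  using fprov_scheme0[of "Imp (Con X0 X1) X0"] by (auto simp: scheme)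

lemma fprov_Con2: "fprov (K0 * M) (Imp (Con A B) B)"
  using fprov_scheme0[of "Imp (Con X0 X1) X1"] by (auto simp: scheme)

lemma fprov_Dis1: "fprov (K0 * M) (Imp A (Dis A B))"
  using fprov_scheme0[of "Imp X0 (Dis X0 X1)"] by (auto simp: scheme)

lemma fprov_Dis2: "fprov (K0 * M) (Imp B (Dis A B))"
  using fprov_scheme0[of "Imp X1 (Dis X0 X1)"] by (auto simp: scheme)

lemma fprov_trans: "fprov p (Imp A B) \<Longrightarrow> fprov q (Imp B C) \<Longrightarrow> fprov (p + q + K0 * M) (Imp A C)"
  using fprov_scheme2[of p "Imp X0 X1" q "Imp X1 X2" "Imp X0 X2"] by (auto simp: scheme)

lemma fprov_weaken: "fprov p A \<Longrightarrow> fprov (p + K0 * M) (Imp B A)"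
  using fprov_scheme1[of p X0 "Imp X1 X0"] by (auto simp: scheme)

lemma fprov_trueE: "fprov p (Imp (Cst True) A) \<Longrightarrow> fprov (p + K0 * M) A"
  using fprov_scheme1[of p "Imp (Cst True) X0" X0] by (auto simp: scheme)

lemma fprov_absurd: "fprov p (Neg A) \<Longrightarrow> fprov (p + K0 * M) (Imp A B)"
  using fprov_scheme1[of p "Neg X0" "Imp X0 X1"] by (auto simp: scheme)

lemma fprov_notnotI: "fprov p (Imp A B) \<Longrightarrow> fprov (p + K0 * M) (Imp A (Neg (Neg B)))"
  using fprov_scheme1[of p "Imp X0 X1" "Imp X0 (Neg (Neg X1))"] by (auto simp: scheme)

lemma fprov_ConI: "fprov p (Imp A B) \<Longrightarrow> fprov q (Imp A C) \<Longrightarrow> fprov (p + q + K0 * M) (Imp A (Con B C))"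
  using fprov_scheme2[of p "Imp X0 X1" q "Imp X0 X2" "Imp X0 (Con X1 X2)"] by (auto simp: scheme)

lemma fprov_notConI1: "fprov p (Imp A (Neg B)) \<Longrightarrow> fprov (p + K0 * M) (Imp A (Neg (Con B C)))"
  using fprov_scheme1[of p "Imp X0 (Neg X1)" "Imp X0 (Neg (Con X1 X2))"] by (auto simp: scheme)

lemma fprov_notConI2: "fprov p (Imp A (Neg C)) \<Longrightarrow> fprov (p + K0 * M) (Imp A (Neg (Con B C)))"
  using fprov_scheme1[of p "Imp X0 (Neg X2)" "Imp X0 (Neg (Con X1 X2))"] by (auto simp: scheme)

lemma fprov_DisI1: "fprov p (Imp A B) \<Longrightarrow> fprov (p + K0 * M) (Imp A (Dis B C))"
  using fprov_scheme1[of p "Imp X0 X1" "Imp X0 (Dis X1 X2)"] by (auto simp: scheme)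

lemma fprov_DisI2: "fprov p (Imp A C) \<Longrightarrow> fprov (p + K0 * M) (Imp A (Dis B C))"
  using fprov_scheme1[of p "Imp X0 X2" "Imp X0 (Dis X1 X2)"] by (auto simp: scheme)

lemma fprov_notDisI:
  "fprov p (Imp A (Neg B)) \<Longrightarrow> fprov q (Imp A (Neg C)) \<Longrightarrow> fprov (p + q + K0 * M) (Imp A (Neg (Dis B C)))"
  using fprov_scheme2[of p "Imp X0 (Neg X1)" q "Imp X0 (Neg X2)" "Imp X0 (Neg (Dis X1 X2))"]
  by (auto simp: scheme)

lemma fprov_ImpI1: "fprov p (Imp A (Neg B)) \<Longrightarrow> fprov (p + K0 * M) (Imp A (Imp B C))"
  using fprov_scheme1[of p "Imp X0 (Neg X1)" "Imp X0 (Imp X1 X2)"] by (auto simp: scheme)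

lemma fprov_ImpI2: "fprov p (Imp A C) \<Longrightarrow> fprov (p + K0 * M) (Imp A (Imp B C))"
  using fprov_scheme1[of p "Imp X0 X2" "Imp X0 (Imp X1 X2)"] by (auto simp: scheme)

lemma fprov_notImpI:
  "fprov p (Imp A B) \<Longrightarrow> fprov q (Imp A (Neg C)) \<Longrightarrow> fprov (p + q + K0 * M) (Imp A (Neg (Imp B C)))"
  using fprov_scheme2[of p "Imp X0 X1" q "Imp X0 (Neg X2)" "Imp X0 (Neg (Imp X1 X2))"]
  by (auto simp: scheme)

lemma fprov_DisE:
  "fprov p (Imp A C) \<Longrightarrow> fprov q (Imp B C) \<Longrightarrow> fprov (p + q + K0 * M) (Imp (Dis A B) C)"
  using fprov_scheme2[of p "Imp X0 X2" q "Imp X1 X2" "Imp (Dis X0 X1) X2"] by (auto simp: scheme)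

lemma fprov_split:
  "fprov p (Imp (Con A B) C) \<Longrightarrow> fprov q (Imp (Con A (Neg B)) C) \<Longrightarrow> fprov (p + q + K0 * M) (Imp A C)"
  using fprov_scheme2[of p "Imp (Con X0 X1) X2" q "Imp (Con X0 (Neg X1)) X2" "Imp X0 X2"]
  by (auto simp: scheme)

text \<open>Here \<open>C\<close> is thought of as a disjunction having \<open>Imp A B\<close> among
  its disjuncts: refuting \<open>C\<close> refutes the disjunct, and that yields \<open>A\<close>.
  With the next two rules, implications into \<open>C\<close> split into separate work on
  antecedents and consequents.\<close>

lemma fprov_Imp_target1:
  "fprov p (Imp (Imp A B) C) \<Longrightarrow> fprov (p + K0 * M) (Imp (Neg C) A)"
  using fprov_scheme1[of p "Imp (Imp X0 X1) X2" "Imp (Neg X2) X0"] by (auto simp: scheme)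

lemma fprov_Imp_target2:
  "fprov p (Imp (Imp A B) C) \<Longrightarrow> fprov (p + K0 * M) (Imp B C)"
  using fprov_scheme1[of p "Imp (Imp X0 X1) X2" "Imp X1 X2"] by (auto simp: scheme)

lemma fprov_ImpE:
  "fprov p (Imp (Neg C) A) \<Longrightarrow> fprov q (Imp B C) \<Longrightarrow> fprov (p + q + K0 * M) (Imp (Imp A B) C)"
  using fprov_scheme2[of p "Imp (Neg X2) X0" q "Imp X1 X2" "Imp (Imp X0 X1) X2"]
  by (auto simp: scheme)

end

lemma length_le_sz_Conj: "length \<Psi> \<le> sz (Conj \<Psi>)"
  by (induction \<Psi> rule: Conj.induct) (auto simp: Suc_le_eq)

lemma length_le_sz_Disj: "length \<Psi> \<le> sz (Disj \<Psi>)"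
  by (induction \<Psi> rule: Disj.induct) (auto simp: Suc_le_eq)

lemma sz_le_sz_Conj: "\<psi> \<in> set \<Psi> \<Longrightarrow> sz \<psi> \<le> sz (Conj \<Psi>)"
  by (induction \<Psi> rule: Conj.induct) auto

lemma sz_le_sz_Disj: "\<psi> \<in> set \<Psi> \<Longrightarrow> sz \<psi> \<le> sz (Disj \<Psi>)"
  by (induction \<Psi> rule: Disj.induct) auto

text \<open>The \<open>+ 1\<close> in the bound pays for the empty conjunction, which is the
  constant true; dually in \<open>fprov_DisjE\<close>.\<close>

lemma fprov_ConjI:
  assumes "sz A \<le> M"
  shows "(\<And>\<psi>. \<psi> \<in> set \<Psi> \<Longrightarrow> fprov p (Imp A \<psi>)) \<Longrightarrow> sz (Conj \<Psi>) \<le> M \<Longrightarrow>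
         fprov ((length \<Psi> + 1) * (p + K0 * M)) (Imp A (Conj \<Psi>))"
proof (induction \<Psi> rule: Conj.induct)
  case 1
  then show ?case
    using fprov_True[OF assms assms assms] by (auto elim: fprov_mono)
next
  case (2 \<phi>)
  then have "fprov p (Imp A \<phi>)" by simp
  then show ?case unfolding Conj.simps by (rule fprov_mono) (simp add: algebra_simps)
next
  case (3 \<phi> \<psi> \<Phi>)
  then have "fprov (p + (length (\<psi> # \<Phi>) + 1) * (p + K0 * M) + K0 * M) (Imp A (Con \<phi> (Conj (\<psi> # \<Phi>))))"
    by - (rule fprov_ConI; auto simp: assms)
  then show ?case unfolding Conj.simps by (rule fprov_mono) (simp add: algebra_simps)
qed

lemma fprov_DisjE:
  assumes "sz A \<le> M"
  shows "(\<And>\<psi>. \<psi> \<in> set \<Psi> \<Longrightarrow> fprov p (Imp \<psi> A)) \<Longrightarrow> sz (Disj \<Psi>) \<le> M \<Longrightarrow>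
         fprov ((length \<Psi> + 1) * (p + K0 * M)) (Imp (Disj \<Psi>) A)"
proof (induction \<Psi> rule: Disj.induct)
  case 1
  then show ?case
    using fprov_False[OF assms assms assms] by (auto elim: fprov_mono)
next
  case (2 \<phi>)
  then have "fprov p (Imp \<phi> A)" by simp
  then show ?case unfolding Disj.simps by (rule fprov_mono) (simp add: algebra_simps)
next
  case (3 \<phi> \<psi> \<Phi>)
  then have "fprov (p + (length (\<psi> # \<Phi>) + 1) * (p + K0 * M) + K0 * M) (Imp (Dis \<phi> (Disj (\<psi> # \<Phi>))) A)"
    by - (rule fprov_DisE; auto simp: assms)
  then show ?case unfolding Disj.simps by (rule fprov_mono) (simp add: algebra_simps)
qed

text \<open>Passing an element of the list costs one projection and one composition of implications,
  hence the factor 2.\<close>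

lemma fprov_ConjD:
  "\<psi> \<in> set \<Psi> \<Longrightarrow> sz (Conj \<Psi>) \<le> M \<Longrightarrow> fprov (length \<Psi> * (2 * (K0 * M))) (Imp (Conj \<Psi>) \<psi>)"
proof (induction \<Psi> rule: Conj.induct)
  case (2 \<phi>)
  then have "fprov (K0 * M) (Imp \<phi> \<phi>)" using fprov_refl[of \<phi> M \<phi> \<phi>] by simp
  with 2 show ?case by (auto elim: fprov_mono)
next
  case (3 \<phi> \<chi> \<Phi>)
  let ?T = "Conj (\<chi> # \<Phi>)"
  have le: "sz \<phi> \<le> M" "sz ?T \<le> M" "sz (Con \<phi> ?T) \<le> M" using 3 by auto
  show ?case
  proof (cases "\<psi> = \<phi>")
    case True
    have "fprov (K0 * M) (Imp (Con \<phi> ?T) \<phi>)" by (rule fprov_Con1[OF le])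
    with True show ?thesis by (auto elim: fprov_mono)
  next
    case False
    with 3 have mem: "\<psi> \<in> set (\<chi> # \<Phi>)" by simp
    with 3 have IH: "fprov (length (\<chi> # \<Phi>) * (2 * (K0 * M))) (Imp ?T \<psi>)" by auto
    have "sz \<psi> \<le> M" using sz_le_sz_Conj[OF mem] le by simp
    moreover have "fprov (K0 * M) (Imp (Con \<phi> ?T) ?T)" by (rule fprov_Con2[OF le])
    ultimately have "fprov (K0 * M + length (\<chi> # \<Phi>) * (2 * (K0 * M)) + K0 * M) (Imp (Con \<phi> ?T) \<psi>)"
      by (intro fprov_trans[OF le(3,2) _ _ IH])
    then show ?thesis unfolding Conj.simps by (rule fprov_mono) (simp add: algebra_simps)
  qed
qed simp

lemma fprov_DisjI:
  "\<psi> \<in> set \<Psi> \<Longrightarrow> sz (Disj \<Psi>) \<le> M \<Longrightarrow> fprov (length \<Psi> * (2 * (K0 * M))) (Imp \<psi> (Disj \<Psi>))"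
proof (induction \<Psi> rule: Disj.induct)
  case (2 \<phi>)
  then have "fprov (K0 * M) (Imp \<phi> \<phi>)" using fprov_refl[of \<phi> M \<phi> \<phi>] by simp
  with 2 show ?case by (auto elim: fprov_mono)
next
  case (3 \<phi> \<chi> \<Phi>)
  let ?T = "Disj (\<chi> # \<Phi>)"
  have le: "sz \<phi> \<le> M" "sz ?T \<le> M" "sz (Dis \<phi> ?T) \<le> M" using 3 by auto
  show ?case
  proof (cases "\<psi> = \<phi>")
    case True
    have "fprov (K0 * M) (Imp \<phi> (Dis \<phi> ?T))" by (rule fprov_Dis1[OF le])
    with True show ?thesis by (auto elim: fprov_mono)
  next
    case False
    with 3 have mem: "\<psi> \<in> set (\<chi> # \<Phi>)" by simp
    with 3 have IH: "fprov (length (\<chi> # \<Phi>) * (2 * (K0 * M))) (Imp \<psi> ?T)" by auto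
    have sz: "sz \<psi> \<le> M" using sz_le_sz_Disj[OF mem] le by simp
    moreover have "fprov (K0 * M) (Imp ?T (Dis \<phi> ?T))" by (rule fprov_Dis2[OF le])
    ultimately have "fprov (length (\<chi> # \<Phi>) * (2 * (K0 * M)) + K0 * M + K0 * M) (Imp \<psi> (Dis \<phi> ?T))"
      by (intro fprov_trans[OF sz le(2,3) IH])
    then show ?thesis unfolding Disj.simps by (rule fprov_mono) (simp add: algebra_simps)
  qed
qed simp

subsection \<open>Formulas decided by few atoms\<close>

text \<open>Kleene's strong three-valued evaluation. A formula that it makes true under all assignments
  to a bounded number of atoms has short proofs, no matter how many other atoms it contains.\<close>

fun keval :: "('a \<Rightarrow> bool option) \<Rightarrow> 'a form \<Rightarrow> bool option" where
  "keval e (Cst b) = Some b"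
| "keval e (At a) = e a"
| "keval e (Neg \<phi>) = map_option Not (keval e \<phi>)"
| "keval e (Con \<phi> \<psi>) =
     (if keval e \<phi> = Some False \<or> keval e \<psi> = Some False then Some False
      else if keval e \<phi> = Some True \<and> keval e \<psi> = Some True then Some True else None)"
| "keval e (Dis \<phi> \<psi>) =
     (if keval e \<phi> = Some True \<or> keval e \<psi> = Some True then Some True
      else if keval e \<phi> = Some False \<and> keval e \<psi> = Some False then Some False else None)"
| "keval e (Imp \<phi> \<psi>) =
     (if keval e \<phi> = Some False \<or> keval e \<psi> = Some True then Some True
      else if keval e \<phi> = Some True \<and> keval e \<psi> = Some False then Some False else None)"

lemma keval_total: "keval (\<lambda>a. Some (e a)) \<phi> = Some (fm_eval e \<phi>)"
  by (induction \<phi>) auto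

lemma keval_inst:
  "keval e (inst \<theta> \<phi>) = keval (\<lambda>a. case \<theta> a of None \<Rightarrow> e a | Some b \<Rightarrow> Some b) \<phi>"
  by (induction \<phi>) (auto split: option.splits)

text \<open>The proof follows the evaluation. A connective decided by one side needs a proof for
  that side only, so undecided subformulas are never touched and the cost stays linear in
  \<open>sz \<phi>\<close>.\<close>

lemma fprov_keval:
  assumes "\<And>a b. e a = Some b \<Longrightarrow> fprov p (Imp H (lit b (At a)))" and H: "sz H \<le> M"
  shows "keval e \<phi> = Some b \<Longrightarrow> sz \<phi> \<le> M \<Longrightarrow> fprov (sz \<phi> * (p + K0 * M)) (Imp H (lit b \<phi>))"
proof (induction \<phi> arbitrary: b)
  case (Cst c)
  then show ?case
    using fprov_True[OF H H H] fprov_notFalse[OF H H H]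
    by (auto simp: lit_def elim: fprov_mono)
next
  case (At a)
  from fprov_mono[OF assms(1), of a b] At show ?case by simp
next
  case (Neg \<phi>)
  then obtain c where c: "keval e \<phi> = Some c" "b = (\<not> c)" by auto
  have "fprov (sz \<phi> * (p + K0 * M)) (Imp H (lit c \<phi>))" using Neg c by auto
  moreover have "fprov (sz \<phi> * (p + K0 * M) + K0 * M) (Imp H (Neg (Neg \<phi>)))" if "c"
    using calculation that Neg.prems H by - (rule fprov_notnotI; auto simp: lit_def)
  ultimately show ?case
    using c by (cases c) (auto simp: lit_def elim!: fprov_mono)
next
  case (Con \<phi> \<psi>)
  have sz: "sz \<phi> \<le> M" "sz \<psi> \<le> M" using Con.prems by auto
  let ?P = "sz \<phi> * (p + K0 * M)" and ?Q = "sz \<psi> * (p + K0 * M)"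
  have IH: "keval e \<phi> = Some c \<Longrightarrow> fprov ?P (Imp H (lit c \<phi>))"
    "keval e \<psi> = Some c \<Longrightarrow> fprov ?Q (Imp H (lit c \<psi>))" for c
    using Con.IH sz by auto
  have "fprov (?P + ?Q + K0 * M) (Imp H (lit b (Con \<phi> \<psi>)))"
  proof -
    consider "keval e \<phi> = Some False" "\<not> b" | "keval e \<psi> = Some False" "\<not> b"
      | "keval e \<phi> = Some True" "keval e \<psi> = Some True" "b"
      using Con.prems(1) by (cases b) (simp_all split: if_split_asm, blast+)
    then show ?thesis
    proof cases
      case 1
      then have "fprov (?P + K0 * M) (Imp H (Neg (Con \<phi> \<psi>)))"
        using IH(1)[OF 1(1)] sz H by - (rule fprov_notConI1; auto simp: lit_def)
      with 1 show ?thesis by (auto simp: lit_def elim!: fprov_mono)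
    next
      case 2
      then have "fprov (?Q + K0 * M) (Imp H (Neg (Con \<phi> \<psi>)))"
        using IH(2)[OF 2(1)] sz H by - (rule fprov_notConI2; auto simp: lit_def)
      with 2 show ?thesis by (auto simp: lit_def elim!: fprov_mono)
    next
      case 3
      then show ?thesis
        using fprov_ConI[OF H sz, of ?P ?Q] IH(1)[OF 3(1)] IH(2)[OF 3(2)] by (simp add: lit_def)
    qed
  qed
  then show ?case by (rule fprov_mono) (simp add: algebra_simps)
next
  case (Dis \<phi> \<psi>)
  have sz: "sz \<phi> \<le> M" "sz \<psi> \<le> M" using Dis.prems by auto
  let ?P = "sz \<phi> * (p + K0 * M)" and ?Q = "sz \<psi> * (p + K0 * M)"
  have IH: "keval e \<phi> = Some c \<Longrightarrow> fprov ?P (Imp H (lit c \<phi>))"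
    "keval e \<psi> = Some c \<Longrightarrow> fprov ?Q (Imp H (lit c \<psi>))" for c
    using Dis.IH sz by auto
  have "fprov (?P + ?Q + K0 * M) (Imp H (lit b (Dis \<phi> \<psi>)))"
  proof -
    consider "keval e \<phi> = Some True" "b" | "keval e \<psi> = Some True" "b"
      | "keval e \<phi> = Some False" "keval e \<psi> = Some False" "\<not> b"
      using Dis.prems(1) by (cases b) (simp_all split: if_split_asm, blast+)
    then show ?thesis
    proof cases
      case 1
      then have "fprov (?P + K0 * M) (Imp H (Dis \<phi> \<psi>))"
        using IH(1)[OF 1(1)] sz H by - (rule fprov_DisI1; auto simp: lit_def)
      with 1 show ?thesis by (auto simp: lit_def elim!: fprov_mono)
    next
      case 2
      then have "fprov (?Q + K0 * M) (Imp H (Dis \<phi> \<psi>))"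
        using IH(2)[OF 2(1)] sz H by - (rule fprov_DisI2; auto simp: lit_def)
      with 2 show ?thesis by (auto simp: lit_def elim!: fprov_mono)
    next
      case 3
      then show ?thesis
        using fprov_notDisI[OF H sz, of ?P ?Q] IH(1)[OF 3(1)] IH(2)[OF 3(2)] by (simp add: lit_def)
    qed
  qed
  then show ?case by (rule fprov_mono) (simp add: algebra_simps)
next
  case (Imp \<phi> \<psi>)
  have sz: "sz \<phi> \<le> M" "sz \<psi> \<le> M" using Imp.prems by auto
  let ?P = "sz \<phi> * (p + K0 * M)" and ?Q = "sz \<psi> * (p + K0 * M)"
  have IH: "keval e \<phi> = Some c \<Longrightarrow> fprov ?P (Imp H (lit c \<phi>))"
    "keval e \<psi> = Some c \<Longrightarrow> fprov ?Q (Imp H (lit c \<psi>))" for c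
    using Imp.IH sz by auto
  have "fprov (?P + ?Q + K0 * M) (Imp H (lit b (Imp \<phi> \<psi>)))"
  proof -
    consider "keval e \<phi> = Some False" "b" | "keval e \<psi> = Some True" "b"
      | "keval e \<phi> = Some True" "keval e \<psi> = Some False" "\<not> b"
      using Imp.prems(1) by (cases b) (simp_all split: if_split_asm, blast+)
    then show ?thesis
    proof cases
      case 1
      then have "fprov (?P + K0 * M) (Imp H (Imp \<phi> \<psi>))"
        using IH(1)[OF 1(1)] sz H by - (rule fprov_ImpI1; auto simp: lit_def)
      with 1 show ?thesis by (auto simp: lit_def elim!: fprov_mono)
    next
      case 2
      then have "fprov (?Q + K0 * M) (Imp H (Imp \<phi> \<psi>))"
        using IH(2)[OF 2(1)] sz H by - (rule fprov_ImpI2; auto simp: lit_def)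
      with 2 show ?thesis by (auto simp: lit_def elim!: fprov_mono)
    next
      case 3
      then show ?thesis
        using fprov_notImpI[OF H sz, of ?P ?Q] IH(1)[OF 3(1)] IH(2)[OF 3(2)] by (simp add: lit_def)
    qed
  qed
  then show ?case by (rule fprov_mono) (simp add: algebra_simps)
qed

text \<open>Each atom of \<open>X\<close> is decided by cases, with a literal added to the
  hypothesis. A literal together with its conjunction sign costs at most 3 symbols, older literals
  are reached by one more projection, and the number of cases doubles. The bound is therefore useful
  only for short \<open>X\<close>.\<close>

lemma fprov_keval_split:
  assumes "\<And>a b. e a = Some b \<Longrightarrow> fprov p (Imp H (lit b (At a)))"
    and "sz H + 3 * length X \<le> M" and "sz \<phi> \<le> M"
    and "\<And>f. keval (\<lambda>a. if a \<in> set X then Some (f a) else e a) \<phi> = Some True"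
  shows "fprov (2 ^ length X * (sz \<phi> * (p + (2 * length X + 1) * (K0 * M)) + length X * (K0 * M))) (Imp H \<phi>)"
  using assms
proof (induction X arbitrary: e p H)
  case Nil
  then show ?case using fprov_keval[of e p H M \<phi> True] by (simp add: lit_def)
next
  case (Cons x X)
  let ?q = "p + 2 * (K0 * M)"
  let ?Q = "2 ^ length X * (sz \<phi> * (?q + (2 * length X + 1) * (K0 * M)) + length X * (K0 * M))"
  have *: "fprov ?Q (Imp (Con H (lit v (At x))) \<phi>)" for v
  proof (rule Cons.IH[where e = "e(x := Some v)"])
    have H: "sz H \<le> M" "sz (lit v (At x)) \<le> M" "sz (Con H (lit v (At x))) \<le> M"
      using Cons.prems(2) by (auto simp: lit_def)
    show "fprov ?q (Imp (Con H (lit v (At x))) (lit b (At a)))"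
      if "(e(x := Some v)) a = Some b" for a b
    proof (cases "a = x")
      case True
      then have "fprov (K0 * M) (Imp (Con H (lit v (At x))) (lit b (At a)))"
        using that fprov_Con2[OF H] by auto
      then show ?thesis by (rule fprov_mono) simp
    next
      case False
      then have "fprov p (Imp H (lit b (At a)))" using that Cons.prems(1) by auto
      moreover have "fprov (K0 * M) (Imp (Con H (lit v (At x))) H)"
        by (rule fprov_Con1[OF H])
      moreover have "sz (lit b (At a)) \<le> M" using Cons.prems(2) by (auto simp: lit_def)
      ultimately have "fprov (K0 * M + p + K0 * M) (Imp (Con H (lit v (At x))) (lit b (At a)))"
        by (intro fprov_trans[OF H(3) H(1)])
      then show ?thesis by (rule fprov_mono) simp
    qed
    show "sz (Con H (lit v (At x))) + 3 * length X \<le> M"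
      using Cons.prems(2) by (auto simp: lit_def)
    show "sz \<phi> \<le> M" by fact
    fix f
    \<comment> \<open>\<open>X\<close> may list an atom twice, as for a gate whose two arguments
      coincide; then the later case distinction determines its value.\<close>
    have "(\<lambda>a. if a \<in> set X then Some (f a) else (e(x := Some v)) a) =
      (\<lambda>a. if a \<in> set (x # X) then Some ((if x \<in> set X then f else f(x := v)) a) else e a)"
      by (auto simp: fun_eq_iff)
    then show "keval (\<lambda>a. if a \<in> set X then Some (f a) else (e(x := Some v)) a) \<phi> = Some True"
      using Cons.prems(4) by presburger
  qed
  have "fprov (?Q + ?Q + K0 * M) (Imp H \<phi>)"
    using *[of True] *[of False] Cons.prems(2,3)
    by - (rule fprov_split[where B = "At x"]; auto simp: lit_def)
  then show ?case
  proof (rule fprov_mono)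
    have "1 \<le> (2::nat) ^ length (x # X)" by simp
    then have "K0 * M \<le> 2 ^ length (x # X) * (K0 * M)"
      using mult_right_mono by fastforce
    then show "?Q + ?Q + K0 * M \<le> 2 ^ length (x # X) *
      (sz \<phi> * (p + (2 * length (x # X) + 1) * (K0 * M)) + length (x # X) * (K0 * M))"
      by (simp add: algebra_simps)
  qed
qed

text \<open>\<open>M\<close> also has to bound the hypotheses on three atoms that occur in the case distinction.\<close>

lemma fprov_keval_taut:
  assumes "length X \<le> 3" and "sz \<phi> + 10 \<le> M"
    and "\<And>f. keval (\<lambda>a. if a \<in> set X then Some (f a) else None) \<phi> = Some True"
  shows "fprov (100 * (K0 * (M * M))) \<phi>"
proof -
  let ?n = "length X" and ?KM = "K0 * M"
  \<comment> \<open>The trivial hypothesis \<open>Cst True\<close> has size 1; three literals bring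
    it to at most 1 + 3 * 3 = 10, which is the slack demanded of \<open>M\<close>.\<close>
  have "fprov (2 ^ ?n * (sz \<phi> * (0 + (2 * ?n + 1) * ?KM) + ?n * ?KM)) (Imp (Cst True) \<phi>)"
    by (rule fprov_keval_split[where e = "\<lambda>_. None"]) (use assms in auto)
  then have "fprov (2 ^ ?n * (sz \<phi> * (0 + (2 * ?n + 1) * ?KM) + ?n * ?KM) + ?KM) \<phi>"
    using assms(2) by (intro fprov_trueE[of \<phi> M \<phi> \<phi>]) auto
  then show ?thesis
  proof (rule fprov_mono)
    have "(2::nat) ^ ?n \<le> 2 ^ 3" using assms(1) by (intro power_increasing) auto
    then have "2 ^ ?n * (sz \<phi> * (0 + (2 * ?n + 1) * ?KM) + ?n * ?KM) \<le> 8 * (sz \<phi> * (7 * ?KM) + 3 * ?KM)"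
      using assms(1) by (intro mult_mono add_mono) auto
    moreover have "8 * (sz \<phi> * (7 * ?KM) + 3 * ?KM) + ?KM \<le> 100 * (K0 * (M * M))"
    proof -
      have "8 * (sz \<phi> * (7 * ?KM) + 3 * ?KM) + ?KM = (56 * sz \<phi> + 25) * ?KM"
        by (simp add: algebra_simps)
      also have "\<dots> \<le> (100 * M) * ?KM" using assms(2) by (intro mult_right_mono) auto
      finally show ?thesis by (simp add: algebra_simps)
    qed
    ultimately show "2 ^ ?n * (sz \<phi> * (0 + (2 * ?n + 1) * ?KM) + ?n * ?KM) + ?KM \<le> 100 * (K0 * (M * M))"
      by linarith
  qed
qed

subsection \<open>Combining implications between conjuncts and disjuncts\<close>

text \<open>Both halves go through a single disjunct of \<open>Y\<close>: refuting \<open>Y\<close>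
  yields every conjunct of every \<open>D s\<close>, and each member of any \<open>E s\<close>
  implies \<open>Y\<close>. A conjunct of \<Delta> without counterpart must be provable, and a
  disjunct of \<Omega> without counterpart refutable.\<close>

lemma fprov_combine:
  fixes Y :: fm
  assumes sz: "sz (Imp (Imp (Conj \<Delta>) (Disj \<Omega>)) Y) \<le> M"
    and Y: "Y = Disj (map (\<lambda>s. Imp (Conj (D s)) (Disj (E s))) [0..<r])"
    and \<Delta>: "\<And>\<delta>. \<delta> \<in> set \<Delta> \<Longrightarrow> fprov p \<delta> \<or> (\<exists>s<r. \<exists>\<delta>'\<in>set (D s). fprov p (Imp \<delta>' \<delta>))"
    and \<Omega>: "\<And>\<omega>. \<omega> \<in> set \<Omega> \<Longrightarrow> fprov p (Neg \<omega>) \<or> (\<exists>s<r. \<exists>\<omega>'\<in>set (E s). fprov p (Imp \<omega> \<omega>'))"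
  shows "fprov (2 * M * (p + 10 * (K0 * (M * M)))) (Imp (Imp (Conj \<Delta>) (Disj \<Omega>)) Y)"
proof -
  let ?K = "K0 * M" and ?KK = "K0 * (M * M)"
  have M1: "1 \<le> M" using sz by simp
  then have K1: "?K \<le> ?KK" by simp
  have szY: "sz Y \<le> M" "sz (Neg Y) \<le> M" "sz (Conj \<Delta>) \<le> M" "sz (Disj \<Omega>) \<le> M"
    and len: "length \<Delta> + 1 \<le> M" "length \<Omega> + 1 \<le> M"
    using sz length_le_sz_Conj[of \<Delta>] length_le_sz_Disj[of \<Omega>] by auto
  have Ys: "fprov (2 * ?KK) (Imp (Imp (Conj (D s)) (Disj (E s))) Y)"
    and szDE: "sz (Conj (D s)) \<le> M" "sz (Disj (E s)) \<le> M" if "s < r" for s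
  proof -
    let ?l = "map (\<lambda>s. Imp (Conj (D s)) (Disj (E s))) [0..<r]"
    have mem: "Imp (Conj (D s)) (Disj (E s)) \<in> set ?l" using that by auto
    have "length ?l \<le> M" using length_le_sz_Disj[of ?l] szY by (simp add: Y)
    then have "length ?l * (2 * ?K) \<le> 2 * ?KK" by (simp add: algebra_simps)
    then show "fprov (2 * ?KK) (Imp (Imp (Conj (D s)) (Disj (E s))) Y)"
      using fprov_DisjI[OF mem, of M] szY by (auto simp: Y elim: fprov_mono)
    show "sz (Conj (D s)) \<le> M" "sz (Disj (E s)) \<le> M"
      using sz_le_sz_Disj[OF mem] szY by (simp_all add: Y)
  qed
  have 1: "fprov (p + 8 * ?KK) (Imp (Neg Y) \<delta>)" if \<delta>: "\<delta> \<in> set \<Delta>" for \<delta>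
  proof -
    have sz\<delta>: "sz \<delta> \<le> M" using sz_le_sz_Conj[OF \<delta>] szY by simp
    from \<Delta>[OF \<delta>] show ?thesis
    proof (elim disjE exE bexE conjE)
      assume "fprov p \<delta>"
      from fprov_weaken[OF sz\<delta> szY(2) sz\<delta> this] show ?thesis
        by (rule fprov_mono) (use K1 in simp)
    next
      fix s \<delta>' assume s: "s < r" and \<delta>': "\<delta>' \<in> set (D s)" "fprov p (Imp \<delta>' \<delta>)"
      have sz\<delta>': "sz \<delta>' \<le> M" using sz_le_sz_Conj[OF \<delta>'(1)] szDE(1)[OF s] by simp
      have "length (D s) \<le> M" using length_le_sz_Conj[of "D s"] szDE(1)[OF s] by simp
      then have "length (D s) * (2 * ?K) \<le> 2 * ?KK" by (simp add: algebra_simps)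
      from fprov_mono[OF fprov_ConjD[OF \<delta>'(1) szDE(1)[OF s]] this]
      have b: "fprov (2 * ?KK) (Imp (Conj (D s)) \<delta>')" .
      have a: "fprov (2 * ?KK + ?K) (Imp (Neg Y) (Conj (D s)))"
        by (rule fprov_Imp_target1[OF szDE[OF s] szY(1) Ys[OF s]])
      from fprov_trans[OF szY(2) sz\<delta>' sz\<delta> fprov_trans[OF szY(2) szDE(1)[OF s] sz\<delta>' a b] \<delta>'(2)]
      show ?thesis by (rule fprov_mono) (use K1 in simp)
    qed
  qed
  have 2: "fprov (p + 8 * ?KK) (Imp \<omega> Y)" if \<omega>: "\<omega> \<in> set \<Omega>" for \<omega>
  proof -
    have sz\<omega>: "sz \<omega> \<le> M" using sz_le_sz_Disj[OF \<omega>] szY by simp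
    from \<Omega>[OF \<omega>] show ?thesis
    proof (elim disjE exE bexE conjE)
      assume "fprov p (Neg \<omega>)"
      from fprov_absurd[OF sz\<omega> szY(1) sz\<omega> this] show ?thesis
        by (rule fprov_mono) (use K1 in simp)
    next
      fix s \<omega>' assume s: "s < r" and \<omega>': "\<omega>' \<in> set (E s)" "fprov p (Imp \<omega> \<omega>')"
      have sz\<omega>': "sz \<omega>' \<le> M" using sz_le_sz_Disj[OF \<omega>'(1)] szDE(2)[OF s] by simp
      have "length (E s) \<le> M" using length_le_sz_Disj[of "E s"] szDE(2)[OF s] by simp
      then have "length (E s) * (2 * ?K) \<le> 2 * ?KK" by (simp add: algebra_simps)
      from fprov_mono[OF fprov_DisjI[OF \<omega>'(1) szDE(2)[OF s]] this]
      have b: "fprov (2 * ?KK) (Imp \<omega>' (Disj (E s)))" .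
      have a: "fprov (2 * ?KK + ?K) (Imp (Disj (E s)) Y)"
        by (rule fprov_Imp_target2[OF szDE[OF s] szY(1) Ys[OF s]])
      from fprov_trans[OF sz\<omega> sz\<omega>' szY(1) \<omega>'(2) fprov_trans[OF sz\<omega>' szDE(2)[OF s] szY(1) b a]]
      show ?thesis by (rule fprov_mono) (use K1 in simp)
    qed
  qed
  have mul: "(l + 1) * (p + 8 * ?KK + ?K) \<le> M * (p + 9 * ?KK)" if "l + 1 \<le> M" for l
    using that K1 by (intro mult_mono) auto
  have "fprov (M * (p + 9 * ?KK)) (Imp (Neg Y) (Conj \<Delta>))"
    by (rule fprov_mono[OF fprov_ConjI[OF szY(2) 1 szY(3)] mul[OF len(1)]])
  moreover have "fprov (M * (p + 9 * ?KK)) (Imp (Disj \<Omega>) Y)"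
    by (rule fprov_mono[OF fprov_DisjE[OF szY(1) 2 szY(4)] mul[OF len(2)]])
  ultimately have "fprov (M * (p + 9 * ?KK) + M * (p + 9 * ?KK) + ?K) (Imp (Imp (Conj \<Delta>) (Disj \<Omega>)) Y)"
    using szY by (intro fprov_ImpE)
  then show ?thesis
  proof (rule fprov_mono)
    have "1 * ?K \<le> (2 * M) * ?KK" using K1 M1 by (intro mult_mono) auto
    then show "M * (p + 9 * ?KK) + M * (p + 9 * ?KK) + ?K \<le> 2 * M * (p + 10 * ?KK)"
      by (simp add: algebra_simps)
  qed
qed

section \<open>The definition sequence of the gadget generator\<close>

text \<open>Flattens the loop over evaluations and positions, so that a definition or output is
  addressed by quotient and remainder of one index.\<close>

lemma concat_map_map_upt:
  "concat (map (\<lambda>s. map (f s) [0..<c]) [0..<r]) = map (\<lambda>q. f (q div c) (q mod c)) [0..<r * c]"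
proof (induction r)
  case (Suc r)
  have "map (\<lambda>q. f (q div c) (q mod c)) [r * c..<r * c + c] = map (f r) [0..<c]"
    by (rule nth_equalityI) auto
  moreover have "[0..<Suc r * c] = [0..<r * c] @ [r * c..<r * c + c]"
    using upt_add_eq_append[of 0 "r * c" c] by (simp add: add.commute[of c])
  ultimately show ?case using Suc by simp
qed simp

section \<open>Address lookups and gate formulas under partial assignments\<close>

lemma keval_Conj_True: "(\<And>x. x \<in> set xs \<Longrightarrow> keval e x = Some True) \<Longrightarrow> keval e (Conj xs) = Some True"
  by (induction xs rule: Conj.induct) auto

lemma keval_Conj_False: "x \<in> set xs \<Longrightarrow> keval e x = Some False \<Longrightarrow> keval e (Conj xs) = Some False"
  by (induction xs rule: Conj.induct) auto

lemma keval_Disj_False: "(\<And>x. x \<in> set xs \<Longrightarrow> keval e x = Some False) \<Longrightarrow> keval e (Disj xs) = Some False"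
  by (induction xs rule: Disj.induct) auto

lemma keval_Disj_True: "x \<in> set xs \<Longrightarrow> keval e x = Some True \<Longrightarrow> keval e (Disj xs) = Some True"
  by (induction xs rule: Disj.induct) auto

lemma nat_eq_if_odd_div_eq:
  fixes m n :: nat
  shows "m < 2 ^ w \<Longrightarrow> n < 2 ^ w \<Longrightarrow> (\<And>t. t < w \<Longrightarrow> odd (m div 2 ^ t) = odd (n div 2 ^ t)) \<Longrightarrow> m = n"
proof (induction w arbitrary: m n)
  case (Suc w)
  have "m div 2 = n div 2"
  proof (rule Suc.IH)
    fix t assume "t < w"
    then show "odd (m div 2 div 2 ^ t) = odd (n div 2 div 2 ^ t)"
      using Suc.prems(3)[of "Suc t"] by (simp add: div_mult2_eq)
  qed (use Suc.prems in auto)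
  moreover have "odd m = odd n" using Suc.prems(3)[of 0] by simp
  ultimately show ?case
    by (metis odd_two_times_div_two_succ even_two_times_div_two)
qed simp

text \<open>Stated for partial \<open>e\<close>, so that it serves twice: for the total assignment
  in the correctness of the gadget formulas, and for the constants substituted in the
  embedding.\<close>

definition reads_addr :: "(nat \<Rightarrow> bool option) \<Rightarrow> nat \<Rightarrow> nat \<Rightarrow> nat \<Rightarrow> nat \<Rightarrow> bool" where
  "reads_addr e a w p A \<longleftrightarrow>
     A < 2 ^ w \<and> (\<forall>t < w. keval e (desc_fm a (p + t)) = Some (odd (A div 2 ^ t)))"

lemma keval_addr_fm:
  assumes "reads_addr e a w p A" "j < 2 ^ w"
  shows "keval e (addr_fm a w p j) = Some (j = A)"
proof (cases "j = A")
  case True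
  with assms show ?thesis
    by (auto simp: addr_fm_def reads_addr_def intro!: keval_Conj_True)
next
  case False
  then obtain t where t: "t < w" "odd (j div 2 ^ t) \<noteq> odd (A div 2 ^ t)"
    using assms nat_eq_if_odd_div_eq[of j w A] by (auto simp: reads_addr_def)
  let ?x = "if odd (j div 2 ^ t) then desc_fm a (p + t) else Neg (desc_fm a (p + t))"
  have "keval e (addr_fm a w p j) = Some False"
    unfolding addr_fm_def
  proof (rule keval_Conj_False[of ?x])
    show "keval e ?x = Some False"
      using t assms(1) by (auto simp: reads_addr_def)
  qed (use t in auto)
  with False show ?thesis by simp
qed

lemma keval_select_fm:
  assumes A: "reads_addr e a w p A" and l: "l \<le> 2 ^ w"
    and b: "A < l \<Longrightarrow> keval e (nd A) = Some b" "l \<le> A \<Longrightarrow> \<not> b"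
  shows "keval e (select_fm a w p l nd) = Some b"
proof -
  have *: "keval e (addr_fm a w p j) = Some (j = A)" if "j < l" for j
    using keval_addr_fm[OF A] that l by simp
  have "keval e (select_fm a w p l nd) = Some True" if b
    unfolding select_fm_def
  proof (rule keval_Disj_True)
    have "A < l" using that b(2) by force
    then show "Con (addr_fm a w p A) (nd A) \<in> set (map (\<lambda>j. Con (addr_fm a w p j) (nd j)) [0..<l])"
      "keval e (Con (addr_fm a w p A) (nd A)) = Some True"
      using that b *[of A] by auto
  qed
  moreover have "keval e (select_fm a w p l nd) = Some False" if "\<not> b"
    unfolding select_fm_def
  proof (rule keval_Disj_False)
    fix x assume "x \<in> set (map (\<lambda>j. Con (addr_fm a w p j) (nd j)) [0..<l])"
    then obtain j where "x = Con (addr_fm a w p j) (nd j)" "j < l" by auto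
    then show "keval e x = Some False" using that b(1) *[of j] by auto
  qed
  ultimately show ?thesis by (cases b) auto
qed

lemma keval_cv_gate_fm:
  assumes "keval e (desc_fm a p) = Some d" "keval e (desc_fm a (p + 1)) = Some d'"
    and "\<not> d' \<or> \<not> d \<Longrightarrow> keval e (select_fm a w (p + 2) l nd) = Some x"
    and "d \<noteq> d' \<Longrightarrow> keval e (select_fm a w (p + 2 + w) l nd) = Some y"
    and "d \<and> d' \<Longrightarrow> keval e (desc_fm a (p + 2)) = Some z"
  shows "keval e (cv_gate_fm a w p l nd) =
    Some (if d then if d' then z else x \<or> y else if d' then x \<and> y else \<not> x)"
  using assms by (cases d; cases d') (simp_all add: cv_gate_fm_def Let_def)

lemma cv_gate_fm_eval:
  "fm_eval e (cv_gate_fm a w p l nd) =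
    (if fm_eval e (desc_fm a p)
     then if fm_eval e (desc_fm a (p + 1)) then fm_eval e (desc_fm a (p + 2))
          else fm_eval e (select_fm a w (p + 2) l nd) \<or> fm_eval e (select_fm a w (p + 2 + w) l nd)
     else if fm_eval e (desc_fm a (p + 1))
          then fm_eval e (select_fm a w (p + 2) l nd) \<and> fm_eval e (select_fm a w (p + 2 + w) l nd)
          else \<not> fm_eval e (select_fm a w (p + 2) l nd))"
  by (auto simp: cv_gate_fm_def Let_def)

lemma read_addr_bits:
  "read_addr v w p < 2 ^ w \<and> (\<forall>t < w. odd (read_addr v w p div 2 ^ t) = at0 v (p + t))"
proof (induction w)
  case (Suc w)
  let ?A = "read_addr v w p" and ?b = "of_bool (at0 v (p + w)) :: nat"
  have A: "read_addr v (Suc w) p = ?A + ?b * 2 ^ w" by (simp add: read_addr_def)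
  have "odd ((?A + ?b * 2 ^ w) div 2 ^ t) = at0 v (p + t)" if "t < Suc w" for t
  proof (cases "t = w")
    case True
    then show ?thesis using Suc by simp
  next
    case False
    then have t: "t < w" using that by simp
    then have "(2::nat) ^ w = 2 ^ t * 2 ^ (w - t)" by (simp flip: power_add)
    then have "(?A + ?b * 2 ^ w) div 2 ^ t = ?A div 2 ^ t + ?b * 2 ^ (w - t)"
      by (simp add: mult.left_commute)
    then show ?thesis using Suc t by simp
  qed
  moreover have "?A + ?b * 2 ^ w < 2 ^ Suc w" using Suc by auto
  ultimately show ?case unfolding A by blast
qed (simp add: read_addr_def)

lemma addr_len_ge: "a + k \<le> 2 ^ addr_len a k"
  unfolding addr_len_def by (rule LeastI[of _ "a + k"]) (simp add: less_imp_le)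

lemma addr_len_le: "a + k \<le> 2 ^ w \<Longrightarrow> addr_len a k \<le> w"
  unfolding addr_len_def by (rule Least_le)

lemma num_gates_le: "num_gates a k \<le> a"
  unfolding num_gates_def by (meson diff_le_self div_le_dividend le_trans)

lemma nodes_le_addr: "k + num_gates a k \<le> 2 ^ addr_len a k"
  using addr_len_ge[of a k] num_gates_le[of a k] by linarith

text \<open>Circuits and definition sequences are evaluated by the same kind of fold; an appended
  entry is computed from the entries before it and never changes afterwards.\<close>

lemma foldl_snoc:
  fixes h :: "'a list \<Rightarrow> 'b \<Rightarrow> 'a" and x :: "'a list" and ys :: "'b list"
  defines "R \<equiv> foldl (\<lambda>vs y. vs @ [h vs y]) x ys"
  shows length_foldl_snoc: "length R = length x + length ys"
    and take_foldl_snoc: "take (length x) R = x"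
    and nth_foldl_snoc: "i < length ys \<Longrightarrow> R ! (length x + i) = h (take (length x + i) R) (ys ! i)"
proof -
  have "length (foldl (\<lambda>vs y. vs @ [h vs y]) x ys) = length x + length ys \<and>
    take (length x) (foldl (\<lambda>vs y. vs @ [h vs y]) x ys) = x \<and>
    (\<forall>i < length ys. foldl (\<lambda>vs y. vs @ [h vs y]) x ys ! (length x + i) =
       h (take (length x + i) (foldl (\<lambda>vs y. vs @ [h vs y]) x ys)) (ys ! i))"
    by (induction ys rule: rev_induct) (auto simp: nth_append less_Suc_eq)
  then show "length R = length x + length ys" "take (length x) R = x"
    "i < length ys \<Longrightarrow> R ! (length x + i) = h (take (length x + i) R) (ys ! i)"
    unfolding R_def by auto
qed

lemma at0_take: "at0 (take n vs) j \<longleftrightarrow> j < n \<and> at0 vs j"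
  by (auto simp: at0_def)

lemma fm_eval_cong: "(\<And>a. a \<in> atoms \<phi> \<Longrightarrow> e a = e' a) \<Longrightarrow> fm_eval e \<phi> = fm_eval e' \<phi>"
  by (induction \<phi>) auto

lemma atoms_Conj: "atoms (Conj xs) = (\<Union>x \<in> set xs. atoms x)"
  by (induction xs rule: Conj.induct) auto

lemma atoms_Disj: "atoms (Disj xs) = (\<Union>x \<in> set xs. atoms x)"
  by (induction xs rule: Disj.induct) auto

lemma atoms_desc_fm: "atoms (desc_fm a p) \<subseteq> {..<a}"
  by (simp add: desc_fm_def)

lemma atoms_addr_fm: "atoms (addr_fm a w p j) \<subseteq> {..<a}"
  unfolding addr_fm_def atoms_Conj
  by (intro UN_least) (auto simp: desc_fm_def split: if_splits)

lemma atoms_select_fm: "atoms (select_fm a w p l nd) \<subseteq> {..<a} \<union> (\<Union>j<l. atoms (nd j))"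
  unfolding select_fm_def atoms_Disj
  by (rule UN_least) (use atoms_addr_fm in force)

lemma atoms_cv_gate_fm: "atoms (cv_gate_fm a w p l nd) \<subseteq> {..<a} \<union> (\<Union>j<l. atoms (nd j))"
proof -
  have "atoms (cv_gate_fm a w p l nd) \<subseteq> atoms (desc_fm a p) \<union> atoms (desc_fm a (p + 1)) \<union>
    atoms (desc_fm a (p + 2)) \<union> atoms (select_fm a w (p + 2) l nd) \<union> atoms (select_fm a w (p + 2 + w) l nd)"
    by (auto simp: cv_gate_fm_def Let_def)
  also have "\<dots> \<subseteq> {..<a} \<union> (\<Union>j<l. atoms (nd j))"
    by (intro Un_least atoms_select_fm le_supI1 atoms_desc_fm)
  finally show ?thesis .
qed

definition cv_idx :: "nat \<Rightarrow> nat \<Rightarrow> nat \<Rightarrow> nat \<Rightarrow> nat" where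
  "cv_idx a k s j = (if j < k then a + s * k + j else a + (a + 1) * k + s * num_gates a k + (j - k))"

lemma cv_node_eq: "cv_node a k s j = At (cv_idx a k s j)"
  by (simp add: cv_node_def cv_idx_def)

lemma block_less: "s \<le> a \<Longrightarrow> j < k \<Longrightarrow> s * k + j < (a + 1) * (k::nat)"
proof -
  assume "s \<le> a" "j < k"
  then have "s * k + j < s * k + k" by simp
  also have "\<dots> = (s + 1) * k" by simp
  also have "\<dots> \<le> (a + 1) * k" using \<open>s \<le> a\<close> by (intro mult_right_mono) auto
  finally show ?thesis .
qed

lemma cv_idx_less:
  assumes "s \<le> a" "j < k + i"
  shows "cv_idx a k s j < a + (a + 1) * k + (s * num_gates a k + i)"
  using assms block_less[of s a j k] by (auto simp: cv_idx_def)

lemma gad_CV_arity: "arity (gad_CV a k) = a + (a + 1) * k"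
  by (simp add: gad_CV_def)

lemma gad_CV_defs:
  "defs (gad_CV a k) =
     map (\<lambda>q. cv_gate_fm a (addr_len a k) (gate_pos a k (q mod num_gates a k)) (k + q mod num_gates a k)
                (cv_node a k (q div num_gates a k))) [0..<(a + 1) * num_gates a k]"
  by (simp add: gad_CV_def concat_map_map_upt del: mult_Suc upt_Suc)

lemma gad_CV_outs:
  "outs (gad_CV a k) =
     map (\<lambda>q. select_fm a (addr_len a k) (q mod (k + 1) * addr_len a k) (k + num_gates a k)
                (cv_node a k (q div (k + 1)))) [0..<(a + 1) * (k + 1)]"
  by (simp add: gad_CV_def concat_map_map_upt del: mult_Suc upt_Suc mult_Suc_right)

lemma length_gad_CV_outs: "length (outs (gad_CV a k)) = (a + 1) * (k + 1)"
  by (simp add: gad_CV_outs del: mult_Suc mult_Suc_right)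

lemma length_gad_CV_defs: "length (defs (gad_CV a k)) = (a + 1) * num_gates a k"
  by (simp add: gad_CV_defs del: mult_Suc mult_Suc_right)

lemma num_atoms_gad_CV: "num_atoms (gad_CV a k) = a + (a + 1) * k + (a + 1) * num_gates a k"
  by (simp add: num_atoms_def gad_CV_arity length_gad_CV_defs del: mult_Suc)

lemma div_mod_block: "i < (N::nat) \<Longrightarrow> (s * N + i) div N = s \<and> (s * N + i) mod N = i"
  by simp

lemma defs_gad_CV_nth:
  assumes "s \<le> a" "i < num_gates a k"
  shows "defs (gad_CV a k) ! (s * num_gates a k + i) =
    cv_gate_fm a (addr_len a k) (gate_pos a k i) (k + i) (cv_node a k s)"
  using assms block_less[OF assms] by (simp add: gad_CV_defs del: mult_Suc)

lemma atoms_gad_CV_gate: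
  assumes "s \<le> a"
  shows "atoms (cv_gate_fm a w p (k + i) (cv_node a k s)) \<subseteq> {..<a + (a + 1) * k + (s * num_gates a k + i)}"
proof -
  have "(\<Union>j<k + i. atoms (cv_node a k s j)) \<subseteq> {..<a + (a + 1) * k + (s * num_gates a k + i)}"
    using cv_idx_less[OF assms] by (auto simp: cv_node_eq simp del: mult_Suc)
  moreover have "{..<a} \<subseteq> {..<a + (a + 1) * k + (s * num_gates a k + i)}" by auto
  ultimately show ?thesis
    by (intro order_trans[OF atoms_cv_gate_fm] Un_least)
qed

text \<open>In each evaluation \<open>s\<close>, the nodes of the decoded circuit reappear in
  \<open>R\<close> at the positions \<open>cv_idx\<close>, by induction on the node number. The
  prefixes formed by \<open>take\<close> express that forward references read as 0 on both
  sides.\<close>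

lemma defseq_eval_gad_CV:
  assumes x: "length x = a + (a + 1) * k"
  shows "defseq_eval (gad_CV a k) x = gad a k (CV a k) x"
proof -
  let ?w = "addr_len a k" and ?N = "num_gates a k" and ?D = "defs (gad_CV a k)"
  define R where "R = foldl (\<lambda>vs \<phi>. vs @ [fm_eval (at0 vs) \<phi>]) x ?D"
  define v where "v = take a x"
  define u where "u s = take k (drop (a + s * k) x)" for s
  define nd where "nd s = nodes (decode a k v) (u s)" for s
  have len_x: "a + s * k + k \<le> length x" if "s \<le> a" for s
  proof -
    have "(s + 1) * k \<le> (a + 1) * k" using that by (intro mult_right_mono) auto
    then show ?thesis using x by simp
  qed
  have len_u: "length (u s) = k" if "s \<le> a" for s
    using len_x[OF that] by (simp add: u_def)
  have len_R: "length R = length x + (a + 1) * ?N"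
    unfolding R_def length_foldl_snoc length_gad_CV_defs ..
  have R_x: "at0 R j = at0 x j" if "j < length x" for j
    using take_foldl_snoc[of x "\<lambda>vs. fm_eval (at0 vs)" ?D] that len_R at0_take[of "length x" R j]
    unfolding R_def by simp
  have gates: "length (gates (decode a k v)) = ?N"
    by (simp add: decode_def)
  have len_nd: "length (nd s) = k + ?N" if "s \<le> a" for s
    using length_foldl_snoc[of "\<lambda>vs. gate_eval (at0 vs)" "u s" "gates (decode a k v)"] len_u[OF that] gates
    by (simp add: nd_def nodes_def)
  have desc: "fm_eval (at0 R) (desc_fm a p) = at0 v p" for p
    using R_x[of p] x by (auto simp: desc_fm_def v_def at0_take)
  have sel: "fm_eval (at0 R) (select_fm a ?w p l (cv_node a k s)) = at0 (take l (nd s)) (read_addr v ?w p)"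
    if nodes: "\<And>j. j < l \<Longrightarrow> at0 R (cv_idx a k s j) = at0 (nd s) j" and l: "l \<le> 2 ^ ?w" for l s p
  proof -
    let ?A = "read_addr v ?w p"
    have "keval (\<lambda>a. Some (at0 R a)) (select_fm a ?w p l (cv_node a k s)) = Some (at0 (take l (nd s)) ?A)"
    proof (rule keval_select_fm[where A = ?A])
      show "reads_addr (\<lambda>a. Some (at0 R a)) a ?w p ?A"
        using read_addr_bits[of v ?w p] by (simp add: reads_addr_def keval_total desc)
    qed (use nodes l in \<open>auto simp: cv_node_eq at0_take\<close>)
    then show ?thesis by (simp add: keval_total)
  qed
  have node: "at0 R (cv_idx a k s j) = at0 (nd s) j" if "s \<le> a" "j < k + ?N" for s j
    using that(2)
  proof (induction j rule: less_induct)
    case (less j)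
    show ?case
    proof (cases "j < k")
      case True
      have "at0 R (a + s * k + j) = x ! (a + s * k + j)"
        using R_x len_x[OF that(1)] True by (simp add: at0_def)
      also have "\<dots> = u s ! j"
        using True len_x[OF that(1)] by (simp add: u_def)
      also have "\<dots> = at0 (nd s) j"
        using take_foldl_snoc[of "u s" "\<lambda>vs. gate_eval (at0 vs)" "gates (decode a k v)"]
          at0_take[of k "nd s" j] len_u[OF that(1)] True
        by (simp add: nd_def nodes_def at0_def)
      finally show ?thesis using True by (simp add: cv_idx_def)
    next
      case False
      define i where "i = j - k"
      have i: "j = k + i" "i < ?N" using False less.prems by (auto simp: i_def)
      let ?q = "s * ?N + i" and ?p = "gate_pos a k i"
      let ?\<phi> = "cv_gate_fm a ?w ?p (k + i) (cv_node a k s)"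
      have q: "?q < length ?D"
        using block_less[OF that(1) i(2)] by (simp add: length_gad_CV_defs)
      have "at0 R (cv_idx a k s j) = R ! (length x + ?q)"
        using q len_R i by (simp add: cv_idx_def at0_def x length_gad_CV_defs add.assoc)
      also have "\<dots> = fm_eval (at0 (take (length x + ?q) R)) (?D ! ?q)"
        using nth_foldl_snoc[OF q] unfolding R_def .
      also have "\<dots> = fm_eval (at0 (take (length x + ?q) R)) ?\<phi>"
        using defs_gad_CV_nth[OF that(1) i(2)] by simp
      \<comment> \<open>A definition mentions only atoms of smaller index, so the prefix may be
        exchanged for all of \<open>R\<close>.\<close>
      also have "\<dots> = fm_eval (at0 R) ?\<phi>"
        using atoms_gad_CV_gate[OF that(1), of ?w ?p k i] x
        by (intro fm_eval_cong) (auto simp: at0_take)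
      also have "\<dots> = gate_eval (at0 (take (k + i) (nd s))) (read_gate v ?w ?p)"
      proof -
        have "fm_eval (at0 R) (select_fm a ?w p' (k + i) (cv_node a k s)) =
          at0 (take (k + i) (nd s)) (read_addr v ?w p')" for p'
          using less.IH i nodes_le_addr[of k a] by (intro sel) auto
        then show ?thesis
          by (simp add: cv_gate_fm_eval desc read_gate_def Let_def)
      qed
      also have "\<dots> = nd s ! j"
        using nth_foldl_snoc[of i "gates (decode a k v)" "\<lambda>vs. gate_eval (at0 vs)" "u s"] gates i
          len_u[OF that(1)]
        by (simp add: nd_def nodes_def decode_def)
      also have "\<dots> = at0 (nd s) j"
        using len_nd[OF that(1)] less.prems by (simp add: at0_def)
      finally show ?thesis .
    qed
  qed
  have out: "fm_eval (at0 R) (select_fm a ?w (t * ?w) (k + ?N) (cv_node a k s)) =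
    at0 (nd s) (read_addr v ?w (t * ?w))" if "s \<le> a" for s t
    using sel[OF node[OF that] nodes_le_addr, of "t * ?w"] len_nd[OF that] by simp
  have "defseq_eval (gad_CV a k) x = map (fm_eval (at0 R)) (outs (gad_CV a k))"
    by (simp only: defseq_eval_def R_def)
  also have "\<dots> = concat (map (\<lambda>s. map (\<lambda>t. fm_eval (at0 R)
      (select_fm a ?w (t * ?w) (k + ?N) (cv_node a k s))) [0..<k + 1]) [0..<a + 1])"
    by (simp only: gad_CV_def defseq.sel map_concat map_map comp_def)
  also have "\<dots> = concat (map (\<lambda>s. map (\<lambda>t. at0 (nd s) (read_addr v ?w (t * ?w))) [0..<k + 1]) [0..<a + 1])"
    by (intro arg_cong[where f = concat] map_cong refl out) (auto simp del: upt_Suc)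
  also have "\<dots> = gad a k (CV a k) x"
    by (simp add: gad_def CV_def run_def decode_def nd_def v_def u_def comp_def del: upt_Suc)
  finally show ?thesis .
qed

subsection \<open>Size\<close>

lemma sz_Conj_le: "(\<And>x. x \<in> set xs \<Longrightarrow> sz x \<le> B) \<Longrightarrow> sz (Conj xs) \<le> length xs * (B + 1) + 1"
proof (induction xs rule: Conj.induct)
  case (2 x)
  then have "sz x \<le> B" by simp
  then show ?case by simp
next
  case (3 x y xs)
  then have "sz x \<le> B" "sz (Conj (y # xs)) \<le> length (y # xs) * (B + 1) + 1" by auto
  then show ?case by simp
qed simp

lemma sz_Disj_le: "(\<And>x. x \<in> set xs \<Longrightarrow> sz x \<le> B) \<Longrightarrow> sz (Disj xs) \<le> length xs * (B + 1) + 1"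
proof (induction xs rule: Disj.induct)
  case (2 x)
  then have "sz x \<le> B" by simp
  then show ?case by simp
next
  case (3 x y xs)
  then have "sz x \<le> B" "sz (Disj (y # xs)) \<le> length (y # xs) * (B + 1) + 1" by auto
  then show ?case by simp
qed simp

text \<open>Numerical factors are absorbed by raising the exponent, so that the size bounds become
  pure powers, as \<open>generator\<close> requires.\<close>

lemma mult_power_absorb:
  fixes M :: nat
  assumes "4 \<le> M" "c \<le> 4 ^ i"
  shows "c * M ^ j \<le> M ^ (i + j)"
proof -
  have "c \<le> M ^ i" using assms power_mono[OF assms(1), of i] by linarith
  then show ?thesis unfolding power_add by (rule mult_right_mono) simp
qed


lemma fm_size_le_sz_atoms:
  assumes "atoms \<phi> \<subseteq> {..<n}"
  shows "fm_size \<phi> \<le> sz \<phi> * (2 * n + 4)"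
proof -
  have "length (enc_nat a) \<le> 2 * n + 1" if "a \<in> atoms \<phi>" for a
  proof -
    have "a < n" using that assms by auto
    then show ?thesis using length_enc_nat_le[of a] by linarith
  qed
  then have "fm_size \<phi> \<le> sz \<phi> * (2 * n + 1 + 3)" by (rule fm_size_le_sz)
  then show ?thesis by (simp add: add.commute)
qed

lemma sz_desc_fm [simp]: "sz (desc_fm a p) = 1"
  by (simp add: desc_fm_def)

lemma sz_addr_fm_le: "sz (addr_fm a w p j) \<le> 3 * w + 1"
  unfolding addr_fm_def by (rule order_trans[OF sz_Conj_le[where B = 2]]) auto

lemma sz_select_fm_le:
  "sz (select_fm a w p l (cv_node a k s)) \<le> l * (3 * w + 4) + 1"
proof -
  let ?l = "map (\<lambda>j. Con (addr_fm a w p j) (cv_node a k s j)) [0..<l]"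
  have "sz (Disj ?l) \<le> length ?l * ((3 * w + 3) + 1) + 1"
    using sz_addr_fm_le[of a w p] by (intro sz_Disj_le) (auto simp: cv_node_eq intro: le_SucI)
  then show ?thesis by (simp add: select_fm_def add.commute)
qed

lemma sz_cv_gate_fm_le:
  "sz (cv_gate_fm a w p l (cv_node a k s)) \<le> 5 * (l * (3 * w + 4)) + 40"
  using sz_select_fm_le[of a w "p + 2" l k s] sz_select_fm_le[of a w "p + 2 + w" l k s]
  by (simp add: cv_gate_fm_def Let_def)

context
  fixes k a M :: nat
  assumes k: "1 \<le> k"
  defines "a \<equiv> k\<^sup>2" and "M \<equiv> (k\<^sup>2 + 1) * (k + 1)"
begin

text \<open>\<open>M\<close> is the number of output bits of the gadget generator, in terms of which
  all sizes have to be measured. The estimates are crude, since only some fixed exponent is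
  wanted.\<close>

lemma M_bounds: "4 \<le> M" "a + k + 1 \<le> M" "a + (a + 1) * k < M" "k \<le> M" "a + 1 \<le> M"
  "addr_len a k \<le> M" "k + num_gates a k \<le> M" "(a + 1) * num_gates a k \<le> M * M"
proof -
  have "M = a * k + a + k + 1" by (simp add: M_def a_def algebra_simps)
  moreover have "1 \<le> a" using k by (simp add: a_def)
  moreover from this have "1 * k \<le> a * k" by (intro mult_right_mono) auto
  ultimately show b: "4 \<le> M" "a + k + 1 \<le> M" "a + (a + 1) * k < M" "k \<le> M" "a + 1 \<le> M"
    using k unfolding add_mult_distrib by linarith+
  show "addr_len a k \<le> M"
    using addr_len_le[of a k "a + k"] b(2) by (simp add: less_imp_le)
  show "k + num_gates a k \<le> M" using num_gates_le[of a k] b(2) by linarith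
  then show "(a + 1) * num_gates a k \<le> M * M" using b(5) by (intro mult_mono) auto
qed

lemma sz_select_gad_CV:
  assumes "l \<le> k + num_gates a k"
  shows "sz (select_fm a (addr_len a k) p l (cv_node a k s)) \<le> M ^ 4"
proof -
  have "l * (3 * addr_len a k + 4) + 1 \<le> M * (3 * M + 4) + 1"
    using M_bounds assms by (intro add_mono mult_mono) auto
  also have "\<dots> \<le> 4 * M ^ 2 + 4 * M ^ 2"
  proof -
    have "M * (3 * M + 4) \<le> M * (4 * M)" using M_bounds(1) by (intro mult_left_mono) auto
    also have "\<dots> = 4 * M ^ 2" by (simp add: power2_eq_square)
    finally have "M * (3 * M + 4) \<le> 4 * M ^ 2" .
    moreover have "1 \<le> 4 * M ^ 2" using M_bounds(1) by simp
    ultimately show ?thesis by linarith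
  qed
  also have "\<dots> = 8 * M ^ 2" by simp
  also have "\<dots> \<le> M ^ (2 + 2)" using M_bounds(1) by (intro mult_power_absorb) auto
  finally show ?thesis using sz_select_fm_le[of a "addr_len a k" p l k s] by simp
qed

lemma sz_gate_gad_CV:
  assumes "l \<le> k + num_gates a k"
  shows "sz (cv_gate_fm a (addr_len a k) p l (cv_node a k s)) \<le> M ^ 6"
proof -
  let ?x = "l * (3 * addr_len a k + 4)"
  have "sz (cv_gate_fm a (addr_len a k) p l (cv_node a k s)) \<le> 5 * ?x + 40"
    by (rule sz_cv_gate_fm_le)
  also have "?x \<le> 8 * M ^ 2"
  proof -
    have "?x \<le> M * (3 * M + 4)" using M_bounds assms by (intro mult_mono) auto
    also have "\<dots> \<le> M * (4 * M)" using M_bounds(1) by (intro mult_left_mono) auto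
    finally show ?thesis by (simp add: power2_eq_square)
  qed
  then have "5 * ?x + 40 \<le> 40 * M ^ 2 + 40 * M ^ 2"
    using M_bounds(1) by (intro add_mono) auto
  also have "\<dots> = 80 * M ^ 2" by simp
  also have "\<dots> \<le> M ^ (4 + 2)" using M_bounds(1) by (intro mult_power_absorb) auto
  finally show ?thesis by simp
qed

lemma sz_defs_gad_CV: "\<phi> \<in> set (defs (gad_CV a k)) \<Longrightarrow> sz \<phi> \<le> M ^ 6"
proof -
  assume "\<phi> \<in> set (defs (gad_CV a k))"
  then obtain q where q: "q < (a + 1) * num_gates a k"
    "\<phi> = cv_gate_fm a (addr_len a k) (gate_pos a k (q mod num_gates a k)) (k + q mod num_gates a k)
                (cv_node a k (q div num_gates a k))"
    unfolding gad_CV_defs by auto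
  have "0 < num_gates a k" using q by (cases "num_gates a k") auto
  then show ?thesis
    unfolding q(2) by (intro sz_gate_gad_CV) (simp add: less_imp_le)
qed

lemma sz_outs_gad_CV: "\<phi> \<in> set (outs (gad_CV a k)) \<Longrightarrow> sz \<phi> \<le> M ^ 4"
  unfolding gad_CV_outs using sz_select_gad_CV by auto

lemma num_atoms_gad_CV_le: "2 * num_atoms (gad_CV a k) + 4 \<le> M ^ 4"
proof -
  have "num_atoms (gad_CV a k) \<le> M + M * M"
    using M_bounds unfolding num_atoms_gad_CV by (intro add_mono) auto
  moreover have "M * 4 \<le> M * M" using M_bounds(1) by (intro mult_left_mono) auto
  ultimately have "2 * num_atoms (gad_CV a k) + 4 \<le> 8 * (M * M)" using M_bounds(1) by linarith
  also have "\<dots> = 8 * M ^ 2" by (simp add: power2_eq_square)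
  also have "\<dots> \<le> M ^ (2 + 2)" using M_bounds(1) by (intro mult_power_absorb) auto
  finally show ?thesis by simp
qed

lemma atoms_defs_gad_CV: "\<phi> \<in> set (defs (gad_CV a k)) \<Longrightarrow> atoms \<phi> \<subseteq> {..<num_atoms (gad_CV a k)}"
proof -
  assume "\<phi> \<in> set (defs (gad_CV a k))"
  then obtain q where q: "q < (a + 1) * num_gates a k"
    "\<phi> = cv_gate_fm a (addr_len a k) (gate_pos a k (q mod num_gates a k)) (k + q mod num_gates a k)
                (cv_node a k (q div num_gates a k))"
    unfolding gad_CV_defs by auto
  have s: "q div num_gates a k \<le> a"
    using less_mult_imp_div_less[OF q(1)] by simp
  have "q div num_gates a k * num_gates a k + q mod num_gates a k = q" by (rule div_mult_mod_eq)
  then show ?thesis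
    using atoms_gad_CV_gate[OF s, of "addr_len a k" "gate_pos a k (q mod num_gates a k)" k "q mod num_gates a k"] q
    unfolding num_atoms_gad_CV by auto
qed

lemma atoms_outs_gad_CV: "\<phi> \<in> set (outs (gad_CV a k)) \<Longrightarrow> atoms \<phi> \<subseteq> {..<num_atoms (gad_CV a k)}"
proof -
  assume "\<phi> \<in> set (outs (gad_CV a k))"
  then obtain q where q: "q < (a + 1) * (k + 1)"
    "\<phi> = select_fm a (addr_len a k) (q mod (k + 1) * addr_len a k) (k + num_gates a k)
                (cv_node a k (q div (k + 1)))"
    unfolding gad_CV_outs by (auto simp del: upt_Suc mult_Suc mult_Suc_right add_Suc_right)
  define s where "s = q div (k + 1)"
  have "s < a + 1"
    unfolding s_def using q(1) by (rule less_mult_imp_div_less)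
  then have s: "s \<le> a" by simp
  have "s * num_gates a k + num_gates a k \<le> (a + 1) * num_gates a k"
    using s mult_right_mono[of "s + 1" "a + 1" "num_gates a k"] by simp
  then have "cv_idx a k s j < num_atoms (gad_CV a k)" if "j < k + num_gates a k" for j
    using cv_idx_less[OF s that] unfolding num_atoms_gad_CV by linarith
  then have "(\<Union>j<k + num_gates a k. atoms (cv_node a k s j)) \<subseteq> {..<num_atoms (gad_CV a k)}"
    by (intro UN_least) (simp add: cv_node_eq)
  moreover have "{..<a} \<subseteq> {..<num_atoms (gad_CV a k)}" by (auto simp: num_atoms_gad_CV)
  ultimately show ?thesis
    unfolding q(2) s_def[symmetric] by (rule order_trans[OF atoms_select_fm Un_least, rotated])
qed

lemma atoms_tau_gad_CV: "atoms (tau (gad_CV a k) b) \<subseteq> {..<num_atoms (gad_CV a k)}"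
proof -
  have "atoms (defs (gad_CV a k) ! i) \<subseteq> {..<num_atoms (gad_CV a k)}" if "i < length (defs (gad_CV a k))" for i
    using atoms_defs_gad_CV that by simp
  moreover have "atoms (if \<beta> then Neg \<phi> else \<phi>) \<subseteq> {..<num_atoms (gad_CV a k)}"
    if "(\<phi>, \<beta>) \<in> set (zip (outs (gad_CV a k)) b)" for \<phi> \<beta>
    using atoms_outs_gad_CV set_zip_leftD[OF that] by auto
  moreover have "arity (gad_CV a k) + i < num_atoms (gad_CV a k)" if "i < length (defs (gad_CV a k))" for i
    using that by (simp add: num_atoms_def)
  ultimately have "\<phi> \<in> set (map (\<lambda>i. Iff (At (arity (gad_CV a k) + i)) (defs (gad_CV a k) ! i)) [0..<length (defs (gad_CV a k))]) \<Longrightarrow>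
      atoms \<phi> \<subseteq> {..<num_atoms (gad_CV a k)}"
    "\<phi> \<in> set (map2 (\<lambda>\<phi> \<beta>. if \<beta> then Neg \<phi> else \<phi>) (outs (gad_CV a k)) b) \<Longrightarrow>
      atoms \<phi> \<subseteq> {..<num_atoms (gad_CV a k)}" for \<phi>
    unfolding Iff_def by force+
  then show ?thesis
    unfolding tau_def form.set atoms_Conj atoms_Disj by (intro Un_least UN_least)
qed

lemma fm_size_gad_CV: "atoms \<phi> \<subseteq> {..<num_atoms (gad_CV a k)} \<Longrightarrow> sz \<phi> \<le> M ^ i \<Longrightarrow> fm_size \<phi> \<le> M ^ (i + 4)"
  unfolding power_add
  using fm_size_le_sz_atoms[of \<phi> "num_atoms (gad_CV a k)"] num_atoms_gad_CV_le
    mult_mono[of "sz \<phi>" "M ^ i" "2 * num_atoms (gad_CV a k) + 4" "M ^ 4"] by linarith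

lemma defseq_size_gad_CV: "defseq_size (gad_CV a k) \<le> M ^ 13"
proof -
  have "sum_list (map fm_size xs) \<le> length xs * B" if "\<And>\<phi>. \<phi> \<in> set xs \<Longrightarrow> fm_size \<phi> \<le> B" for xs B
    using sum_list_mono[of xs fm_size "\<lambda>_. B"] that by (simp add: sum_list_triv)
  from this[of "defs (gad_CV a k)" "M ^ 10"] this[of "outs (gad_CV a k)" "M ^ 8"]
  have "defseq_size (gad_CV a k) \<le> length (defs (gad_CV a k)) * M ^ 10 + length (outs (gad_CV a k)) * M ^ 8"
    using fm_size_gad_CV[OF atoms_defs_gad_CV sz_defs_gad_CV] fm_size_gad_CV[OF atoms_outs_gad_CV sz_outs_gad_CV]
    unfolding defseq_size_def by (simp add: add_mono)
  also have "\<dots> \<le> (M * M) * M ^ 10 + M * M ^ 8"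
    using M_bounds by (intro add_mono mult_right_mono)
      (auto simp: length_gad_CV_defs length_gad_CV_outs M_def a_def)
  also have "\<dots> = M ^ 12 + M ^ 9" by (simp flip: power_Suc power_add power2_eq_square)
  also have "\<dots> \<le> M ^ 12 + M ^ 12" using M_bounds(1) by (intro add_mono power_increasing) auto
  also have "\<dots> = 2 * M ^ 12" by simp
  also have "\<dots> \<le> M ^ (1 + 12)" using M_bounds(1) by (intro mult_power_absorb) auto
  finally show ?thesis by simp
qed

lemma sz_tau_gad_CV: "sz (tau (gad_CV a k) b) \<le> M ^ 13"
proof -
  let ?D = "defs (gad_CV a k)"
  let ?A = "map (\<lambda>i. Iff (At (arity (gad_CV a k) + i)) (?D ! i)) [0..<length ?D]"
  let ?B = "map2 (\<lambda>\<phi> \<beta>. if \<beta> then Neg \<phi> else \<phi>) (outs (gad_CV a k)) b"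
  have M8: "1 \<le> M ^ i" for i using M_bounds(1) by simp
  have "sz (Conj ?A) \<le> length ?A * ((2 * M ^ 6 + 5) + 1) + 1"
  proof (rule sz_Conj_le)
    fix \<phi> assume "\<phi> \<in> set ?A"
    then obtain i where i: "i < length ?D" "\<phi> = Iff (At (arity (gad_CV a k) + i)) (?D ! i)" by auto
    then have "sz (?D ! i) \<le> M ^ 6" using sz_defs_gad_CV by simp
    then show "sz \<phi> \<le> 2 * M ^ 6 + 5" by (simp add: i(2) Iff_def)
  qed
  also have "\<dots> \<le> (M * M) * (8 * M ^ 6) + 1"
    using M_bounds(8) M8[of 6] by (intro add_mono mult_mono) (auto simp: length_gad_CV_defs)
  also have "(M * M) * (8 * M ^ 6) = 8 * M ^ 8" by (simp flip: power_add power2_eq_square)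
  finally have 1: "sz (Conj ?A) \<le> 8 * M ^ 8 + 1" .
  have "sz (Disj ?B) \<le> length ?B * ((M ^ 4 + 1) + 1) + 1"
  proof (rule sz_Disj_le)
    fix \<phi> assume "\<phi> \<in> set ?B"
    then obtain \<psi> \<beta> where "(\<psi>, \<beta>) \<in> set (zip (outs (gad_CV a k)) b)" "\<phi> = (if \<beta> then Neg \<psi> else \<psi>)" by auto
    with sz_outs_gad_CV[OF set_zip_leftD] show "sz \<phi> \<le> M ^ 4 + 1" by fastforce
  qed
  also have "\<dots> \<le> M * (3 * M ^ 4) + 1"
    using M8[of 4] by (intro add_mono mult_mono) (auto simp: length_gad_CV_outs M_def a_def)
  also have "M * (3 * M ^ 4) = 3 * M ^ 5" by (simp flip: power_Suc)
  also have "3 * M ^ 5 + 1 \<le> 3 * M ^ 8 + 1" using M_bounds(1) by (intro add_mono mult_left_mono power_increasing) auto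
  finally have 2: "sz (Disj ?B) \<le> 3 * M ^ 8 + 1" .
  have "sz (tau (gad_CV a k) b) \<le> 20 * M ^ 8"
    using 1 2 M8[of 8] by (simp add: tau_def)
  also have "\<dots> \<le> M ^ (5 + 8)" using M_bounds(1) by (intro mult_power_absorb) auto
  finally show ?thesis by simp
qed

lemma fm_size_tau_gad_CV: "fm_size (tau (gad_CV a k) b) \<le> M ^ 17"
  using fm_size_gad_CV[OF atoms_tau_gad_CV sz_tau_gad_CV] by simp

end

lemma generator_gad_CV: "generator (\<lambda>k. gad (k\<^sup>2) k (CV (k\<^sup>2) k)) (\<lambda>k. gad_CV (k\<^sup>2) k)"
  unfolding generator_def
proof (intro conjI allI impI exI[of _ 13])
  fix k :: nat assume k: "1 \<le> k"
  show "arity (gad_CV (k\<^sup>2) k) < length (outs (gad_CV (k\<^sup>2) k))"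
    using M_bounds(3)[OF k] by (simp add: gad_CV_arity length_gad_CV_outs)
  show "defseq_size (gad_CV (k\<^sup>2) k) \<le> length (outs (gad_CV (k\<^sup>2) k)) ^ 13"
    using defseq_size_gad_CV[OF k] unfolding length_gad_CV_outs .
next
  fix k :: nat and x :: "bool list"
  assume "length x = arity (gad_CV (k\<^sup>2) k)"
  then show "defseq_eval (gad_CV (k\<^sup>2) k) x = gad (k\<^sup>2) k (CV (k\<^sup>2) k) x"
    by (intro defseq_eval_gad_CV) (simp add: gad_CV_arity)
qed

section \<open>Embedding a circuit into the gadget generator\<close>

lemma inst_Conj: "inst \<theta> (Conj xs) = Conj (map (inst \<theta>) xs)"
  by (induction xs rule: Conj.induct) auto

lemma inst_Disj: "inst \<theta> (Disj xs) = Disj (map (inst \<theta>) xs)"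
  by (induction xs rule: Disj.induct) auto

lemma rename_Conj: "rename f (Conj xs) = Conj (map (rename f) xs)"
  by (induction xs rule: Conj.induct) auto

lemma rename_Disj: "rename f (Disj xs) = Disj (map (rename f) xs)"
  by (induction xs rule: Disj.induct) auto

lemma keval_ConI: "keval e \<phi> = Some b \<Longrightarrow> keval e \<psi> = Some c \<Longrightarrow> keval e (Con \<phi> \<psi>) = Some (b \<and> c)"
  by auto

lemma keval_DisI: "keval e \<phi> = Some b \<Longrightarrow> keval e \<psi> = Some c \<Longrightarrow> keval e (Dis \<phi> \<psi>) = Some (b \<or> c)"
  by auto

lemma keval_Iff: "keval e \<phi> = Some b \<Longrightarrow> keval e \<psi> = Some c \<Longrightarrow> keval e (Iff \<phi> \<psi>) = Some (b = c)"
  by (auto simp: Iff_def)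

text \<open>\<open>room\<close> makes the output addresses fit, so that the subtraction in
  \<open>num_gates\<close> does not truncate; \<open>S_le\<close> leaves space for all gates of
  \<open>Cn\<close>. The description length \<open>a\<close> is a parameter, specialised only in
  \<open>reduction\<close>.\<close>

locale embedding =
  fixes Cn :: circuit and a k n S w N :: nat
  assumes n: "n = inputs Cn" and S: "S = length (gates Cn)"
    and w: "w = addr_len a k" and N: "N = num_gates a k"
    and k_pos: "1 \<le> k" and a_pos: "1 \<le> a"
    and n_le: "n \<le> k" and S_le: "S \<le> N" and room: "(k + 1) * w \<le> a"
    and stretch: "n < length (outputs Cn)"
begin

text \<open>\<open>nu l j\<close> is the address, in the described circuit, of node \<open>j\<close> of \<open>Cn\<close>. A node that is not among
  the first \<open>l\<close> is sent to \<open>k + N\<close>, which is never available, so that both are read as \<open>0\<close>. \<open>mu s x\<close> is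
  the atom of the gadget that plays the role of the atom \<open>x\<close> of \<open>Cn\<close> in the \<open>s\<close>-th evaluation.\<close>

definition nu :: "nat \<Rightarrow> nat \<Rightarrow> nat" where
  "nu l j = (if j < l then if j < n then j else k + (j - n) else k + N)"

definition mu :: "nat \<Rightarrow> nat \<Rightarrow> nat" where
  "mu s x = (if x < n then a + s * k + x else a + (a + 1) * k + s * N + (x - n))"

text \<open>\<open>Cn\<close> occupies the inputs 0 to n - 1 and the outputs 0 to n. The outputs n +
  1 to k return the spare inputs n to k - 1, hence the shift by one.\<close>

definition out_addr :: "nat \<Rightarrow> nat" where
  "out_addr t = (if t < n + 1 then nu (n + S) (outputs Cn ! t) else t - 1)"

text \<open>Spare gates are coded as the constant 0. A constant occupies the lowest bit of the first
  address field, hence \<open>of_bool b\<close>.\<close>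

definition gate_code :: "nat \<Rightarrow> bool \<times> bool \<times> nat \<times> nat" where
  "gate_code i =
     (if i < S
      then case gates Cn ! i of
             GConst b \<Rightarrow> (True, True, of_bool b, 0)
           | GNot x \<Rightarrow> (False, False, nu (n + i) x, 0)
           | GAnd x y \<Rightarrow> (False, True, nu (n + i) x, nu (n + i) y)
           | GOr x y \<Rightarrow> (True, False, nu (n + i) x, nu (n + i) y)
      else (True, True, 0, 0))"

definition code_bit :: "bool \<times> bool \<times> nat \<times> nat \<Rightarrow> nat \<Rightarrow> bool" where
  "code_bit c r = (case c of (d, d', x, y) \<Rightarrow>
     if r = 0 then d else if r = 1 then d'
     else if r < 2 + w then odd (x div 2 ^ (r - 2)) else odd (y div 2 ^ (r - 2 - w)))"

definition desc :: "nat \<Rightarrow> bool" where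
  "desc p =
     (if p < (k + 1) * w then odd (out_addr (p div w) div 2 ^ (p mod w))
      else code_bit (gate_code ((p - (k + 1) * w) div (2 + 2 * w))) ((p - (k + 1) * w) mod (2 + 2 * w)))"

text \<open>Undefined exactly on inputs and gates that represent atoms of \<open>Cn\<close>. Spare
  input j of evaluation s feeds output j + 1 of that block, so it receives the bit prescribed there;
  spare gates receive the value 0 that their code computes.\<close>

definition vt :: "bool list \<Rightarrow> nat \<Rightarrow> bool option" where
  "vt b x =
     (if x < a then Some (desc x)
      else if x < a + (a + 1) * k
      then if (x - a) mod k < n then None else Some (b ! ((x - a) div k * (k + 1) + ((x - a) mod k + 1)))
      else if (x - (a + (a + 1) * k)) mod N < S then None else Some False)"

definition ext :: "bool list \<Rightarrow> (nat \<Rightarrow> bool option) \<Rightarrow> nat \<Rightarrow> bool option" where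
  "ext b e x = (case vt b x of None \<Rightarrow> e x | Some c \<Rightarrow> Some c)"

text \<open>The outputs of \<open>Cn\<close> beyond the first \<open>n + 1\<close> are not computed in the gadget; prescribing any
  values for them, here \<open>0\<close>, only weakens the formula \<open>\<tau>\<close>.\<close>

definition cut :: "bool list \<Rightarrow> nat \<Rightarrow> bool list" where
  "cut b s = take (n + 1) (drop (s * (k + 1)) b) @ replicate (length (outputs Cn) - (n + 1)) False"

lemma keval_inst_vt: "keval e (inst (vt b) \<phi>) = keval (ext b e) \<phi>"
  unfolding keval_inst ext_def ..

lemma w_pos: "1 \<le> w"
  using addr_len_ge[of a k] a_pos k_pos w by (cases w) auto

lemma gate_room: "(k + 1) * w + N * (2 + 2 * w) \<le> a"
proof -
  have "N * (2 + 2 * w) \<le> a - (k + 1) * w"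
    unfolding N num_gates_def w by (rule div_times_less_eq_dividend)
  then show ?thesis using room by linarith
qed

lemma node_addr: "k + N < 2 ^ w"
proof -
  have "N * 2 \<le> N * (2 + 2 * w)" by simp
  then have "N < a" using gate_room a_pos by linarith
  then show ?thesis using addr_len_ge[of a k] w by simp
qed

lemma nu_less: "l \<le> n + S \<Longrightarrow> nu l j < 2 ^ w"
  using node_addr S_le n_le unfolding nu_def by auto

text \<open>Translation of addresses preserves availability: a forward reference goes to
  \<open>k + N\<close>, beyond every prefix, so the default value 0 is the same in both
  circuits.\<close>

lemma nu_less_iff: "n \<le> l \<Longrightarrow> l \<le> n + S \<Longrightarrow> nu l j < k + (l - n) \<longleftrightarrow> j < l"
  using S_le n_le unfolding nu_def by auto

lemma cv_idx_N: "cv_idx a k s j = (if j < k then a + s * k + j else a + (a + 1) * k + s * N + (j - k))"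
  by (simp add: cv_idx_def N)

lemma cv_idx_nu: "j < l \<Longrightarrow> cv_idx a k s (nu l j) = mu s j"
  using n_le by (auto simp: nu_def mu_def cv_idx_N)

lemma mu_gate: "mu s (n + i) = a + (a + 1) * k + (s * N + i)"
  by (simp add: mu_def)

lemma vt_mu:
  assumes "s \<le> a" "x < n + S"
  shows "vt b (mu s x) = None"
proof (cases "x < n")
  case True
  then have "s * k + x < (a + 1) * k" "(s * k + x) mod k = x"
    using block_less[OF assms(1), of x k] n_le by auto
  then show ?thesis using True by (simp add: vt_def mu_def add.assoc del: mult_Suc)
next
  case False
  then have "x - n < N" using assms S_le by linarith
  then have "(s * N + (x - n)) mod N = x - n" by (simp only: div_mod_block)
  then show ?thesis using False assms by (simp add: vt_def mu_def add.assoc del: add_diff_assoc add_diff_assoc2)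
qed

lemma vt_input:
  assumes "s \<le> a" "n \<le> j" "j < k"
  shows "vt b (cv_idx a k s j) = Some (b ! (s * (k + 1) + (j + 1)))"
proof -
  have "s * k + j < (a + 1) * k" "(s * k + j) mod k = j" "(s * k + j) div k = s"
    using block_less[OF assms(1,3)] assms by auto
  then show ?thesis using assms by (simp add: vt_def cv_idx_def add.assoc del: mult_Suc)
qed

lemma vt_gate:
  assumes "s \<le> a" "S \<le> i" "i < N"
  shows "vt b (cv_idx a k s (k + i)) = Some False"
proof -
  have "(s * N + i) mod N = i" using assms by auto
  then show ?thesis using assms by (auto simp: vt_def cv_idx_N add.assoc)
qed

lemma ext_mu: "s \<le> a \<Longrightarrow> x < n + S \<Longrightarrow> ext b e (mu s x) = e (mu s x)"
  by (simp add: ext_def vt_mu)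

lemma keval_desc: "p < a \<Longrightarrow> keval (ext b e) (desc_fm a p) = Some (desc p)"
  by (simp add: desc_fm_def ext_def vt_def)

lemma out_addr_less: "t < k + 1 \<Longrightarrow> out_addr t < 2 ^ w"
  using nu_less[of "n + S"] node_addr unfolding out_addr_def by auto

lemma reads_out:
  assumes "t < k + 1"
  shows "reads_addr (ext b e) a w (t * w) (out_addr t)"
  unfolding reads_addr_def
proof (intro conjI allI impI out_addr_less assms)
  fix r assume r: "r < w"
  have p: "t * w + r < (k + 1) * w" using block_less[of t k r w] r assms by simp
  have "(t * w + r) div w = t" "(t * w + r) mod w = r" using r by auto
  then have "desc (t * w + r) = odd (out_addr t div 2 ^ r)"
    using p unfolding desc_def by simp
  then show "keval (ext b e) (desc_fm a (t * w + r)) = Some (odd (out_addr t div 2 ^ r))"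
    using keval_desc[of "t * w + r"] p room by simp
qed

lemma keval_gate_bit:
  assumes "i < N" "r < 2 + 2 * w"
  shows "keval (ext b e) (desc_fm a (gate_pos a k i + r)) = Some (code_bit (gate_code i) r)"
proof -
  let ?p = "(k + 1) * w + (i * (2 + 2 * w) + r)"
  have "i * (2 + 2 * w) + r < N * (2 + 2 * w)"
    using block_less[of i "N - 1" r "2 + 2 * w"] assms by simp
  then have "?p < a" using gate_room by linarith
  moreover have "(i * (2 + 2 * w) + r) div (2 + 2 * w) = i" "(i * (2 + 2 * w) + r) mod (2 + 2 * w) = r"
    using assms(2) div_mod_block[of r "2 + 2 * w" i] by blast+
  then have "desc ?p = code_bit (gate_code i) r" unfolding desc_def by simp
  moreover have "gate_pos a k i + r = ?p" by (simp add: gate_pos_def w)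
  ultimately show ?thesis using keval_desc[of ?p b e] by (simp only:)
qed

lemma reads_gate:
  assumes "i < N" "gate_code i = (d, d', x, y)" "x < 2 ^ w" "y < 2 ^ w"
  shows "keval (ext b e) (desc_fm a (gate_pos a k i)) = Some d"
    and "keval (ext b e) (desc_fm a (gate_pos a k i + 1)) = Some d'"
    and "keval (ext b e) (desc_fm a (gate_pos a k i + 2)) = Some (odd x)"
    and "reads_addr (ext b e) a w (gate_pos a k i + 2) x"
    and "reads_addr (ext b e) a w (gate_pos a k i + 2 + w) y"
proof -
  note bit = keval_gate_bit[OF assms(1), of _ b e, unfolded assms(2)]
  show "keval (ext b e) (desc_fm a (gate_pos a k i)) = Some d"
    using bit[of 0] by (simp add: code_bit_def)
  show "keval (ext b e) (desc_fm a (gate_pos a k i + 1)) = Some d'"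
    using bit[of 1] by (simp add: code_bit_def)
  show "keval (ext b e) (desc_fm a (gate_pos a k i + 2)) = Some (odd x)"
    using bit[of 2] w_pos by (simp add: code_bit_def)
  show "reads_addr (ext b e) a w (gate_pos a k i + 2) x"
    using bit[of "2 + _"] assms(3) by (simp add: reads_addr_def code_bit_def add.assoc)
  show "reads_addr (ext b e) a w (gate_pos a k i + 2 + w) y"
    using bit[of "2 + (w + _)"] assms(4) by (simp add: reads_addr_def code_bit_def add.assoc)
qed

lemma keval_select_nu:
  assumes "s \<le> a" "n \<le> l" "l \<le> n + S" "reads_addr (ext b e) a w p (nu l j)"
    and "j < l \<Longrightarrow> e (mu s j) = Some c" "l \<le> j \<Longrightarrow> \<not> c"
  shows "keval (ext b e) (select_fm a w p (k + (l - n)) (cv_node a k s)) = Some c"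
proof (rule keval_select_fm[OF assms(4)])
  show "k + (l - n) \<le> 2 ^ w" using assms node_addr S_le by simp
  show "keval (ext b e) (cv_node a k s (nu l j)) = Some c" if "nu l j < k + (l - n)"
  proof -
    have "j < l" using that nu_less_iff[OF assms(2,3), of j] by blast
    then show ?thesis using assms by (simp add: cv_node_eq cv_idx_nu ext_mu)
  qed
  show "\<not> c" if "k + (l - n) \<le> nu l j"
    using that assms nu_less_iff[OF assms(2,3), of j] by force
qed

lemma keval_node_fm:
  assumes "j < l \<Longrightarrow> e (mu s j) = Some c" "l \<le> j \<Longrightarrow> \<not> c"
  shows "keval e (rename (mu s) (node_fm l j)) = Some c"
  using assms by (auto simp: node_fm_def)

section \<open>Gates and outputs of the gadget after the substitution\<close>

definition gate_refs :: "gate \<Rightarrow> nat list" where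
  "gate_refs g = (case g of GConst _ \<Rightarrow> [] | GNot x \<Rightarrow> [x] | GAnd x y \<Rightarrow> [x, y] | GOr x y \<Rightarrow> [x, y])"

definition def_fm :: "nat \<Rightarrow> fm" where
  "def_fm i = Iff (At (n + i)) (gate_fm (n + i) (gates Cn ! i))"

definition gad_def_fm :: "nat \<Rightarrow> nat \<Rightarrow> fm" where
  "gad_def_fm s i = Iff (At (a + (a + 1) * k + (s * N + i)))
     (cv_gate_fm a w (gate_pos a k i) (k + i) (cv_node a k s))"

text \<open>Only the atom of the gate and those of its at most two arguments matter. Under each
  assignment to them both definitions compare the gate's atom with the same value.\<close>

lemma fprov_gate:
  assumes s: "s \<le> a" and i: "i < S"
    and M: "sz (Imp (rename (mu s) (def_fm i)) (inst (vt b) (gad_def_fm s i))) + 10 \<le> M"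
  shows "fprov (100 * (K0 * (M * M))) (Imp (rename (mu s) (def_fm i)) (inst (vt b) (gad_def_fm s i)))"
proof (rule fprov_keval_taut[OF _ M])
  let ?g = "gates Cn ! i"
  let ?X = "map (mu s) ((n + i) # gate_refs ?g)"
  show "length ?X \<le> 3" by (cases ?g) (auto simp: gate_refs_def)
  fix f :: "nat \<Rightarrow> bool"
  let ?e = "\<lambda>a::nat. if a \<in> set ?X then Some (f a) else None"
  \<comment> \<open>The guard reflects that references to node \<open>n + i\<close> or later read as
    0, both in \<open>node_fm\<close> and in the lookup.\<close>
  define val where "val x = (x < n + i \<and> f (mu s x))" for x
  have iN: "i < N" using i S_le by simp
  have node: "keval ?e (rename (mu s) (node_fm (n + i) x)) = Some (val x)"
    if "x \<in> set (gate_refs ?g)" for x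
    using that by (intro keval_node_fm) (auto simp: val_def)
  have sel: "keval (ext b ?e) (select_fm a w p (k + i) (cv_node a k s)) = Some (val x)"
    if "x \<in> set (gate_refs ?g)" "reads_addr (ext b ?e) a w p (nu (n + i) x)" for x p
    using keval_select_nu[OF s _ _ that(2), of "val x"] that(1) i by (auto simp: val_def)
  have nu: "nu (n + i) x < 2 ^ w" for x using nu_less i by simp
  have w1: "(1::nat) < 2 ^ w" using w_pos by (intro one_less_power) auto
  obtain c where c: "keval ?e (rename (mu s) (gate_fm (n + i) ?g)) = Some c"
    "keval (ext b ?e) (cv_gate_fm a w (gate_pos a k i) (k + i) (cv_node a k s)) = Some c"
  proof (cases ?g)
    case (GConst v)
    have code: "gate_code i = (True, True, of_bool v, 0)" using GConst i by (simp add: gate_code_def)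
    have lt: "of_bool v < (2::nat) ^ w" "(0::nat) < 2 ^ w" using w1 by (cases v; simp)+
    note rd = reads_gate[OF iN code lt, of b ?e]
    have "keval (ext b ?e) (cv_gate_fm a w (gate_pos a k i) (k + i) (cv_node a k s)) = Some v"
      using rd by (subst keval_cv_gate_fm[where d = True and d' = True and z = v]) auto
    with that show ?thesis using GConst by simp
  next
    case (GNot x)
    have code: "gate_code i = (False, False, nu (n + i) x, 0)" using GNot i by (simp add: gate_code_def)
    have lt: "(0::nat) < 2 ^ w" by simp
    note rd = reads_gate[OF iN code nu lt, of b ?e]
    have x: "x \<in> set (gate_refs ?g)" using GNot by (simp add: gate_refs_def)
    have "keval (ext b ?e) (cv_gate_fm a w (gate_pos a k i) (k + i) (cv_node a k s)) = Some (\<not> val x)"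
      using rd sel[OF x rd(4)]
      by (subst keval_cv_gate_fm[where d = False and d' = False and x = "val x"]) auto
    with that show ?thesis using GNot node[OF x] by simp
  next
    case (GAnd x y)
    have code: "gate_code i = (False, True, nu (n + i) x, nu (n + i) y)"
      using GAnd i by (simp add: gate_code_def)
    note rd = reads_gate[OF iN code nu nu, of b ?e]
    have x: "x \<in> set (gate_refs ?g)" "y \<in> set (gate_refs ?g)" using GAnd by (simp_all add: gate_refs_def)
    have "keval (ext b ?e) (cv_gate_fm a w (gate_pos a k i) (k + i) (cv_node a k s)) = Some (val x \<and> val y)"
      using rd sel[OF x(1) rd(4)] sel[OF x(2) rd(5)]
      by (subst keval_cv_gate_fm[where d = False and d' = True and x = "val x" and y = "val y"]) auto
    moreover have "keval ?e (rename (mu s) (gate_fm (n + i) ?g)) = Some (val x \<and> val y)"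
      using keval_ConI[OF node[OF x(1)] node[OF x(2)]] by (simp only: GAnd gate_fm.simps form.map)
    ultimately show ?thesis using that by blast
  next
    case (GOr x y)
    have code: "gate_code i = (True, False, nu (n + i) x, nu (n + i) y)"
      using GOr i by (simp add: gate_code_def)
    note rd = reads_gate[OF iN code nu nu, of b ?e]
    have x: "x \<in> set (gate_refs ?g)" "y \<in> set (gate_refs ?g)" using GOr by (simp_all add: gate_refs_def)
    have "keval (ext b ?e) (cv_gate_fm a w (gate_pos a k i) (k + i) (cv_node a k s)) = Some (val x \<or> val y)"
      using rd sel[OF x(1) rd(4)] sel[OF x(2) rd(5)]
      by (subst keval_cv_gate_fm[where d = True and d' = False and x = "val x" and y = "val y"]) auto
    moreover have "keval ?e (rename (mu s) (gate_fm (n + i) ?g)) = Some (val x \<or> val y)"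
      using keval_DisI[OF node[OF x(1)] node[OF x(2)]] by (simp only: GOr gate_fm.simps form.map)
    ultimately show ?thesis using that by blast
  qed
  have "keval ?e (rename (mu s) (def_fm i)) = Some (f (mu s (n + i)) = c)"
    unfolding def_fm_def Iff_def using c(1) by auto
  moreover have "keval (ext b ?e) (At (mu s (n + i))) = Some (f (mu s (n + i)))"
    using ext_mu[OF s, of "n + i" b ?e] i by simp
  then have "keval ?e (inst (vt b) (gad_def_fm s i)) = Some (f (mu s (n + i)) = c)"
    unfolding keval_inst_vt gad_def_fm_def mu_gate using c(2) by (intro keval_Iff)
  ultimately show "keval ?e (Imp (rename (mu s) (def_fm i)) (inst (vt b) (gad_def_fm s i))) = Some True"
    by (cases "f (mu s (n + i)) = c") simp_all
qed

text \<open>No atom is left to decide: the gate is coded as 0 and its own atom has been replaced by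
  0, so the definition is simply true.\<close>

lemma fprov_spare_gate:
  assumes s: "s \<le> a" and i: "S \<le> i" "i < N" and M: "sz (inst (vt b) (gad_def_fm s i)) + 10 \<le> M"
  shows "fprov (100 * (K0 * (M * M))) (inst (vt b) (gad_def_fm s i))"
proof (rule fprov_keval_taut[of "[]", OF _ M])
  fix f :: "nat \<Rightarrow> bool"
  let ?e = "\<lambda>a::nat. if a \<in> set [] then Some (f a) else None"
  have code: "gate_code i = (True, True, 0, 0)" using i by (simp add: gate_code_def)
  have lt: "(0::nat) < 2 ^ w" by simp
  note rd = reads_gate[OF i(2) code lt lt, of b "?e"]
  have "keval (ext b ?e) (cv_gate_fm a w (gate_pos a k i) (k + i) (cv_node a k s)) = Some False"
    using rd by (subst keval_cv_gate_fm[where d = True and d' = True and z = False]) auto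
  moreover have "keval (ext b ?e) (At (a + (a + 1) * k + (s * N + i))) = Some False"
    using vt_gate[OF s i, of b] by (simp add: ext_def cv_idx_N add.assoc)
  ultimately have "keval (ext b ?e) (gad_def_fm s i) = Some (False = False)"
    unfolding gad_def_fm_def by (rule keval_Iff[rotated])
  then show "keval ?e (inst (vt b) (gad_def_fm s i)) = Some True"
    unfolding keval_inst_vt by simp
qed simp

definition sign_fm :: "bool \<Rightarrow> fm \<Rightarrow> fm" where
  "sign_fm \<beta> \<phi> = (if \<beta> then Neg \<phi> else \<phi>)"

definition out_fm :: "nat \<Rightarrow> fm" where
  "out_fm t = node_fm (n + S) (outputs Cn ! t)"

definition gad_out_fm :: "nat \<Rightarrow> nat \<Rightarrow> fm" where
  "gad_out_fm s t = select_fm a w (t * w) (k + N) (cv_node a k s)"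

lemma keval_gad_out:
  assumes s: "s \<le> a" and t: "t < k + 1"
    and c: "keval (ext b e) (cv_node a k s (out_addr t)) = Some c \<or> (k + N \<le> out_addr t \<and> \<not> c)"
    and "out_addr t < k + N \<or> \<not> c"
  shows "keval (ext b e) (gad_out_fm s t) = Some c"
  unfolding gad_out_fm_def
  using assms node_addr by (intro keval_select_fm[OF reads_out[OF t]]) auto

text \<open>The lookup of a genuine output reduces to the one node it refers to, so a case
  distinction on a single atom settles the implication for either sign.\<close>

lemma fprov_out:
  assumes s: "s \<le> a" and t: "t < n + 1"
    and M: "sz (Imp (inst (vt b) (sign_fm \<beta> (gad_out_fm s t))) (rename (mu s) (sign_fm \<beta> (out_fm t)))) + 10 \<le> M"
  shows "fprov (100 * (K0 * (M * M)))
    (Imp (inst (vt b) (sign_fm \<beta> (gad_out_fm s t))) (rename (mu s) (sign_fm \<beta> (out_fm t))))"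
proof (rule fprov_keval_taut[of "[mu s (outputs Cn ! t)]", OF _ M])
  let ?x = "outputs Cn ! t"
  fix f :: "nat \<Rightarrow> bool"
  let ?e = "\<lambda>a::nat. if a \<in> set [mu s ?x] then Some (f a) else None"
  define c where "c \<longleftrightarrow> ?x < n + S \<and> f (mu s ?x)"
  have tk: "t < k + 1" using t n_le by simp
  have addr: "out_addr t = nu (n + S) ?x" using t by (simp add: out_addr_def)
  have "keval (ext b ?e) (gad_out_fm s t) = Some c"
  proof (cases "?x < n + S")
    case True
    then have "nu (n + S) ?x < k + N" using nu_less_iff[of "n + S" ?x] S_le by simp
    then show ?thesis
      using True s by (intro keval_gad_out[OF s tk]) (auto simp: addr cv_node_eq cv_idx_nu ext_mu c_def)
  next
    case False
    then show ?thesis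
      by (intro keval_gad_out[OF s tk]) (auto simp: addr c_def nu_def)
  qed
  moreover have "keval ?e (rename (mu s) (out_fm t)) = Some c"
    unfolding out_fm_def by (rule keval_node_fm) (auto simp: c_def)
  ultimately show "keval ?e (Imp (inst (vt b) (sign_fm \<beta> (gad_out_fm s t))) (rename (mu s) (sign_fm \<beta> (out_fm t)))) = Some True"
    by (cases c) (auto simp: sign_fm_def keval_inst_vt)
qed simp

text \<open>The copied input carries precisely the prescribed bit, so the disjunct asserting a
  difference at this position is refuted outright.\<close>

lemma fprov_copied_out:
  assumes s: "s \<le> a" and t: "n + 1 \<le> t" "t < k + 1" and \<beta>: "\<beta> = b ! (s * (k + 1) + t)"
    and M: "sz (Neg (inst (vt b) (sign_fm \<beta> (gad_out_fm s t)))) + 10 \<le> M"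
  shows "fprov (100 * (K0 * (M * M))) (Neg (inst (vt b) (sign_fm \<beta> (gad_out_fm s t))))"
proof (rule fprov_keval_taut[of "[]", OF _ M])
  fix f :: "nat \<Rightarrow> bool"
  let ?e = "\<lambda>a::nat. if a \<in> set [] then Some (f a) else None"
  have addr: "out_addr t = t - 1" using t by (simp add: out_addr_def)
  have "vt b (cv_idx a k s (t - 1)) = Some \<beta>"
    using vt_input[OF s, of "t - 1" b] t \<beta> by simp
  then have "keval (ext b ?e) (gad_out_fm s t) = Some \<beta>"
    using t by (intro keval_gad_out[OF s t(2)]) (auto simp: addr cv_node_eq ext_def)
  then show "keval ?e (Neg (inst (vt b) (sign_fm \<beta> (gad_out_fm s t)))) = Some True"
    by (cases \<beta>) (auto simp: sign_fm_def keval_inst_vt)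
qed simp

lemma length_cut: "s \<le> a \<Longrightarrow> length b = (a + 1) * (k + 1) \<Longrightarrow> length (cut b s) = length (outputs Cn)"
  and cut_nth: "s \<le> a \<Longrightarrow> length b = (a + 1) * (k + 1) \<Longrightarrow> t < n + 1 \<Longrightarrow> cut b s ! t = b ! (s * (k + 1) + t)"
proof -
  assume s: "s \<le> a" and b: "length b = (a + 1) * (k + 1)"
  have "s * (k + 1) + n < length b"
    using block_less[OF s, of n "k + 1"] n_le b by simp
  then have *: "length (take (n + 1) (drop (s * (k + 1)) b)) = n + 1" by simp
  then show "length (cut b s) = length (outputs Cn)" using stretch by (simp add: cut_def)
  show "cut b s ! t = b ! (s * (k + 1) + t)" if "t < n + 1"
    using that * \<open>s * (k + 1) + n < length b\<close> by (simp add: cut_def nth_append)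
qed

lemma tau_gad_CV_eq:
  assumes "length b = (a + 1) * (k + 1)"
  shows "tau (gad_CV a k) b =
    Imp (Conj (map (\<lambda>q. gad_def_fm (q div N) (q mod N)) [0..<(a + 1) * N]))
        (Disj (map (\<lambda>q. sign_fm (b ! q) (gad_out_fm (q div (k + 1)) (q mod (k + 1)))) [0..<(a + 1) * (k + 1)]))"
proof -
  have "map (\<lambda>i. Iff (At (arity (gad_CV a k) + i)) (defs (gad_CV a k) ! i)) [0..<length (defs (gad_CV a k))] =
    map (\<lambda>q. gad_def_fm (q div N) (q mod N)) [0..<(a + 1) * N]"
    unfolding gad_CV_defs N w
    by (simp add: gad_CV_arity gad_def_fm_def N[symmetric] w[symmetric] del: upt_Suc mult_Suc)
  moreover have "map2 (\<lambda>\<phi> \<beta>. if \<beta> then Neg \<phi> else \<phi>) (outs (gad_CV a k)) b =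
    map (\<lambda>q. sign_fm (b ! q) (gad_out_fm (q div (k + 1)) (q mod (k + 1)))) [0..<(a + 1) * (k + 1)]"
    using assms unfolding gad_CV_outs
    by (intro nth_equalityI)
       (simp_all add: sign_fm_def gad_out_fm_def N[symmetric] w[symmetric] del: upt_Suc mult_Suc mult_Suc_right)
  ultimately show ?thesis unfolding tau_def by simp
qed

lemma tau_circuit_eq:
  assumes "length b = length (outputs Cn)"
  shows "tau (defseq_of Cn) b =
    Imp (Conj (map def_fm [0..<S])) (Disj (map (\<lambda>t. sign_fm (b ! t) (out_fm t)) [0..<length (outputs Cn)]))"
proof -
  have "map (\<lambda>i. Iff (At (arity (defseq_of Cn) + i)) (defs (defseq_of Cn) ! i)) [0..<length (defs (defseq_of Cn))] =
    map def_fm [0..<S]"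
    by (simp add: defseq_of_def def_fm_def n[symmetric] S[symmetric])
  moreover have "map2 (\<lambda>\<phi> \<beta>. if \<beta> then Neg \<phi> else \<phi>) (outs (defseq_of Cn)) b =
    map (\<lambda>t. sign_fm (b ! t) (out_fm t)) [0..<length (outputs Cn)]"
    using assms by (intro nth_equalityI) (simp_all add: sign_fm_def out_fm_def defseq_of_def n[symmetric] S[symmetric])
  ultimately show ?thesis unfolding tau_def by simp
qed

text \<open>A concatenation is missed only if one of its blocks is missed, so one formula for the
  gadget turns into \<open>a + 1\<close> formulas for \<open>Cn\<close>, one per evaluation.\<close>

definition target :: "bool list \<Rightarrow> fm" where
  "target b = Disj (map (\<lambda>s. rename (mu s) (tau (defseq_of Cn) (cut b s))) [0..<a + 1])"

text \<open>Instance of \<open>fprov_combine\<close>: gates of \<open>Cn\<close> and the outputs up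
  to \<open>n\<close> have counterparts in the same evaluation, while spare gates and copied outputs
  are settled by constants.\<close>

lemma fprov_target:
  assumes b: "length b = (a + 1) * (k + 1)"
    and M: "sz (Imp (inst (vt b) (tau (gad_CV a k) b)) (target b)) + 10 \<le> M"
  shows "fprov (220 * (K0 * (M * M * M))) (Imp (inst (vt b) (tau (gad_CV a k) b)) (target b))"
proof -
  let ?p = "100 * (K0 * (M * M))"
  define \<Delta> where "\<Delta> = map (\<lambda>q. inst (vt b) (gad_def_fm (q div N) (q mod N))) [0..<(a + 1) * N]"
  define \<Omega> where "\<Omega> = map (\<lambda>q. inst (vt b) (sign_fm (b ! q) (gad_out_fm (q div (k + 1)) (q mod (k + 1)))))
    [0..<(a + 1) * (k + 1)]"
  define D where "D s = map (\<lambda>i. rename (mu s) (def_fm i)) [0..<S]" for s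
  define E where "E s = map (\<lambda>t. rename (mu s) (sign_fm (cut b s ! t) (out_fm t))) [0..<length (outputs Cn)]" for s
  have src: "inst (vt b) (tau (gad_CV a k) b) = Imp (Conj \<Delta>) (Disj \<Omega>)"
    unfolding tau_gad_CV_eq[OF b] \<Delta>_def \<Omega>_def by (simp add: inst_Conj inst_Disj comp_def del: upt_Suc mult_Suc mult_Suc_right)
  have ren: "rename (mu s) (tau (defseq_of Cn) (cut b s)) = Imp (Conj (D s)) (Disj (E s))" if "s \<le> a" for s
    unfolding tau_circuit_eq[OF length_cut[OF that b]] D_def E_def
    by (simp add: rename_Conj rename_Disj comp_def)
  then have tgt: "target b = Disj (map (\<lambda>s. Imp (Conj (D s)) (Disj (E s))) [0..<a + 1])"
    unfolding target_def by (intro arg_cong[where f = Disj] map_cong) auto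
  have szM: "sz (Conj \<Delta>) + sz (Disj \<Omega>) + sz (target b) + 12 \<le> M"
    using M unfolding src by simp
  have szD: "sz (Conj (D s)) + sz (Disj (E s)) \<le> sz (target b)" if "s \<le> a" for s
  proof -
    have "Imp (Conj (D s)) (Disj (E s)) \<in> set (map (\<lambda>s. Imp (Conj (D s)) (Disj (E s))) [0..<a + 1])"
      using that by (auto simp del: upt_Suc)
    from sz_le_sz_Disj[OF this] show ?thesis unfolding tgt by simp
  qed
  have "fprov (2 * M * (?p + 10 * (K0 * (M * M)))) (Imp (Imp (Conj \<Delta>) (Disj \<Omega>)) (target b))"
  proof (rule fprov_combine[OF _ tgt])
    show "sz (Imp (Imp (Conj \<Delta>) (Disj \<Omega>)) (target b)) \<le> M" using szM by simp
  next
    fix \<delta> assume mem: "\<delta> \<in> set \<Delta>"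
    then obtain q where q: "q < (a + 1) * N" "\<delta> = inst (vt b) (gad_def_fm (q div N) (q mod N))"
      unfolding \<Delta>_def by (auto simp del: mult_Suc)
    define s i where "s = q div N" and "i = q mod N"
    have \<delta>: "\<delta> = inst (vt b) (gad_def_fm s i)" using q by (simp add: s_def i_def)
    have s: "s \<le> a" using less_mult_imp_div_less[OF q(1)] by (simp add: s_def)
    have i: "i < N" using q by (cases N) (auto simp: i_def)
    have sz\<delta>: "sz \<delta> \<le> sz (Conj \<Delta>)" by (rule sz_le_sz_Conj[OF mem])
    show "fprov ?p \<delta> \<or> (\<exists>s<a + 1. \<exists>\<delta>'\<in>set (D s). fprov ?p (Imp \<delta>' \<delta>))"
    proof (cases "i < S")
      case True
      then have mem': "rename (mu s) (def_fm i) \<in> set (D s)" by (simp add: D_def)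
      have "sz (rename (mu s) (def_fm i)) \<le> sz (Conj (D s))" by (rule sz_le_sz_Conj[OF mem'])
      then have "fprov ?p (Imp (rename (mu s) (def_fm i)) \<delta>)"
        unfolding \<delta> using sz\<delta>[unfolded \<delta>] szM szD[OF s] by (intro fprov_gate[OF s True]) simp
      then show ?thesis using mem' s by (intro disjI2 exI[of _ s]) auto
    next
      case False
      then have "fprov ?p \<delta>"
        unfolding \<delta> using sz\<delta>[unfolded \<delta>] szM i by (intro fprov_spare_gate[OF s]) auto
      then show ?thesis ..
    qed
  next
    fix \<omega> assume mem: "\<omega> \<in> set \<Omega>"
    then obtain q where q: "q < (a + 1) * (k + 1)"
      "\<omega> = inst (vt b) (sign_fm (b ! q) (gad_out_fm (q div (k + 1)) (q mod (k + 1))))"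
      unfolding \<Omega>_def by (auto simp del: mult_Suc mult_Suc_right upt_Suc)
    define s t where "s = q div (k + 1)" and "t = q mod (k + 1)"
    have qst: "q = s * (k + 1) + t" unfolding s_def t_def by (rule div_mult_mod_eq[symmetric])
    have \<omega>: "\<omega> = inst (vt b) (sign_fm (b ! q) (gad_out_fm s t))" using q by (simp add: s_def t_def)
    have s: "s \<le> a" using less_mult_imp_div_less[OF q(1)] by (simp add: s_def)
    have t: "t < k + 1" by (simp add: t_def)
    have sz\<omega>: "sz \<omega> \<le> sz (Disj \<Omega>)" by (rule sz_le_sz_Disj[OF mem])
    show "fprov ?p (Neg \<omega>) \<or> (\<exists>s<a + 1. \<exists>\<omega>'\<in>set (E s). fprov ?p (Imp \<omega> \<omega>'))"
    proof (cases "t < n + 1")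
      case True
      then have "rename (mu s) (sign_fm (cut b s ! t) (out_fm t)) \<in> set (E s)"
        using stretch by (auto simp: E_def)
      moreover have "cut b s ! t = b ! q" using cut_nth[OF s b True] qst by simp
      ultimately have mem': "rename (mu s) (sign_fm (b ! q) (out_fm t)) \<in> set (E s)" by simp
      have "sz (rename (mu s) (sign_fm (b ! q) (out_fm t))) \<le> sz (Disj (E s))"
        by (rule sz_le_sz_Disj[OF mem'])
      then have "fprov ?p (Imp \<omega> (rename (mu s) (sign_fm (b ! q) (out_fm t))))"
        unfolding \<omega> using sz\<omega>[unfolded \<omega>] szM szD[OF s] by (intro fprov_out[OF s True]) simp
      then show ?thesis using mem' s by (intro disjI2 exI[of _ s]) auto
    next
      case False
      then have "fprov ?p (Neg \<omega>)"
        unfolding \<omega> using sz\<omega>[unfolded \<omega>] szM t qst by (intro fprov_copied_out[OF s]) auto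
      then show ?thesis ..
    qed
  qed
  moreover have "2 * M * (?p + 10 * (K0 * (M * M))) = 220 * (K0 * (M * M * M))" by (simp add: algebra_simps)
  ultimately show ?thesis unfolding src by (simp only:)
qed

lemma num_atoms_circuit: "num_atoms (defseq_of Cn) = n + S"
  by (simp add: num_atoms_def defseq_of_def n S)

lemma mu_less:
  assumes "s \<le> a" "x < n + S"
  shows "mu s x < num_atoms (gad_CV a k)"
proof (cases "x < n")
  case True
  then show ?thesis
    using block_less[OF assms(1), of x k] n_le by (simp add: mu_def num_atoms_gad_CV del: mult_Suc)
next
  case False
  then have "x - n < N" using assms S_le by linarith
  from block_less[OF assms(1) this] show ?thesis
    using False by (simp only: mu_def num_atoms_gad_CV N[symmetric] if_False)
qed

lemma block_inj:
  assumes "s * c + x = s' * c + x'" "x < c" "x' < (c::nat)"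
  shows "s = s' \<and> x = x'"
  using assms div_mod_block by metis

text \<open>Keeps the disjuncts arising from different evaluations in disjoint atoms, as
  \<open>vee_hard\<close> demands of the new disjunction.\<close>

lemma mu_inj:
  assumes "s \<le> a" "s' \<le> a" "x < n + S" "x' < n + S" "mu s x = mu s' x'"
  shows "s = s' \<and> x = x'"
proof -
  have *: "mu s x < a + (a + 1) * k \<longleftrightarrow> x < n" if "s \<le> a" for s x
    using block_less[OF that, of x k] n_le by (auto simp: mu_def add.assoc simp del: mult_Suc)
  have iff: "x < n \<longleftrightarrow> x' < n" using *[of s x] *[of s' x'] assms by simp
  show ?thesis
  proof (cases "x < n")
    case True
    then have "s * k + x = s' * k + x'" using iff assms(5) by (simp add: mu_def)
    then show ?thesis using block_inj[of s k x s' x'] True iff n_le by simp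
  next
    case False
    then have "s * N + (x - n) = s' * N + (x' - n)" using iff assms(5) by (simp add: mu_def)
    moreover have "x - n < N" "x' - n < N" using False iff assms S_le by linarith+
    ultimately have "s = s' \<and> x - n = x' - n" by (rule block_inj)
    then show ?thesis using False iff by auto
  qed
qed

text \<open>Ensures that the new disjunction introduces no names: all names in the EF proof are then
  bounded by the size of the original formula.\<close>

lemma mu_in_atoms:
  assumes s: "s \<le> a" and x: "x < n + S" and b: "length b = (a + 1) * (k + 1)"
  shows "mu s x \<in> atoms (tau (gad_CV a k) b)"
proof (cases "x < n")
  case True
  have k: "0 < k" using k_pos by simp
  have "mu s x \<in> atoms (cv_node a k s x)"
    using True n_le by (simp add: cv_node_eq cv_idx_def mu_def)
  moreover have "x < k + N" using True n_le by simp
  \<comment> \<open>Output 0 is an arbitrary choice: the lookup of any output mentions all nodes of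
    its evaluation, in particular all inputs.\<close>
  ultimately have at: "mu s x \<in> atoms (gad_out_fm s 0)"
    unfolding gad_out_fm_def select_fm_def atoms_Disj by force
  let ?q = "s * (k + 1) + 0"
  have q: "?q < (a + 1) * (k + 1)" using block_less[OF s, of 0 "k + 1"] by simp
  have "sign_fm (b ! ?q) (gad_out_fm (?q div (k + 1)) (?q mod (k + 1))) \<in>
    set (map (\<lambda>q. sign_fm (b ! q) (gad_out_fm (q div (k + 1)) (q mod (k + 1)))) [0..<(a + 1) * (k + 1)])"
    using q unfolding set_map by (intro imageI) (simp only: set_upt atLeastLessThan_iff zero_le simp_thms)
  moreover have "mu s x \<in> atoms (sign_fm (b ! ?q) (gad_out_fm (?q div (k + 1)) (?q mod (k + 1))))"
    using at div_mod_block[of 0 "k + 1" s] by (simp add: sign_fm_def)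
  ultimately show ?thesis
    unfolding tau_gad_CV_eq[OF b] form.set atoms_Disj by blast
next
  case False
  let ?q = "s * N + (x - n)"
  have xN: "x - n < N" using False x S_le by linarith
  have q: "?q < (a + 1) * N" by (rule block_less[OF s xN])
  have "gad_def_fm (?q div N) (?q mod N) \<in> set (map (\<lambda>q. gad_def_fm (q div N) (q mod N)) [0..<(a + 1) * N])"
    using q unfolding set_map by (intro imageI) (simp only: set_upt atLeastLessThan_iff zero_le simp_thms)
  moreover have "mu s x \<in> atoms (gad_def_fm (?q div N) (?q mod N))"
  proof -
    have "?q div N * N + ?q mod N = ?q" by (rule div_mult_mod_eq)
    then have "mu s x = a + (a + 1) * k + (?q div N * N + ?q mod N)"
      using False by (simp only: mu_def if_False add.assoc)
    then show ?thesis by (simp only: gad_def_fm_def Iff_def form.set) blast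
  qed
  ultimately show ?thesis
    unfolding tau_gad_CV_eq[OF b] form.set atoms_Conj by blast
qed

lemma sz_tau_circuit:
  assumes "length b = length (outputs Cn)"
  shows "sz (tau (defseq_of Cn) b) \<le> 12 * S + 3 * length (outputs Cn) + 3"
    and "length (outputs Cn) \<le> sz (tau (defseq_of Cn) b)"
proof -
  let ?m = "length (outputs Cn)"
  let ?O = "map (\<lambda>t. sign_fm (b ! t) (out_fm t)) [0..<?m]"
  have node: "sz (node_fm l j) = 1" for l j by (simp add: node_fm_def)
  have gate: "sz (gate_fm l g) \<le> 3" for l g by (cases g) (auto simp: node)
  have "sz (def_fm i) \<le> 11" for i
    using gate[of "n + i" "gates Cn ! i"] by (simp add: def_fm_def Iff_def)
  then have "sz (Conj (map def_fm [0..<S])) \<le> length (map def_fm [0..<S]) * (11 + 1) + 1"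
    by (intro sz_Conj_le) auto
  moreover have "sz (Disj ?O) \<le> length ?O * (2 + 1) + 1"
    by (intro sz_Disj_le) (auto simp: sign_fm_def out_fm_def node)
  ultimately show "sz (tau (defseq_of Cn) b) \<le> 12 * S + 3 * ?m + 3"
    unfolding tau_circuit_eq[OF assms] by simp
  have "?m \<le> sz (Disj ?O)" using length_le_sz_Disj[of ?O] by simp
  then show "?m \<le> sz (tau (defseq_of Cn) b)"
    unfolding tau_circuit_eq[OF assms] by simp
qed

lemma sz_target:
  assumes "length b = (a + 1) * (k + 1)"
  shows "sz (target b) \<le> (a + 1) * (12 * S + 3 * length (outputs Cn) + 4) + 1"
proof -
  let ?l = "map (\<lambda>s. rename (mu s) (tau (defseq_of Cn) (cut b s))) [0..<a + 1]"
  have "sz (Disj ?l) \<le> length ?l * ((12 * S + 3 * length (outputs Cn) + 3) + 1) + 1"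
    using sz_tau_circuit(1)[OF length_cut[OF _ assms]] by (intro sz_Disj_le) (auto simp del: upt_Suc)
  moreover have "(12 * S + 3 * length (outputs Cn) + 3) + 1 = 12 * S + 3 * length (outputs Cn) + 4" by simp
  moreover have "length ?l = a + 1" by simp
  ultimately show ?thesis unfolding target_def by (simp only:)
qed

end

section \<open>From a disjunction for the gadget to a disjunction for the circuit\<close>

lemma inst_rename: "(\<And>x. x \<in> atoms \<phi> \<Longrightarrow> \<theta> (f x) = \<eta> x) \<Longrightarrow> inst \<theta> (rename f \<phi>) = rename f (inst \<eta> \<phi>)"
  by (induction \<phi>) (auto split: option.splits)

lemma atoms_inst: "atoms (inst \<theta> \<phi>) \<subseteq> atoms \<phi>"
  by (induction \<phi>) (auto split: option.splits)

lemma atoms_tau_circuit: "atoms (tau (defseq_of C) b) \<subseteq> {..<num_atoms (defseq_of C)}"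
proof -
  have node: "atoms (node_fm l j) \<subseteq> {..<l}" for l j by (simp add: node_fm_def)
  have gate: "atoms (gate_fm l g) \<subseteq> {..<l}" for l g
    using node[of l] by (cases g) (auto simp: node_fm_def split: if_splits)
  let ?D = "defseq_of C"
  have "atoms \<phi> \<subseteq> {..<num_atoms ?D}"
    if mem: "\<phi> \<in> set (map (\<lambda>i. Iff (At (arity ?D + i)) (defs ?D ! i)) [0..<length (defs ?D)])" for \<phi>
  proof -
    obtain i where i: "i < length (gates C)" "\<phi> = Iff (At (inputs C + i)) (gate_fm (inputs C + i) (gates C ! i))"
      using mem by (auto simp: defseq_of_def)
    then show ?thesis
      using gate[of "inputs C + i" "gates C ! i"] by (auto simp: Iff_def num_atoms_def defseq_of_def)
  qed
  moreover have "atoms \<phi> \<subseteq> {..<num_atoms ?D}"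
    if mem: "\<phi> \<in> set (map2 (\<lambda>\<phi> \<beta>. if \<beta> then Neg \<phi> else \<phi>) (outs ?D) b)" for \<phi>
  proof -
    obtain \<psi> \<beta> where "(\<psi>, \<beta>) \<in> set (zip (outs ?D) b)" "\<phi> = (if \<beta> then Neg \<psi> else \<psi>)"
      using mem by auto
    moreover from this(1) have "\<psi> \<in> set (outs ?D)" by (rule set_zip_leftD)
    then have "atoms \<psi> \<subseteq> {..<num_atoms ?D}"
      by (auto simp: defseq_of_def num_atoms_def node_fm_def split: if_splits)
    ultimately show ?thesis by auto
  qed
  ultimately show ?thesis
    unfolding tau_def form.set atoms_Conj atoms_Disj by (intro Un_least UN_least)
qed

definition family_disj :: "defseq \<Rightarrow> bool list list \<Rightarrow> (nat \<Rightarrow> nat \<Rightarrow> nat) \<Rightarrow> fm" where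
  "family_disj D bs \<rho> = Disj (map (\<lambda>i. rename (\<rho> i) (tau D (bs ! i))) [0..<length bs])"

definition disjoint_names :: "defseq \<Rightarrow> bool list list \<Rightarrow> (nat \<Rightarrow> nat \<Rightarrow> nat) \<Rightarrow> bool" where
  "disjoint_names D bs \<rho> \<longleftrightarrow>
     bs \<noteq> [] \<and> (\<forall>b \<in> set bs. length b = length (outs D)) \<and>
     inj_on (\<lambda>(i, a). \<rho> i a) ({..<length bs} \<times> {..<num_atoms D})"

context embedding
begin

text \<open>Disjunct \<open>i\<close> and evaluation \<open>s\<close> give the new disjunct with
  index i(a + 1) + s, written in the names \<rho> composed with \<open>mu\<close>; disjointness
  follows from injectivity of both. The lower bound on the size of the result later forces
  \<open>n\<close> to be bounded.\<close>

lemma reduction: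
  assumes a: "a = k\<^sup>2" and bs: "disjoint_names (gad_CV a k) bs \<rho>"
    and M: "sz (family_disj (gad_CV a k) bs \<rho>) +
      (length bs + 1) * ((a + 1) * (12 * S + 3 * length (outputs Cn) + 4)) + 20 \<le> M"
  shows "\<exists>\<theta> bs' \<rho>'. disjoint_names (defseq_of Cn) bs' \<rho>' \<and>
    atoms (family_disj (defseq_of Cn) bs' \<rho>') \<subseteq> atoms (family_disj (gad_CV a k) bs \<rho>) \<and>
    length (outputs Cn) \<le> sz (family_disj (defseq_of Cn) bs' \<rho>') \<and>
    fprov (230 * (K0 * (M * M * M * M)))
      (Imp (inst \<theta> (family_disj (gad_CV a k) bs \<rho>)) (family_disj (defseq_of Cn) bs' \<rho>'))"
proof -
  let ?G = "gad_CV a k" and ?D = "defseq_of Cn" and ?r = "length bs"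
  let ?\<phi> = "family_disj ?G bs \<rho>" and ?m = "length (outputs Cn)"
  let ?T = "12 * S + 3 * ?m + 4"
  have len: "length (bs ! i) = (a + 1) * (k + 1)" if "i < ?r" for i
    using bs that unfolding disjoint_names_def length_gad_CV_outs by auto
  have inj: "inj_on (\<lambda>(i, a). \<rho> i a) ({..<?r} \<times> {..<num_atoms ?G})" and r: "0 < ?r"
    using bs by (auto simp: disjoint_names_def)
  \<comment> \<open>\<rho> is injective on the atoms in use, so each name can be traced back to its
    disjunct, whose own prescribed bits determine the constants. Foreign names are kept.\<close>
  define \<theta> where "\<theta> y = (if y \<in> (\<lambda>(i, a). \<rho> i a) ` ({..<?r} \<times> {..<num_atoms ?G})
    then case inv_into ({..<?r} \<times> {..<num_atoms ?G}) (\<lambda>(i, a). \<rho> i a) y of (i, x) \<Rightarrow> vt (bs ! i) x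
    else None)" for y
  have \<theta>: "\<theta> (\<rho> i x) = vt (bs ! i) x" if "i < ?r" "x < num_atoms ?G" for i x
  proof -
    have mem: "(i, x) \<in> {..<?r} \<times> {..<num_atoms ?G}" using that by simp
    have "\<rho> i x \<in> (\<lambda>(i, a). \<rho> i a) ` ({..<?r} \<times> {..<num_atoms ?G})"
      using imageI[OF mem, of "\<lambda>(i, a). \<rho> i a"] by simp
    then show ?thesis using inv_into_f_f[OF inj mem] by (simp add: \<theta>_def)
  qed
  define R where "R = ?r * (a + 1)"
  define bs' where "bs' = map (\<lambda>q. cut (bs ! (q div (a + 1))) (q mod (a + 1))) [0..<R]"
  define \<rho>' where "\<rho>' q = (\<lambda>x. \<rho> (q div (a + 1)) (mu (q mod (a + 1)) x))" for q
  let ?\<psi> = "family_disj ?D bs' \<rho>'"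
  have len': "length bs' = R" by (simp add: bs'_def)
  have q: "q div (a + 1) < ?r" "q mod (a + 1) \<le> a" if "q < R" for q
    using less_mult_imp_div_less[of q ?r "a + 1"] that by (auto simp: R_def less_Suc_eq_le[symmetric])
  have dn: "disjoint_names ?D bs' \<rho>'"
    unfolding disjoint_names_def
  proof (intro conjI ballI)
    show "bs' \<noteq> []" using r by (auto simp: bs'_def R_def)
    show "length b = length (outs ?D)" if "b \<in> set bs'" for b
      using that q length_cut[OF _ len] by (auto simp: bs'_def defseq_of_def)
    show "inj_on (\<lambda>(i, a). \<rho>' i a) ({..<length bs'} \<times> {..<num_atoms ?D})"
    proof (rule inj_onI, clarify)
      fix i x j y assume ij: "i < length bs'" "j < length bs'" and xy: "x < num_atoms ?D" "y < num_atoms ?D"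
        and eq: "\<rho>' i x = \<rho>' j y"
      note xy' = xy[unfolded num_atoms_circuit] and ij' = ij[unfolded len']
      have "(i div (a + 1), mu (i mod (a + 1)) x) = (j div (a + 1), mu (j mod (a + 1)) y)"
        using inj_onD[OF inj, of "(i div (a + 1), mu (i mod (a + 1)) x)" "(j div (a + 1), mu (j mod (a + 1)) y)"]
          eq q[OF ij'(1)] q[OF ij'(2)] mu_less xy' by (simp add: \<rho>'_def)
      then have "i div (a + 1) = j div (a + 1)" "i mod (a + 1) = j mod (a + 1)" "x = y"
        using mu_inj[OF q(2)[OF ij'(1)] q(2)[OF ij'(2)] xy'] by auto
      then show "i = j \<and> x = y" by (metis div_mult_mod_eq)
    qed
  qed
  have at: "atoms ?\<psi> \<subseteq> atoms ?\<phi>"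
  proof
    fix y assume "y \<in> atoms ?\<psi>"
    then obtain p where p: "p < R" "y \<in> atoms (rename (\<rho>' p) (tau ?D (bs' ! p)))"
      unfolding family_disj_def atoms_Disj len' by auto
    then obtain x where x: "x \<in> atoms (tau ?D (bs' ! p))" "y = \<rho>' p x"
      by (auto simp: form.set_map)
    then have "x < n + S" using atoms_tau_circuit[of Cn] num_atoms_circuit by auto
    with q[OF p(1)] have "mu (p mod (a + 1)) x \<in> atoms (tau ?G (bs ! (p div (a + 1))))"
      by (intro mu_in_atoms len)
    then have "y \<in> atoms (rename (\<rho> (p div (a + 1))) (tau ?G (bs ! (p div (a + 1)))))"
      unfolding x(2) \<rho>'_def form.set_map by (rule imageI)
    then show "y \<in> atoms ?\<phi>"
      using q(1)[OF p(1)] unfolding family_disj_def atoms_Disj by auto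
  qed
  have b': "bs' ! p = cut (bs ! (p div (a + 1))) (p mod (a + 1))" if "p < R" for p
    using that by (simp add: bs'_def)
  have sz': "sz (tau ?D (bs' ! p)) \<le> ?T - 1" "?m \<le> sz (tau ?D (bs' ! p))" if "p < R" for p
    using sz_tau_circuit[OF length_cut[OF q(2)[OF that] len[OF q(1)[OF that]]]] b'[OF that] by auto
  have sz\<psi>: "sz ?\<psi> \<le> R * ?T + 1"
  proof -
    let ?l = "map (\<lambda>i. rename (\<rho>' i) (tau ?D (bs' ! i))) [0..<length bs']"
    have "sz (Disj ?l) \<le> length ?l * ((?T - 1) + 1) + 1"
      using sz' by (intro sz_Disj_le) (auto simp: len')
    then show ?thesis by (simp add: family_disj_def len' add.commute)
  qed
  have "R * ?T + 1 \<le> (?r + 1) * ((a + 1) * ?T) + 1" by (simp add: R_def algebra_simps)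
  then have sz\<psi>M: "sz ?\<psi> \<le> M" using sz\<psi> M by linarith
  have m\<psi>: "?m \<le> sz ?\<psi>"
  proof -
    have R0: "0 < R" using r by (simp add: R_def)
    then have "rename (\<rho>' 0) (tau ?D (bs' ! 0)) \<in> set (map (\<lambda>i. rename (\<rho>' i) (tau ?D (bs' ! i))) [0..<length bs'])"
      by (auto simp: len')
    from sz_le_sz_Disj[OF this] show ?thesis
      using sz'(2)[OF R0] unfolding family_disj_def by simp
  qed
  define X where "X i = rename (\<rho> i) (inst (vt (bs ! i)) (tau ?G (bs ! i)))" for i
  have src: "inst \<theta> ?\<phi> = Disj (map X [0..<?r])"
  proof -
    have "inst \<theta> (rename (\<rho> i) (tau ?G (bs ! i))) = X i" if "i < ?r" for i
      unfolding X_def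
      using atoms_tau_gad_CV[OF k_pos, of "bs ! i", folded a] \<theta>[OF that]
      by (intro inst_rename) auto
    then show ?thesis unfolding family_disj_def inst_Disj map_map comp_def
      by (intro arg_cong[where f = Disj] map_cong) auto
  qed
  have szX: "sz (X i) \<le> sz ?\<phi>" if "i < ?r" for i
    using sz_le_sz_Disj[of "X i" "map X [0..<?r]"] that src sz_inst[of \<theta> ?\<phi>] by auto
  have step: "fprov (225 * (K0 * (M * M * M))) (Imp (X i) ?\<psi>)" if i: "i < ?r" for i
  proof -
    let ?K = "K0 * M"
    let ?Y = "rename (\<rho> i) (target (bs ! i))"
    have tM: "sz (target (bs ! i)) \<le> (a + 1) * ?T + 1"
      by (rule sz_target[OF len[OF i]])
    have "1 * ((a + 1) * ?T) \<le> (?r + 1) * ((a + 1) * ?T)" by (intro mult_right_mono) auto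
    then have tM': "sz (X i) + sz (target (bs ! i)) + 15 \<le> M" using tM M szX[OF i] by linarith
    have "fprov (220 * (K0 * (M * M * M))) (Imp (inst (vt (bs ! i)) (tau ?G (bs ! i))) (target (bs ! i)))"
      using tM' by (intro fprov_target[OF len[OF i]]) (simp add: X_def)
    from fprov_rename[OF this, of "\<rho> i"]
    have 1: "fprov (220 * (K0 * (M * M * M))) (Imp (X i) ?Y)" by (simp add: X_def)
    let ?l = "map (\<lambda>s. rename (\<rho> i) (rename (mu s) (tau ?D (cut (bs ! i) s)))) [0..<a + 1]"
    have Y: "?Y = Disj ?l" unfolding target_def rename_Disj by (simp add: comp_def del: upt_Suc)
    have szY: "sz ?Y \<le> M" "sz (X i) \<le> M" using tM' by auto
    have "fprov (2 * (?K * M)) (Imp \<chi> ?\<psi>)" if mem: "\<chi> \<in> set ?l" for \<chi>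
    proof -
      obtain s where s: "s \<le> a" "\<chi> = rename (\<rho> i) (rename (mu s) (tau ?D (cut (bs ! i) s)))"
        using mem by (auto simp del: upt_Suc simp: less_Suc_eq_le)
      let ?q = "i * (a + 1) + s"
      have "?q < (?r - 1 + 1) * (a + 1)" using i s by (intro block_less) auto
      moreover have "?r - 1 + 1 = ?r" using r by simp
      ultimately have qR: "?q < R" unfolding R_def by (simp only:)
      have dm: "?q div (a + 1) = i" "?q mod (a + 1) = s" using div_mod_block[of s "a + 1" i] s by auto
      have "\<chi> = rename (\<rho>' ?q) (tau ?D (bs' ! ?q))"
        unfolding b'[OF qR] \<rho>'_def dm s(2) form.map_comp comp_def ..
      then have mem': "\<chi> \<in> set (map (\<lambda>i. rename (\<rho>' i) (tau ?D (bs' ! i))) [0..<length bs'])"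
        using qR by (auto simp: len')
      have le: "R \<le> M"
        using length_le_sz_Disj[of "map (\<lambda>i. rename (\<rho>' i) (tau ?D (bs' ! i))) [0..<length bs']"] sz\<psi>M
        by (simp add: family_disj_def len')
      have "fprov (R * (2 * ?K)) (Imp \<chi> ?\<psi>)"
        using fprov_DisjI[OF mem', of M] sz\<psi>M by (simp add: family_disj_def len')
      then show ?thesis by (rule fprov_mono) (use le in \<open>simp add: algebra_simps\<close>)
    qed
    then have 2: "fprov ((length ?l + 1) * (2 * (?K * M) + ?K)) (Imp ?Y ?\<psi>)"
      using szY unfolding Y by (intro fprov_DisjE[OF sz\<psi>M])
    have "length ?l \<le> sz (target (bs ! i))" using length_le_sz_Disj[of ?l] unfolding Y[symmetric] sz_rename .
    then have "length ?l + 1 \<le> M" using tM' by linarith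
    moreover have "?K \<le> ?K * M" using tM' by simp
    ultimately have "(length ?l + 1) * (2 * (?K * M) + ?K) \<le> M * (3 * (?K * M))"
      by (intro mult_mono) auto
    also have "\<dots> = 3 * (K0 * (M * M * M))" by (simp add: algebra_simps)
    finally have 2: "fprov (3 * (K0 * (M * M * M))) (Imp ?Y ?\<psi>)"
      using 2 by (rule fprov_mono[rotated])
    from fprov_trans[OF szY(2,1) sz\<psi>M 1 2] show ?thesis
    proof (rule fprov_mono)
      have "?K * 1 \<le> ?K * (M * M)" using tM' by (intro mult_left_mono) auto
      then show "220 * (K0 * (M * M * M)) + 3 * (K0 * (M * M * M)) + ?K \<le> 225 * (K0 * (M * M * M))"
        by (simp add: algebra_simps)
    qed
  qed
  have "fprov ((length (map X [0..<?r]) + 1) * (225 * (K0 * (M * M * M)) + K0 * M)) (Imp (Disj (map X [0..<?r])) ?\<psi>)"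
    using step M src sz_inst[of \<theta> ?\<phi>] by (intro fprov_DisjE[OF sz\<psi>M]) auto
  then have "fprov (230 * (K0 * (M * M * M * M))) (Imp (inst \<theta> ?\<phi>) ?\<psi>)"
    unfolding src
  proof (rule fprov_mono)
    have rM: "?r + 1 \<le> M"
      using length_le_sz_Disj[of "map X [0..<?r]"] src sz_inst[of \<theta> ?\<phi>] M by simp
    have "K0 * M * 1 \<le> K0 * M * (M * M)" using rM by (intro mult_left_mono) auto
    then have "(length (map X [0..<?r]) + 1) * (225 * (K0 * (M * M * M)) + K0 * M) \<le> M * (226 * (K0 * (M * M * M)))"
      using rM by (intro mult_mono) (auto simp: algebra_simps)
    then show "(length (map X [0..<?r]) + 1) * (225 * (K0 * (M * M * M)) + K0 * M) \<le> 230 * (K0 * (M * M * M * M))"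
      by (simp add: algebra_simps)
  qed
  with dn at m\<psi> show ?thesis by blast
qed

end

section \<open>The reduction\<close>

text \<open>\<open>simulates\<close> speaks only of tautologies, so the implication proved in Frege
  must be known to be one.\<close>

lemma fprov_sound: "fprov n \<phi> \<Longrightarrow> tautology \<phi>"
proof (induction rule: fprov.induct)
  case (fprov_ax \<phi> n)
  then show ?case by (induction rule: frege_axiom.induct) (auto simp: tautology_def)
qed (auto simp: tautology_def)

section \<open>Polynomial bounds and the space for a description\<close>

lemma enat_power: "enat x ^ c = enat (x ^ c)"
  by (induction c) (auto simp: one_enat_def)

lemma enat_power_le: "x \<le> enat y \<Longrightarrow> x ^ c \<le> enat (y ^ c)"
proof -
  assume "x \<le> enat y"
  then obtain x' where "x = enat x'" "x' \<le> y" by (cases x) auto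
  then show ?thesis by (simp add: enat_power power_mono)
qed

text \<open>This rule and the next three read off an exponent from the shape of an expression, so
  that a bound by some power of \<open>m\<close> can be found without naming the exponent.\<close>

lemma pow_add:
  assumes "2 \<le> (m::nat)" "x \<le> m ^ i" "y \<le> m ^ j"
  shows "x + y \<le> m ^ (i + j + 1)"
proof -
  have "m ^ i \<le> m ^ (i + j)" "m ^ j \<le> m ^ (i + j)" using assms(1) by (auto intro: power_increasing)
  then have "x + y \<le> 2 * m ^ (i + j)" using assms by linarith
  also have "\<dots> \<le> m * m ^ (i + j)" using assms(1) by (rule mult_right_mono) simp
  finally show ?thesis by simp
qed

lemma pow_mult: "x \<le> (m::nat) ^ i \<Longrightarrow> y \<le> m ^ j \<Longrightarrow> x * y \<le> m ^ (i + j)"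
  unfolding power_add by (rule mult_mono) auto

lemma pow_pow: "x \<le> (m::nat) ^ i \<Longrightarrow> x ^ c \<le> m ^ (i * c)"
  unfolding power_mult by (rule power_mono) auto

lemma pow_const: "2 \<le> (m::nat) \<Longrightarrow> c \<le> m ^ c"
proof -
  assume "2 \<le> m"
  then have "2 ^ c \<le> m ^ c" by (rule power_mono) simp
  then show ?thesis using less_exp[of c] by linarith
qed

text \<open>True from 12 on (2862 against 4096) but not at 11 (2450 against 2048). The left side
  bounds k(k + 1) for k up to 4j + 5.\<close>

lemma quadratic_le_exp: "12 \<le> j \<Longrightarrow> (4 * j + 5) * (4 * j + 6) \<le> (2::nat) ^ j"
proof (induction j rule: dec_induct)
  case (step j)
  have "(4 * Suc j + 5) * (4 * Suc j + 6) \<le> 2 * ((4 * j + 5) * (4 * j + 6))"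
  proof -
    have "12 * j \<le> j * j" using step by (intro mult_right_mono) auto
    then show ?thesis using step by (simp add: algebra_simps)
  qed
  with step show ?case by simp
qed simp

text \<open>Addresses are logarithmic in \<open>k\<close>, but it is enough that their length w is
  at most about k/4: the k + 1 outputs and k gates then need at most k(4w + 2) bits. The threshold
  is 50 = 4 * 12 + 2, with 12 from \<open>quadratic_le_exp\<close>.\<close>

lemma room_for_description:
  assumes "50 \<le> k"
  shows "(k + 1) * addr_len (k\<^sup>2) k + k * (2 + 2 * addr_len (k\<^sup>2) k) \<le> k\<^sup>2"
proof -
  define j where "j = (k - 2) div 4"
  have j: "4 * j + 2 \<le> k" "k \<le> 4 * j + 5" "12 \<le> j" using assms by (auto simp: j_def)
  have "k\<^sup>2 + k = k * (k + 1)" by (simp add: power2_eq_square)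
  also have "\<dots> \<le> (4 * j + 5) * (4 * j + 6)" using j by (intro mult_mono) auto
  also have "\<dots> \<le> 2 ^ j" using quadratic_le_exp[OF j(3)] .
  finally have w: "addr_len (k\<^sup>2) k \<le> j" by (rule addr_len_le)
  have "(k + 1) * addr_len (k\<^sup>2) k + k * (2 + 2 * addr_len (k\<^sup>2) k) \<le> (2 * k) * j + k * (2 + 2 * j)"
    using w assms by (intro add_mono mult_mono) auto
  also have "\<dots> = k * (4 * j + 2)" by (simp add: algebra_simps)
  also have "\<dots> \<le> k * k" using j by (intro mult_left_mono) auto
  finally show ?thesis by (simp add: power2_eq_square)
qed

lemma root_exists:
  assumes "1 \<le> e"
  shows "\<exists>n::nat. n ^ e \<le> k \<and> k < (n + 1) ^ e"
proof -
  let ?n = "LEAST n. k < (n + 1) ^ e"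
  have ex: "k < (k + 1) ^ e" using assms self_le_power[of "k + 1" e] by simp
  then have 1: "k < (?n + 1) ^ e" by (rule LeastI)
  have "?n ^ e \<le> k"
  proof (cases ?n)
    case 0
    then show ?thesis using assms by (simp add: zero_power)
  next
    case (Suc n')
    then show ?thesis using not_less_Least[of n' "\<lambda>n. k < (n + 1) ^ e"] by simp
  qed
  with 1 show ?thesis by blast
qed

definition vee_set :: "(bool list \<Rightarrow> bool list \<Rightarrow> bool) \<Rightarrow> (nat \<Rightarrow> defseq) \<Rightarrow> nat \<Rightarrow> fm set" where
  "vee_set P D c = {\<phi>. \<exists>k bs \<rho>. k \<ge> 1 \<and> disjoint_names (D k) bs \<rho> \<and> \<phi> = family_disj (D k) bs \<rho> \<and>
     min_size P \<phi> \<le> enat (length (outs (D k)) ^ c)}"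

lemma vee_hard_iff: "vee_hard P D \<longleftrightarrow> (\<forall>c \<ge> 1. finite (vee_set P D c))"
  unfolding vee_hard_def vee_set_def disjoint_names_def family_disj_def by (simp only: conj_assoc)

text \<open>A single \<tau> is a disjunction of length 1 under the identical naming. Its size is at
  most the 17th power of the output length, which converts the exponent; the \<open>+ 1\<close>
  meets the demand for exponents at least 1.\<close>

lemma vee_hard_imp_hard_gad_CV:
  assumes "vee_hard P (\<lambda>k. gad_CV (k\<^sup>2) k)"
  shows "hard P (\<lambda>k. gad_CV (k\<^sup>2) k)"
  unfolding hard_def
proof
  fix c
  let ?D = "\<lambda>k. gad_CV (k\<^sup>2) k"
  show "finite {\<phi>. \<exists>k b. k \<ge> 1 \<and> length b = length (outs (?D k)) \<and> \<phi> = tau (?D k) b \<and>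
                       min_size P \<phi> \<le> enat (fm_size \<phi> ^ c)}" (is "finite ?H")
  proof (rule finite_subset)
    show "finite (vee_set P ?D (17 * c + 1))" using assms by (simp add: vee_hard_iff)
    show "?H \<subseteq> vee_set P ?D (17 * c + 1)"
    proof
      fix \<phi> assume "\<phi> \<in> ?H"
      then obtain k b where k: "1 \<le> k" "length b = length (outs (?D k))" "\<phi> = tau (?D k) b"
        "min_size P \<phi> \<le> enat (fm_size \<phi> ^ c)" by auto
      let ?M = "length (outs (?D k))"
      have "fm_size \<phi> \<le> ?M ^ 17"
        unfolding k(3) length_gad_CV_outs by (rule fm_size_tau_gad_CV[OF k(1)])
      then have "fm_size \<phi> ^ c \<le> ?M ^ (17 * c)" by (rule pow_pow)
      also have "\<dots> \<le> ?M ^ (17 * c + 1)"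
        using M_bounds(1)[OF k(1)] unfolding length_gad_CV_outs by (intro power_increasing) auto
      finally have "min_size P \<phi> \<le> enat (?M ^ (17 * c + 1))"
        using k(4) by (meson enat_ord_simps(1) order_trans)
      moreover have "\<phi> = family_disj (?D k) [b] (\<lambda>_ x. x)"
        by (simp add: family_disj_def k(3) form.map_ident)
      moreover have "disjoint_names (?D k) [b] (\<lambda>_ x. x)"
        using k(2) by (auto simp: disjoint_names_def inj_on_def)
      ultimately show "\<phi> \<in> vee_set P ?D (17 * c + 1)"
        using k(1) unfolding vee_set_def by blast
    qed
  qed
qed

text \<open>The inner exponent \<open>c\<close> stems from the substitution of constants,
  \<open>c0\<close> from the simulation of EF, and the outer \<open>c\<close> from modus ponens;
  \<open>F\<close> is the size of the gadget disjunction and \<open>F + 3\<close> the cost per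
  symbol of the EF proof. The exponent \<open>E\<close> must not depend on \<open>m\<close>,
  \<open>k\<close>, \<open>S\<close>, \<open>F\<close>, and is assembled from the fixed exponents
  alone.\<close>

lemma size_bound:
  "\<exists>E. \<forall>m k S F. 2 \<le> m \<longrightarrow> k \<le> m ^ e \<longrightarrow> S \<le> m ^ e \<longrightarrow> F \<le> (((k\<^sup>2 + 1) * (k + 1)) ^ c1) ^ d2 + d2 \<longrightarrow>
     ((((k\<^sup>2 + 1) * (k + 1)) ^ c1) ^ c +
      (let M = F + (F + 1) * ((k\<^sup>2 + 1) * (12 * S + 3 * m + 4)) + 20
       in 230 * (K * (M * M * M * M)) * (F + 3)) ^ c0) ^ c \<le> (m::nat) ^ E"
proof -
  have "\<exists>E. \<forall>m k S F. 2 \<le> m \<longrightarrow> k \<le> m ^ e \<longrightarrow> S \<le> m ^ e \<longrightarrow> F \<le> m ^ i \<longrightarrow>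
     ((((k\<^sup>2 + 1) * (k + 1)) ^ c1) ^ c +
      (let M = F + (F + 1) * ((k\<^sup>2 + 1) * (12 * S + 3 * m + 4)) + 20
       in 230 * (K * (M * M * M * M)) * (F + 3)) ^ c0) ^ c \<le> (m::nat) ^ E" for i
    unfolding Let_def
    by (rule exI, intro allI impI)
       (assumption | rule pow_pow pow_add pow_mult eq_refl[OF power_one_right[symmetric]] pow_const)+
  moreover have "\<exists>i. \<forall>m k F. 2 \<le> m \<longrightarrow> k \<le> m ^ e \<longrightarrow> F \<le> (((k\<^sup>2 + 1) * (k + 1)) ^ c1) ^ d2 + d2 \<longrightarrow> F \<le> (m::nat) ^ i"
    by (rule exI, intro allI impI, erule order_trans) (assumption | rule pow_pow pow_add pow_mult pow_const)+
  ultimately show ?thesis by meson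
qed

lemma vee_hard_gad_CV:
  fixes P :: "bool list \<Rightarrow> bool list \<Rightarrow> bool"
    and c :: nat
    and g :: "bool list \<Rightarrow> bool list"
    and m :: "nat \<Rightarrow> nat"
    and C :: "nat \<Rightarrow> circuit"
  assumes pps: "pps P"
    and sim: "simulates P EF"
    and subst: "\<And>\<sigma> \<theta>. tautology \<sigma> \<Longrightarrow> min_size P (inst \<theta> \<sigma>) \<le> min_size P \<sigma> ^ c"
    and mp: "\<And>\<alpha> \<beta>. min_size P \<beta> \<le> (min_size P \<alpha> + min_size P (Imp \<alpha> \<beta>)) ^ c"
    and g_ptime: "ptime_fun g"
    and g_stretch: "\<And>x. length (g x) = m (length x)" "\<And>n. m n > n"
    and C_inputs: "\<And>n. inputs (C n) = n"
    and C_computes: "generator (\<lambda>n. g) (\<lambda>n. defseq_of (C n))"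
    and g_hard: "vee_hard P (\<lambda>n. defseq_of (C n))"
  shows "vee_hard P (\<lambda>k. gad_CV (k\<^sup>2) k)"
  unfolding vee_hard_iff
proof (intro allI impI)
  fix c1 :: nat assume "1 \<le> c1"
  let ?D = "\<lambda>n. defseq_of (C n)" and ?G = "\<lambda>k. gad_CV (k\<^sup>2) k"
  let ?M = "\<lambda>k::nat. (k\<^sup>2 + 1) * (k + 1)"
  obtain d0 where d0: "\<And>n. 1 \<le> n \<Longrightarrow> defseq_size (?D n) \<le> length (outs (?D n)) ^ d0"
    using C_computes by (auto simp: generator_def)
  obtain d1 where d1: "\<And>x. length (g x) \<le> length x + length x ^ d1 + d1"
    using ptime_fun_length[OF g_ptime] by blast
  obtain d2 where d2: "\<And>\<phi> x. P x (enc \<phi>) \<Longrightarrow> fm_size \<phi> \<le> length x ^ d2 + d2"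
    using pps_fm_size[OF pps] by blast
  obtain c0 where c0: "\<And>\<sigma>. tautology \<sigma> \<Longrightarrow> min_size P \<sigma> \<le> min_size EF \<sigma> ^ c0"
    using sim by (auto simp: simulates_def)
  have outs: "length (outputs (C n)) = m n" if "1 \<le> n" for n
  proof -
    have "defseq_eval (?D n) (replicate n False) = g (replicate n False)"
      using C_computes that by (auto simp: generator_def defseq_of_def C_inputs)
    from arg_cong[OF this, of length] have "length (outs (?D n)) = m n"
      using g_stretch(1)[of "replicate n False"] by (simp add: defseq_eval_def)
    then show ?thesis by (simp add: defseq_of_def)
  qed
  have outs': "length (outs (?D n)) = m n" if "1 \<le> n" for n
    using outs[OF that] by (simp add: defseq_of_def)
  \<comment> \<open>The exponent that two uses of \<open>pow_add\<close> produce for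
    \<open>n + n ^ d1 + d1\<close>.\<close>
  define e1 where "e1 = 1 + d1 + 1 + d1 + 1"
  \<comment> \<open>The product \<open>e1 * d0\<close> bounds the number of gates;
    \<open>d0 + 1\<close> also keeps the exponent positive, as taking roots requires.\<close>
  define e where "e = e1 * (d0 + 1)"
  have e_pos: "1 \<le> e" by (simp add: e_def e1_def)
  have m_le: "m n \<le> n ^ e1" if "2 \<le> n" for n
  proof -
    have "m n \<le> n + n ^ d1 + d1"
      using d1[of "replicate n False"] g_stretch(1)[of "replicate n False"] by simp
    also have "\<dots> \<le> n ^ e1"
      unfolding e1_def using that by (intro pow_add pow_const) auto
    finally show ?thesis .
  qed
  have S_le: "length (gates (C n)) \<le> n ^ e" if "2 \<le> n" for n
  proof -
    have "length (gates (C n)) = length (defs (?D n))" by (simp add: defseq_of_def)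
    also have "\<dots> = (\<Sum>\<phi>\<leftarrow>defs (?D n). 1)" by (simp add: sum_list_triv)
    also have "\<dots> \<le> sum_list (map fm_size (defs (?D n)))"
      by (intro sum_list_mono order_trans[OF sz_pos(1) sz_le_fm_size])
    also have "\<dots> \<le> defseq_size (?D n)" by (simp add: defseq_size_def)
    also have "\<dots> \<le> m n ^ d0" using d0[of n] outs'[of n] that by simp
    also have "\<dots> \<le> n ^ (e1 * d0)" by (rule pow_pow[OF m_le[OF that]])
    also have "\<dots> \<le> n ^ e" using that by (intro power_increasing) (auto simp: e_def)
    finally show ?thesis .
  qed
  \<comment> \<open>The exponent \<open>2 * e\<close> arises because \<open>k\<close> is below
    \<open>(n + 1) ^ e\<close> and n + 1 is at most n^2, which is at most the square of the output
    length.\<close>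
  obtain E where E: "\<And>m k S F. 2 \<le> m \<Longrightarrow> k \<le> m ^ (2 * e) \<Longrightarrow> S \<le> m ^ (2 * e) \<Longrightarrow> F \<le> (?M k ^ c1) ^ d2 + d2 \<Longrightarrow>
     ((?M k ^ c1) ^ c +
      (let M = F + (F + 1) * ((k\<^sup>2 + 1) * (12 * S + 3 * m + 4)) + 20
       in 230 * (K0 * (M * M * M * M)) * (F + 3)) ^ c0) ^ c \<le> m ^ E"
    using size_bound[of "2 * e" c1 d2 c K0 c0] by blast
  have fin: "finite (vee_set P ?D (E + 1))"
    using g_hard by (simp add: vee_hard_iff)
  \<comment> \<open>For the fixed exponent \<open>E + 1\<close> only finitely many disjunctions for
    \<open>g\<close> have short proofs, so one bound covers their sizes. Large \<open>k\<close> will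
    produce a disjunction that exceeds it.\<close>
  then obtain Bf where Bf: "\<And>\<psi>. \<psi> \<in> vee_set P ?D (E + 1) \<Longrightarrow> sz \<psi> \<le> Bf"
    using finite_imageI[OF fin, of sz] unfolding finite_nat_set_iff_bounded_le by blast
  \<comment> \<open>Beyond 50 the description fits, beyond \<open>2 ^ e\<close> the root
    \<open>n\<close> is at least 2, and beyond \<open>(Bf + 1) ^ e\<close> the root exceeds
    \<open>Bf\<close>.\<close>
  define Kb where "Kb = max (max 50 (2 ^ e)) ((Bf + 1) ^ e)"
  show "finite (vee_set P ?G c1)"
  \<comment> \<open>The code length of \<phi> is polynomial in the length of its proof and hence in
    \<open>k\<close>, so a bound on \<open>k\<close> suffices for finiteness.\<close>
  proof (rule finite_subset[OF _ finite_fm_size_le], rule subsetI, rule CollectI)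
    fix \<phi> assume "\<phi> \<in> vee_set P ?G c1"
    then obtain k bs \<rho> where k: "1 \<le> k" and bs: "disjoint_names (?G k) bs \<rho>"
      and \<phi>: "\<phi> = family_disj (?G k) bs \<rho>" and "min_size P \<phi> \<le> enat (length (outs (?G k)) ^ c1)"
      unfolding vee_set_def by blast
    then have min: "min_size P \<phi> \<le> enat (?M k ^ c1)" by (simp only: length_gad_CV_outs)
    then obtain x where x: "P x (enc \<phi>)" "length x \<le> ?M k ^ c1" by (rule min_size_leE)
    have "enc \<phi> \<in> TAUT" using pps x(1) by (auto simp: pps_def)
    then have taut: "tautology \<phi>" using inj_enc by (auto simp: TAUT_def dest: injD)
    define F where "F = fm_size \<phi>"
    have F: "F \<le> (?M k ^ c1) ^ d2 + d2"
      using d2[OF x(1)] power_mono[OF x(2), of d2] unfolding F_def by linarith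
    have "k \<le> Kb"
    proof (rule ccontr)
      assume "\<not> k \<le> Kb"
      then have big: "50 \<le> k" "2 ^ e \<le> k" "(Bf + 1) ^ e \<le> k" by (auto simp: Kb_def)
      obtain n where rt: "n ^ e \<le> k" "k < (n + 1) ^ e" using root_exists[OF e_pos] by blast
      have "(2::nat) ^ e < (n + 1) ^ e" using big(2) rt(2) by simp
      then have "2 < n + 1" by (rule power_less_imp_less_base) simp
      then have n2: "2 \<le> n" by simp
      define S where "S = length (gates (C n))"
      let ?w = "addr_len (k\<^sup>2) k" and ?N = "num_gates (k\<^sup>2) k"
      have Sk: "S \<le> k" using S_le[OF n2] rt(1) by (simp add: S_def)
      have nk: "n \<le> k" using self_le_power[of n e] e_pos n2 rt(1) by linarith
      note room = room_for_description[OF big(1)]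
      have "S * (2 + 2 * ?w) \<le> k * (2 + 2 * ?w)" using Sk by (rule mult_right_mono) simp
      then have "S * (2 + 2 * ?w) \<le> k\<^sup>2 - (k + 1) * ?w" using room by linarith
      then have SN: "S \<le> ?N" unfolding num_gates_def
        by (subst less_eq_div_iff_mult_less_eq) auto
      interpret embedding "C n" "k\<^sup>2" k n S ?w ?N
        using k nk SN room outs[of n] g_stretch(2)[of n] n2
        by unfold_locales (auto simp: C_inputs S_def)
      have mn: "2 \<le> m n" "n < m n" "n \<le> m n" using g_stretch(2)[of n] n2 by auto
      define M where "M = F + (F + 1) * ((k\<^sup>2 + 1) * (12 * S + 3 * m n + 4)) + 20"
      have "length bs \<le> sz \<phi>"
        unfolding \<phi> family_disj_def using length_le_sz_Disj[of "map (\<lambda>i. rename (\<rho> i) (tau (?G k) (bs ! i))) [0..<length bs]"]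
        by simp
      then have r: "length bs \<le> F" "sz \<phi> \<le> F" using sz_le_fm_size[of \<phi>] unfolding F_def by linarith+
      have "sz \<phi> + (length bs + 1) * ((k\<^sup>2 + 1) * (12 * S + 3 * length (outputs (C n)) + 4)) + 20 \<le> M"
        unfolding M_def using r n2 by (subst outs) (auto intro!: add_mono mult_right_mono)
      then obtain \<theta> bs' \<rho>' where bs': "disjoint_names (?D n) bs' \<rho>'"
        and at: "atoms (family_disj (?D n) bs' \<rho>') \<subseteq> atoms \<phi>"
        and szm: "length (outputs (C n)) \<le> sz (family_disj (?D n) bs' \<rho>')"
        and pr: "fprov (230 * (K0 * (M * M * M * M))) (Imp (inst \<theta> \<phi>) (family_disj (?D n) bs' \<rho>'))"
        using reduction[OF refl bs, of M] unfolding \<phi> by blast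
      define \<psi> where "\<psi> = family_disj (?D n) bs' \<rho>'"
      note at = at[folded \<psi>_def] and szm = szm[folded \<psi>_def] and pr = pr[folded \<psi>_def]
      let ?Q = "230 * (K0 * (M * M * M * M)) * (F + 3)"
      have "length (enc_nat y) \<le> F" if "y \<in> atoms (Imp (inst \<theta> \<phi>) \<psi>)" for y
        using that at atoms_inst[of \<theta> \<phi>] atom_le_fm_size[of y \<phi>] unfolding F_def by auto
      from min_size_EF_le[OF pr this] have "min_size EF (Imp (inst \<theta> \<phi>) \<psi>) \<le> enat ?Q" .
      then have "min_size EF (Imp (inst \<theta> \<phi>) \<psi>) ^ c0 \<le> enat (?Q ^ c0)" by (rule enat_power_le)
      with c0[OF fprov_sound[OF pr]] have "min_size P (Imp (inst \<theta> \<phi>) \<psi>) \<le> enat (?Q ^ c0)"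
        by (rule order_trans)
      moreover have "min_size P (inst \<theta> \<phi>) \<le> enat ((?M k ^ c1) ^ c)"
        using subst[OF taut, of \<theta>] enat_power_le[OF min, of c] by (rule order_trans)
      ultimately have "min_size P (inst \<theta> \<phi>) + min_size P (Imp (inst \<theta> \<phi>) \<psi>) \<le> enat ((?M k ^ c1) ^ c + ?Q ^ c0)"
        using add_mono[of "min_size P (inst \<theta> \<phi>)" "enat ((?M k ^ c1) ^ c)" _ "enat (?Q ^ c0)"]
        unfolding plus_enat_simps by blast
      then have "(min_size P (inst \<theta> \<phi>) + min_size P (Imp (inst \<theta> \<phi>) \<psi>)) ^ c \<le> enat (((?M k ^ c1) ^ c + ?Q ^ c0) ^ c)"
        by (rule enat_power_le)
      with mp have "min_size P \<psi> \<le> enat (((?M k ^ c1) ^ c + ?Q ^ c0) ^ c)" by (rule order_trans)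
      moreover have "((?M k ^ c1) ^ c + ?Q ^ c0) ^ c \<le> m n ^ (E + 1)"
      proof -
        have "n + 1 \<le> n * n" using n2 mult_right_mono[OF n2, of n] by linarith
        then have "n + 1 \<le> n ^ 2" by (simp add: power2_eq_square)
        also have "\<dots> \<le> m n ^ 2" using mn(3) by (rule power_mono) simp
        finally have "(n + 1) ^ e \<le> m n ^ (2 * e)" by (rule pow_pow)
        then have "k \<le> m n ^ (2 * e)" using rt(2) by linarith
        with E[OF mn(1) _ _ F, of S] Sk
        have "((?M k ^ c1) ^ c + ?Q ^ c0) ^ c \<le> m n ^ E" unfolding Let_def M_def by linarith
        also have "\<dots> \<le> m n ^ (E + 1)" using mn(1) by (intro power_increasing) auto
        finally show ?thesis .
      qed
      ultimately have "min_size P \<psi> \<le> enat (m n ^ (E + 1))" by (meson enat_ord_simps(1) order_trans)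
      then have "\<psi> \<in> vee_set P ?D (E + 1)"
        unfolding vee_set_def using bs' n2 outs'[of n] \<psi>_def
        by (intro CollectI exI[of _ n] exI[of _ bs'] exI[of _ \<rho>']) auto
      then have "sz \<psi> \<le> Bf" by (rule Bf)
      \<comment> \<open>\<psi> has at least as many symbols as \<open>g\<close> has output bits, and
        these are more than \<open>n\<close>.\<close>
      then have "n + 1 \<le> Bf + 1" using szm outs[of n] mn(2) n2 by simp
      then have "(n + 1) ^ e \<le> (Bf + 1) ^ e" by (rule power_mono) simp
      then show False using rt(2) big(3) by linarith
    qed
    then have "?M k \<le> ?M Kb" by (intro mult_mono add_mono power_mono) auto
    then have "(?M k ^ c1) ^ d2 + d2 \<le> (?M Kb ^ c1) ^ d2 + d2"
      by (intro add_mono power_mono) auto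
    then show "fm_size \<phi> \<le> (?M Kb ^ c1) ^ d2 + d2" using F unfolding F_def by linarith
  qed
qed

theorem theorem1p7:
  fixes P :: "bool list \<Rightarrow> bool list \<Rightarrow> bool"
    and c :: nat
    and g :: "bool list \<Rightarrow> bool list"
    and m :: "nat \<Rightarrow> nat"
    and C :: "nat \<Rightarrow> circuit"
  assumes pps: "pps P"
    and sim: "simulates P EF"
    and c: "c \<ge> 1"
    and subst: "\<And>\<sigma> \<theta>. tautology \<sigma> \<Longrightarrow> min_size P (inst \<theta> \<sigma>) \<le> min_size P \<sigma> ^ c"
    and mp: "\<And>\<alpha> \<beta>. min_size P \<beta> \<le> (min_size P \<alpha> + min_size P (Imp \<alpha> \<beta>)) ^ c"
    and g_ptime: "ptime_fun g"
    and g_stretch: "\<And>x. length (g x) = m (length x)" "\<And>n. m n > n"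
    and C_inputs: "\<And>n. inputs (C n) = n"
    and C_computes: "generator (\<lambda>n. g) (\<lambda>n. defseq_of (C n))"
    and g_hard: "vee_hard P (\<lambda>n. defseq_of (C n))"
  shows "generator (\<lambda>k. gad (k\<^sup>2) k (CV (k\<^sup>2) k)) (\<lambda>k. gad_CV (k\<^sup>2) k)
       \<and> vee_hard P (\<lambda>k. gad_CV (k\<^sup>2) k)
       \<and> hard P (\<lambda>k. gad_CV (k\<^sup>2) k)"
  using generator_gad_CV
    vee_hard_gad_CV[OF pps sim subst mp g_ptime g_stretch C_inputs C_computes g_hard]
    vee_hard_imp_hard_gad_CV
  by blast

end
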